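(* The property "Whitehead-trivial determinant" of discrete groups is stable under direct limits, stable under inverse limits, and subgroup stable. That is: (i) if $\pi$ is a direct limit of a directed system of groups each having Whitehead-trivial determinant, then $\pi$ has Whitehead-trivial determinant; (ii) if $\pi$ is an inverse limit of a directed (inverse) system of groups each having Whitehead-trivial determinant, then $\pi$ has Whitehead-trivial determinant; (iii) every subgroup of a group with Whitehead-trivial determinant has Whitehead-trivial determinant.
   Context: For a discrete group $\pi$, $\mathcal N\pi$ is the group von Neumann algebra, containing $\mathbb C\pi$ acting on $\ell^2(\pi)$ by left multiplication; $\operatorname{tr}_\pi(a)=(a\cdot1,1)_{\ell^2(\pi)}$ and $\operatorname{tr}_\pi((a_{ij}))=\sum_i\operatorname{tr}_\pi(a_{ii})$ for $(a_{ij})\in M(d\times d,\mathcal N\pi)$. Matrices act on $\ell^2(\pi)^d$ by left multiplication. For $\Delta\in M(d\times d,\mathcal N\pi)$ positive (semidefinite) self-adjoint, $F_\Delta(\lambda)=\operatorname{tr}_\pi\chi_{[0,\lambda]}(\Delta)$, and $\ln\det_\pi(\Delta)=\int_{0^+}^\infty\ln\lambda\,dF_\Delta(\lambda)$ if the integral converges, $-\infty$ otherwise. The group $\pi$ has Whitehead-trivial determinant if $\ln\det_\pi(A^*A)=0$ for all $A\in Wh(\pi)$, i.e. for every $d$ and every invertible $A\in Gl(d\times d,\mathbb Z\pi)$ ($\ln\det_\pi(\cdot^*\cdot)$ factors through the Whitehead group $Wh(\pi)$). *)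

theory Defs
  imports
    "HOL-Analysis.Analysis"
    "HOL-Algebra.Product_Groups"
    "HOL-Library.Poly_Mapping"
begin

text \<open>
  Vectors are functions on the whole index type that vanish off the index set, so that
  equality of vectors is equality of functions.
\<close>

definition ell2 :: "'i set \<Rightarrow> ('i \<Rightarrow> complex) set" where
  "ell2 S = {v. (\<forall>x. x \<notin> S \<longrightarrow> v x = 0) \<and> (\<lambda>x. (cmod (v x))\<^sup>2) summable_on S}"

definition ell2_inner :: "'i set \<Rightarrow> ('i \<Rightarrow> complex) \<Rightarrow> ('i \<Rightarrow> complex) \<Rightarrow> complex" where
  "ell2_inner S v w = (\<Sum>\<^sub>\<infinity>x\<in>S. v x * cnj (w x))"

text \<open>Linearity and boundedness follow from symmetry and idempotence.\<close>

definition orth_projection ::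
    "'i set \<Rightarrow> (('i \<Rightarrow> complex) \<Rightarrow> ('i \<Rightarrow> complex)) \<Rightarrow> bool" where
  "orth_projection S P \<longleftrightarrow>
     (\<forall>v\<in>ell2 S. P v \<in> ell2 S \<and> P (P v) = P v) \<and>
     (\<forall>v\<in>ell2 S. \<forall>w\<in>ell2 S. ell2_inner S (P v) w = ell2_inner S v (P w))"

definition projection_valued_measure ::
    "'i set \<Rightarrow> (real set \<Rightarrow> ('i \<Rightarrow> complex) \<Rightarrow> ('i \<Rightarrow> complex)) \<Rightarrow> bool" where
  "projection_valued_measure S E \<longleftrightarrow>
     (\<forall>B\<in>sets borel. orth_projection S (E B)) \<and>
     (\<forall>v\<in>ell2 S. E UNIV v = v) \<and>
     (\<forall>A\<in>sets borel. \<forall>B\<in>sets borel. \<forall>v\<in>ell2 S. E (A \<inter> B) v = E A (E B v)) \<and>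
     (\<forall>B :: nat \<Rightarrow> real set. range B \<subseteq> sets borel \<longrightarrow> disjoint_family B \<longrightarrow>
        (\<forall>v\<in>ell2 S. \<forall>w\<in>ell2 S.
           (\<lambda>n. ell2_inner S (E (B n) v) w) sums ell2_inner S (E (\<Union>n. B n) v) w))"

definition pvm_measure ::
    "'i set \<Rightarrow> (real set \<Rightarrow> ('i \<Rightarrow> complex) \<Rightarrow> ('i \<Rightarrow> complex)) \<Rightarrow> ('i \<Rightarrow> complex) \<Rightarrow> real measure" where
  "pvm_measure S E v =
     measure_of UNIV (sets borel) (\<lambda>B. ennreal (Re (ell2_inner S (E B v) v)))"

text \<open>
  \<open>T = \<integral> t dE(t)\<close>, where \<open>E\<close> has compact support because only bounded operators \<open>T\<close>
  are considered.  By polarization it is enough to test the identity on the quadratic form.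
\<close>

definition is_spectral_measure ::
    "'i set \<Rightarrow> (('i \<Rightarrow> complex) \<Rightarrow> ('i \<Rightarrow> complex)) \<Rightarrow>
      (real set \<Rightarrow> ('i \<Rightarrow> complex) \<Rightarrow> ('i \<Rightarrow> complex)) \<Rightarrow> bool" where
  "is_spectral_measure S T E \<longleftrightarrow>
     projection_valued_measure S E \<and>
     (\<exists>K. \<forall>v\<in>ell2 S. E {-K..K} v = v) \<and>
     (\<forall>v\<in>ell2 S. ell2_inner S (T v) v = complex_of_real (LINT t|pvm_measure S E v. t))"

text \<open>
  The projection \<open>\<chi>\<^sub>B(T)\<close> of a bounded self-adjoint operator \<open>T\<close>, for a Borel set \<open>B\<close>.
  By the spectral theorem the spectral measure exists and is unique on Borel sets and on
  vectors in \<open>ell2 S\<close>.  It is not determined on other arguments, hence the choice operator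
  in place of a definite description.
\<close>

definition spectral_projection ::
    "'i set \<Rightarrow> (('i \<Rightarrow> complex) \<Rightarrow> ('i \<Rightarrow> complex)) \<Rightarrow> real set \<Rightarrow>
      ('i \<Rightarrow> complex) \<Rightarrow> ('i \<Rightarrow> complex)" where
  "spectral_projection S T = (SOME E. is_spectral_measure S T E)"

text \<open>\<open>\<ell>\<^sup>2(G)\<^sup>d\<close> is \<open>ell2 (ell2_index G d)\<close>.\<close>

definition ell2_index :: "('g, 'm) monoid_scheme \<Rightarrow> nat \<Rightarrow> (nat \<times> 'g) set" where
  "ell2_index G d = {..<d} \<times> carrier G"

definition unit_vec :: "('g, 'm) monoid_scheme \<Rightarrow> nat \<Rightarrow> nat \<times> 'g \<Rightarrow> complex" where
  "unit_vec G i = (\<lambda>p. if p = (i, \<one>\<^bsub>G\<^esub>) then 1 else 0)"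

text \<open>
  If \<open>T\<close> is given by a matrix \<open>(a\<^sub>i\<^sub>j)\<close> over the group von Neumann algebra, the summand
  for \<open>i\<close> is \<open>(a\<^sub>i\<^sub>i \<cdot> 1, 1)\<close>.
\<close>

definition vn_trace ::
    "('g, 'm) monoid_scheme \<Rightarrow> nat \<Rightarrow>
      ((nat \<times> 'g \<Rightarrow> complex) \<Rightarrow> (nat \<times> 'g \<Rightarrow> complex)) \<Rightarrow> complex" where
  "vn_trace G d T = (\<Sum>i<d. ell2_inner (ell2_index G d) (T (unit_vec G i)) (unit_vec G i))"

definition spectral_density ::
    "('g, 'm) monoid_scheme \<Rightarrow> nat \<Rightarrow>
      ((nat \<times> 'g \<Rightarrow> complex) \<Rightarrow> (nat \<times> 'g \<Rightarrow> complex)) \<Rightarrow> real \<Rightarrow> real" where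
  "spectral_density G d T l = Re (vn_trace G d (spectral_projection (ell2_index G d) T {0..l}))"

text \<open>
  The Stieltjes integral over \<open>(0, \<infinity>)\<close> leaves out the atom at \<open>0\<close>.  The spectrum of \<open>T\<close> is
  bounded, so the integral can only diverge at \<open>0\<close>, where \<open>ln\<close> has constant sign;
  convergence is therefore the same as integrability.
\<close>

definition ln_det ::
    "('g, 'm) monoid_scheme \<Rightarrow> nat \<Rightarrow>
      ((nat \<times> 'g \<Rightarrow> complex) \<Rightarrow> (nat \<times> 'g \<Rightarrow> complex)) \<Rightarrow> ereal" where
  "ln_det G d T =
     (let \<mu> = interval_measure (spectral_density G d T) in
        if set_integrable \<mu> {0<..} ln then ereal (LINT l:{0<..}|\<mu>. ln l) else -\<infinity>)"

definition group_ring :: "('g, 'm) monoid_scheme \<Rightarrow> ('g \<Rightarrow>\<^sub>0 int) set" where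
  "group_ring G = {a. Poly_Mapping.keys a \<subseteq> carrier G}"

definition gr_one :: "('g, 'm) monoid_scheme \<Rightarrow> 'g \<Rightarrow>\<^sub>0 int" where
  "gr_one G = Poly_Mapping.single \<one>\<^bsub>G\<^esub> 1"

definition gr_mult ::
    "('g, 'm) monoid_scheme \<Rightarrow> ('g \<Rightarrow>\<^sub>0 int) \<Rightarrow> ('g \<Rightarrow>\<^sub>0 int) \<Rightarrow> ('g \<Rightarrow>\<^sub>0 int)" where
  "gr_mult G a b =
     (\<Sum>x\<in>Poly_Mapping.keys a. \<Sum>y\<in>Poly_Mapping.keys b.
        Poly_Mapping.single (x \<otimes>\<^bsub>G\<^esub> y) (Poly_Mapping.lookup a x * Poly_Mapping.lookup b y))"

definition gr_star :: "('g, 'm) monoid_scheme \<Rightarrow> ('g \<Rightarrow>\<^sub>0 int) \<Rightarrow> ('g \<Rightarrow>\<^sub>0 int)" where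
  "gr_star G a =
     (\<Sum>x\<in>Poly_Mapping.keys a. Poly_Mapping.single (inv\<^bsub>G\<^esub> x) (Poly_Mapping.lookup a x))"

text \<open>
  A \<open>d \<times> d\<close> matrix is a function of two indices of which only the values at indices
  below \<open>d\<close> matter.
\<close>

type_synonym 'g gr_matrix = "nat \<Rightarrow> nat \<Rightarrow> ('g \<Rightarrow>\<^sub>0 int)"

definition gr_matrices :: "('g, 'm) monoid_scheme \<Rightarrow> nat \<Rightarrow> 'g gr_matrix set" where
  "gr_matrices G d = {A. \<forall>i<d. \<forall>j<d. A i j \<in> group_ring G}"

definition mat_mult ::
    "('g, 'm) monoid_scheme \<Rightarrow> nat \<Rightarrow> 'g gr_matrix \<Rightarrow> 'g gr_matrix \<Rightarrow> 'g gr_matrix" where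
  "mat_mult G d A B = (\<lambda>i j. \<Sum>k<d. gr_mult G (A i k) (B k j))"

definition mat_star :: "('g, 'm) monoid_scheme \<Rightarrow> 'g gr_matrix \<Rightarrow> 'g gr_matrix" where
  "mat_star G A = (\<lambda>i j. gr_star G (A j i))"

definition mat_is_one :: "('g, 'm) monoid_scheme \<Rightarrow> nat \<Rightarrow> 'g gr_matrix \<Rightarrow> bool" where
  "mat_is_one G d A \<longleftrightarrow> (\<forall>i<d. \<forall>j<d. A i j = (if i = j then gr_one G else 0))"

definition GL_group_ring :: "('g, 'm) monoid_scheme \<Rightarrow> nat \<Rightarrow> 'g gr_matrix set" where
  "GL_group_ring G d =
     {A \<in> gr_matrices G d. \<exists>B\<in>gr_matrices G d.
        mat_is_one G d (mat_mult G d A B) \<and> mat_is_one G d (mat_mult G d B A)}"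

text \<open>
  Left multiplication by the matrix \<open>A\<close> on \<open>\<ell>\<^sup>2(G)\<^sup>d\<close>; a group element \<open>x\<close> acts on a
  function \<open>v\<close> by \<open>(x \<cdot> v)(g) = v(x\<^sup>-\<^sup>1 g)\<close>, so that it sends the basis vector of \<open>h\<close> to that
  of \<open>x h\<close>.
\<close>

definition mat_op ::
    "('g, 'm) monoid_scheme \<Rightarrow> nat \<Rightarrow> 'g gr_matrix \<Rightarrow>
      (nat \<times> 'g \<Rightarrow> complex) \<Rightarrow> (nat \<times> 'g \<Rightarrow> complex)" where
  "mat_op G d A v = (\<lambda>(i, g).
     if i < d \<and> g \<in> carrier G then
       \<Sum>j<d. \<Sum>x\<in>Poly_Mapping.keys (A i j).
         of_int (Poly_Mapping.lookup (A i j) x) * v (j, inv\<^bsub>G\<^esub> x \<otimes>\<^bsub>G\<^esub> g)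
     else 0)"

definition whitehead_trivial_det :: "('g, 'm) monoid_scheme \<Rightarrow> bool" where
  "whitehead_trivial_det G \<longleftrightarrow>
     (\<forall>d. \<forall>A\<in>GL_group_ring G d. ln_det G d (mat_op G d (mat_mult G d (mat_star G A) A)) = 0)"

definition directed_index :: "'i set \<Rightarrow> ('i \<Rightarrow> 'i \<Rightarrow> bool) \<Rightarrow> bool" where
  "directed_index I R \<longleftrightarrow>
     I \<noteq> {} \<and> reflp_on I R \<and> transp_on I R \<and>
     (\<forall>i\<in>I. \<forall>j\<in>I. \<exists>k\<in>I. R i k \<and> R j k)"

definition direct_system ::
    "'i set \<Rightarrow> ('i \<Rightarrow> 'i \<Rightarrow> bool) \<Rightarrow> ('i \<Rightarrow> ('a, 'm) monoid_scheme) \<Rightarrow>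
      ('i \<Rightarrow> 'i \<Rightarrow> 'a \<Rightarrow> 'a) \<Rightarrow> bool" where
  "direct_system I R G \<phi> \<longleftrightarrow>
     directed_index I R \<and>
     (\<forall>i\<in>I. group (G i)) \<and>
     (\<forall>i\<in>I. \<forall>j\<in>I. R i j \<longrightarrow> \<phi> i j \<in> hom (G i) (G j)) \<and>
     (\<forall>i\<in>I. \<forall>x\<in>carrier (G i). \<phi> i i x = x) \<and>
     (\<forall>i\<in>I. \<forall>j\<in>I. \<forall>k\<in>I. R i j \<longrightarrow> R j k \<longrightarrow>
        (\<forall>x\<in>carrier (G i). \<phi> j k (\<phi> i j x) = \<phi> i k x))"

definition direct_limit_rel ::
    "'i set \<Rightarrow> ('i \<Rightarrow> 'i \<Rightarrow> bool) \<Rightarrow> ('i \<Rightarrow> ('a, 'm) monoid_scheme) \<Rightarrow>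
      ('i \<Rightarrow> 'i \<Rightarrow> 'a \<Rightarrow> 'a) \<Rightarrow> (('i \<times> 'a) \<times> ('i \<times> 'a)) set" where
  "direct_limit_rel I R G \<phi> =
     {((i, x), (j, y)). i \<in> I \<and> x \<in> carrier (G i) \<and> j \<in> I \<and> y \<in> carrier (G j) \<and>
        (\<exists>k\<in>I. R i k \<and> R j k \<and> \<phi> i k x = \<phi> j k y)}"

text \<open>
  The quotient of the disjoint union of the groups.  In the product and the unit the unions
  run over representatives (and upper bounds), all of which give the same class.
\<close>

definition direct_limit ::
    "'i set \<Rightarrow> ('i \<Rightarrow> 'i \<Rightarrow> bool) \<Rightarrow> ('i \<Rightarrow> ('a, 'm) monoid_scheme) \<Rightarrow>
      ('i \<Rightarrow> 'i \<Rightarrow> 'a \<Rightarrow> 'a) \<Rightarrow> ('i \<times> 'a) set monoid" where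
  "direct_limit I R G \<phi> =
     \<lparr>carrier = (SIGMA i:I. carrier (G i)) // direct_limit_rel I R G \<phi>,
      monoid.mult = (\<lambda>X Y. \<Union>(i, x)\<in>X. \<Union>(j, y)\<in>Y. \<Union>k\<in>{k\<in>I. R i k \<and> R j k}.
        direct_limit_rel I R G \<phi> `` {(k, \<phi> i k x \<otimes>\<^bsub>G k\<^esub> \<phi> j k y)}),
      one = (\<Union>i\<in>I. direct_limit_rel I R G \<phi> `` {(i, \<one>\<^bsub>G i\<^esub>)})\<rparr>"

text \<open>For \<open>R i j\<close> the structure map \<open>p i j\<close> goes from \<open>G j\<close> to \<open>G i\<close>.\<close>

definition inverse_system ::
    "'i set \<Rightarrow> ('i \<Rightarrow> 'i \<Rightarrow> bool) \<Rightarrow> ('i \<Rightarrow> ('a, 'm) monoid_scheme) \<Rightarrow>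
      ('i \<Rightarrow> 'i \<Rightarrow> 'a \<Rightarrow> 'a) \<Rightarrow> bool" where
  "inverse_system I R G p \<longleftrightarrow>
     directed_index I R \<and>
     (\<forall>i\<in>I. group (G i)) \<and>
     (\<forall>i\<in>I. \<forall>j\<in>I. R i j \<longrightarrow> p i j \<in> hom (G j) (G i)) \<and>
     (\<forall>i\<in>I. \<forall>x\<in>carrier (G i). p i i x = x) \<and>
     (\<forall>i\<in>I. \<forall>j\<in>I. \<forall>k\<in>I. R i j \<longrightarrow> R j k \<longrightarrow>
        (\<forall>x\<in>carrier (G k). p i j (p j k x) = p i k x))"

definition inverse_limit ::
    "'i set \<Rightarrow> ('i \<Rightarrow> 'i \<Rightarrow> bool) \<Rightarrow> ('i \<Rightarrow> ('a, 'm) monoid_scheme) \<Rightarrow>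
      ('i \<Rightarrow> 'i \<Rightarrow> 'a \<Rightarrow> 'a) \<Rightarrow> ('i \<Rightarrow> 'a) monoid" where
  "inverse_limit I R G p =
     (product_group I G)
       \<lparr>carrier := {f \<in> carrier (product_group I G).
          \<forall>i\<in>I. \<forall>j\<in>I. R i j \<longrightarrow> p i j (f j) = f i}\<rparr>"

end

theory Submission
  imports Defs "HOL-Probability.Probability" "HOL-Real_Asymp.Real_Asymp"
begin

text \<open>
  If \<open>A\<close> is invertible over \<open>\<int>\<pi>\<close> and \<open>C\<close> bounds the \<open>\<ell>\<^sup>1\<close>-norms of \<open>A\<close> and \<open>A\<^sup>-\<^sup>1\<close>, then the
  spectrum of \<open>\<Delta> = A\<^sup>*A\<close> lies in \<open>[1/C\<^sup>2, C\<^sup>2]\<close>.  There \<open>ln\<close> is a uniform limit of polynomials,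
  so \<open>ln det(\<Delta>) = tr(ln \<Delta>)\<close> is determined up to \<open>\<delta>\<close> by the traces of finitely many powers of
  \<open>\<Delta>\<close>.  The bound \<open>C\<close> survives group homomorphisms, and the traces of finitely many powers only
  depend on which elements of some finite set are trivial.  A finite set of elements of an inverse
  limit, of a subgroup, or of a lift to some group of a direct system can be mapped to one of the
  given groups without changing which of its elements are trivial in \<open>\<pi>\<close>, and there the determinant is \<open>0\<close>.

  The spectral measure of \<open>\<Delta>\<close> is obtained from the Hausdorff moment problem: for \<open>0 \<le> T \<le> 1\<close> the
  operators \<open>T\<^sup>k(1 - T)\<^sup>n\<^sup>-\<^sup>k\<close> are positive, so the Bernstein weights of the moments \<open>(T\<^sup>n v, v)\<close> are
  probability measures, and a weak limit of them has these moments.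
\<close>

section \<open>Functionals on bounded Borel functions\<close>

text \<open>The spectral gap has an elementary source: \<open>A\<close> is bounded by
  \<open>C\<close> and \<open>v\<close> equals the inverse applied to \<open>A v\<close>, so the
  norm of \<open>A v\<close> lies between those of \<open>v / C\<close> and \<open>C v\<close>, and
  its square is the quadratic form of the operator. Without a gap \<open>ln\<close> would be
  unbounded near 0, and finitely many traces would not control the determinant. \<open>C\<close> is
  uniform because a push-forward can only merge or cancel coefficients.

  The determinant over an auxiliary group is known to vanish only for matrices invertible there. In
  the direct limit, lifts of \<open>A\<close> and of its inverse need not be inverse in the group to
  which they are lifted. The finite set of elements must therefore also record the equations saying
  that the two matrices are inverse to each other.

  \<open>spectral_projection\<close> is a choice of which only the defining conditions are known.
  Constructing one spectral measure is not enough: the moments of every spectral measure have to be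
  derived from these conditions, which tie it to the operator through the first moment alone.

  Measures appear as functionals because polarization produces signed ones.\<close>

definition bdd_borel :: "real \<Rightarrow> real \<Rightarrow> (real \<Rightarrow> real) set" where
  "bdd_borel a b = {f \<in> borel_measurable borel. \<exists>C. \<forall>x\<in>{a..b}. \<bar>f x\<bar> \<le> C}"

text \<open>
  A signed measure on \<open>[a, b]\<close>, given by its integrals.  Locality, \<open>L f = L g\<close> whenever
  \<open>f = g\<close> on \<open>[a, b]\<close>, follows from the convergence property.
\<close>

definition borel_functional :: "real \<Rightarrow> real \<Rightarrow> ((real \<Rightarrow> real) \<Rightarrow> real) \<Rightarrow> bool" where
  "borel_functional a b L \<longleftrightarrow>
     (\<forall>f\<in>bdd_borel a b. \<forall>g\<in>bdd_borel a b. L (\<lambda>x. f x + g x) = L f + L g) \<and>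
     (\<forall>c. \<forall>f\<in>bdd_borel a b. L (\<lambda>x. c * f x) = c * L f) \<and>
     (\<forall>F f (C::real). (\<forall>n. F n \<in> borel_measurable borel) \<longrightarrow> f \<in> borel_measurable borel \<longrightarrow>
        (\<forall>n :: nat. \<forall>x\<in>{a..b}. \<bar>F n x\<bar> \<le> C) \<longrightarrow>
        (\<forall>x\<in>{a..b}. (\<lambda>n. F n x) \<longlonglongrightarrow> f x) \<longrightarrow> (\<lambda>n. L (F n)) \<longlonglongrightarrow> L f)"

lemma bdd_borelI:
  "f \<in> borel_measurable borel \<Longrightarrow> (\<And>x. a \<le> x \<Longrightarrow> x \<le> b \<Longrightarrow> \<bar>f x\<bar> \<le> C) \<Longrightarrow> f \<in> bdd_borel a b"
  by (auto simp: bdd_borel_def intro!: exI[of _ C])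

lemma bdd_borel_measurable [measurable_dest]:
  "f \<in> bdd_borel a b \<Longrightarrow> f \<in> borel_measurable borel"
  by (auto simp: bdd_borel_def)

lemma bdd_borel_bound:
  assumes "f \<in> bdd_borel a b"
  obtains C where "C \<ge> 0" "\<And>x. a \<le> x \<Longrightarrow> x \<le> b \<Longrightarrow> \<bar>f x\<bar> \<le> C"
proof -
  obtain C where "\<forall>x\<in>{a..b}. \<bar>f x\<bar> \<le> C"
    using assms by (auto simp: bdd_borel_def)
  then show ?thesis by (intro that[of "max 0 C"]) (auto simp: le_max_iff_disj)
qed

lemma bdd_borel_add [intro]:
  assumes "f \<in> bdd_borel a b" "g \<in> bdd_borel a b"
  shows "(\<lambda>x. f x + g x) \<in> bdd_borel a b"
proof -
  obtain C D where "\<And>x. a \<le> x \<Longrightarrow> x \<le> b \<Longrightarrow> \<bar>f x\<bar> \<le> C" "\<And>x. a \<le> x \<Longrightarrow> x \<le> b \<Longrightarrow> \<bar>g x\<bar> \<le> D"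
    using assms by (metis bdd_borel_bound)
  then show ?thesis using assms
    by (intro bdd_borelI[where C = "C + D"])
       (auto intro!: order_trans[OF abs_triangle_ineq] add_mono simp: bdd_borel_measurable)
qed

lemma bdd_borel_mult [intro]:
  assumes "f \<in> bdd_borel a b" "g \<in> bdd_borel a b"
  shows "(\<lambda>x. f x * g x) \<in> bdd_borel a b"
proof -
  obtain C D where "\<And>x. a \<le> x \<Longrightarrow> x \<le> b \<Longrightarrow> \<bar>f x\<bar> \<le> C" "\<And>x. a \<le> x \<Longrightarrow> x \<le> b \<Longrightarrow> \<bar>g x\<bar> \<le> D" "C \<ge> 0"
    using assms by (metis bdd_borel_bound)
  then show ?thesis using assms
    by (intro bdd_borelI[where C = "C * D"]) (auto intro!: mult_mono simp: abs_mult bdd_borel_measurable)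
qed

text \<open>Compactness of \<open>{a..b}\<close> gives the bound. Values outside the interval are
  unrestricted, so powers belong to the class.\<close>

lemma bdd_borel_continuous:
  assumes "f \<in> borel_measurable borel" "continuous_on {a..b} f"
  shows "f \<in> bdd_borel a b"
proof -
  have "bounded (f ` {a..b})"
    using assms by (intro compact_imp_bounded compact_continuous_image) auto
  then show ?thesis using assms by (auto simp: bounded_iff bdd_borel_def)
qed

lemma bdd_borel_const [intro]: "(\<lambda>x. c) \<in> bdd_borel a b"
  by (rule bdd_borelI[where C = "\<bar>c\<bar>"]) auto

lemma bdd_borel_cmult [intro]: "f \<in> bdd_borel a b \<Longrightarrow> (\<lambda>x. c * f x) \<in> bdd_borel a b"
  by (rule bdd_borel_mult) auto

lemma bdd_borel_power [intro]: "(\<lambda>x. x ^ n) \<in> bdd_borel a b"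
  by (rule bdd_borel_continuous) (auto intro!: continuous_intros)

lemma bdd_borel_id [intro]: "(\<lambda>x. x) \<in> bdd_borel a b"
  using bdd_borel_power[of 1] by simp

lemma bdd_borel_indicator [intro]: "A \<in> sets borel \<Longrightarrow> indicator A \<in> bdd_borel a b"
  by (rule bdd_borelI[where C = 1]) (auto simp: indicator_def)

lemma bdd_borel_sum [intro]:
  "(\<And>i. i \<in> I \<Longrightarrow> f i \<in> bdd_borel a b) \<Longrightarrow> (\<lambda>x. \<Sum>i\<in>I. f i x) \<in> bdd_borel a b"
  by (induction I rule: infinite_finite_induct) auto

lemma borel_functional_add:
  "borel_functional a b L \<Longrightarrow> f \<in> bdd_borel a b \<Longrightarrow> g \<in> bdd_borel a b \<Longrightarrow>
    L (\<lambda>x. f x + g x) = L f + L g"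
  by (auto simp: borel_functional_def)

lemma borel_functional_cmult:
  "borel_functional a b L \<Longrightarrow> f \<in> bdd_borel a b \<Longrightarrow> L (\<lambda>x. c * f x) = c * L f"
  by (auto simp: borel_functional_def)

lemma borel_functional_LIMSEQ:
  assumes "borel_functional a b L" "\<And>n. F n \<in> borel_measurable borel" "f \<in> borel_measurable borel"
    and "\<And>n x. a \<le> x \<Longrightarrow> x \<le> b \<Longrightarrow> \<bar>F n x\<bar> \<le> C"
    and "\<And>x. a \<le> x \<Longrightarrow> x \<le> b \<Longrightarrow> (\<lambda>n. F n x) \<longlonglongrightarrow> f x"
  shows "(\<lambda>n. L (F n)) \<longlonglongrightarrow> L f"
proof -
  have "\<forall>n. \<forall>x\<in>{a..b}. \<bar>F n x\<bar> \<le> C" "\<forall>x\<in>{a..b}. (\<lambda>n. F n x) \<longlonglongrightarrow> f x"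
    using assms(4,5) by auto
  then show ?thesis using assms(1-3) unfolding borel_functional_def by blast
qed

text \<open>The constant sequence \<open>f\<close> converges to \<open>g\<close> pointwise on the
  interval, whatever \<open>g\<close> does outside.\<close>

lemma borel_functional_cong:
  assumes "borel_functional a b L" "f \<in> bdd_borel a b" "g \<in> borel_measurable borel"
    and "\<And>x. a \<le> x \<Longrightarrow> x \<le> b \<Longrightarrow> f x = g x"
  shows "L f = L g"
proof -
  obtain C where "\<And>x. a \<le> x \<Longrightarrow> x \<le> b \<Longrightarrow> \<bar>f x\<bar> \<le> C" using assms(2) bdd_borel_bound by blast
  then have "(\<lambda>n. L f) \<longlonglongrightarrow> L g"
    using assms by (intro borel_functional_LIMSEQ[of a b L "\<lambda>_. f" g C])
                   (auto simp: bdd_borel_measurable)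
  then show ?thesis by (simp add: LIMSEQ_const_iff)
qed

lemma borel_functional_diff:
  assumes "borel_functional a b L" "f \<in> bdd_borel a b" "g \<in> bdd_borel a b"
  shows "L (\<lambda>x. f x - g x) = L f - L g"
  using borel_functional_add[OF assms(1,2) bdd_borel_cmult[OF assms(3), of "-1"]]
    borel_functional_cmult[OF assms(1,3), of "-1"] by simp

lemma borel_functional_0:
  "borel_functional a b L \<Longrightarrow> L (\<lambda>x. 0) = 0"
  using borel_functional_cmult[OF _ bdd_borel_const, of a b L 0 0] by simp

lemma borel_functional_sum:
  assumes "borel_functional a b L" "\<And>i. i \<in> I \<Longrightarrow> f i \<in> bdd_borel a b"
  shows "L (\<lambda>x. \<Sum>i\<in>I. f i x) = (\<Sum>i\<in>I. L (f i))"
proof -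
  have 0: "L (\<lambda>x. 0) = 0"
    using borel_functional_0[OF assms(1)] .
  show ?thesis using assms(2)
  proof (induction I rule: infinite_finite_induct)
    case (insert i I)
    then show ?case using borel_functional_add[OF assms(1), of "f i" "\<lambda>x. \<Sum>i\<in>I. f i x"]
      by (auto intro: bdd_borel_sum)
  qed (auto simp: 0)
qed

lemma borel_functional_lincomb:
  assumes "borel_functional a b L" "borel_functional a b L'"
  shows "borel_functional a b (\<lambda>f. c * L f + c' * L' f)"
  unfolding borel_functional_def
proof (intro conjI ballI allI impI)
  fix F :: "nat \<Rightarrow> real \<Rightarrow> real" and f :: "real \<Rightarrow> real" and C :: real
  assume "\<forall>n. F n \<in> borel_measurable borel" "f \<in> borel_measurable borel"
    "\<forall>n::nat. \<forall>x\<in>{a..b}. \<bar>F n x\<bar> \<le> C" "\<forall>x\<in>{a..b}. (\<lambda>n. F n x) \<longlonglongrightarrow> f x"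
  then show "(\<lambda>n. c * L (F n) + c' * L' (F n)) \<longlonglongrightarrow> c * L f + c' * L' f"
    by (intro tendsto_add tendsto_mult tendsto_const
        borel_functional_LIMSEQ[OF assms(1), where C = C] borel_functional_LIMSEQ[OF assms(2), where C = C]) auto
qed (simp_all add: borel_functional_add[OF assms(1)] borel_functional_add[OF assms(2)]
    borel_functional_cmult[OF assms(1)] borel_functional_cmult[OF assms(2)] algebra_simps)

lemma borel_functional_zero: "borel_functional a b (\<lambda>f. 0)"
  by (auto simp: borel_functional_def)

lemma borel_functional_scale:
  "borel_functional a b L \<Longrightarrow> borel_functional a b (\<lambda>f. c * L f)"
  using borel_functional_lincomb[of a b L L c 0] by simp

lemma borel_functional_minus:
  "borel_functional a b L \<Longrightarrow> borel_functional a b L' \<Longrightarrow> borel_functional a b (\<lambda>f. L f - L' f)"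
  using borel_functional_lincomb[of a b L L' 1 "-1"] by simp

lemma borel_functional_sum_functionals:
  "(\<And>i. i \<in> I \<Longrightarrow> borel_functional a b (L i)) \<Longrightarrow> borel_functional a b (\<lambda>f. \<Sum>i\<in>I. L i f)"
proof (induction I rule: infinite_finite_induct)
  case (insert i I)
  then show ?case
    using borel_functional_lincomb[of a b "L i" "\<lambda>f. \<Sum>i\<in>I. L i f" 1 1] by simp
qed (auto simp: borel_functional_zero)

text \<open>The signed measure with density \<open>g\<close>. With \<open>g\<close> an indicator or
  the identity, a factor under the integral leads to another functional, to which the uniqueness
  lemmas apply.\<close>

lemma borel_functional_weight:
  assumes L: "borel_functional a b L" and g: "g \<in> bdd_borel a b"
  shows "borel_functional a b (\<lambda>f. L (\<lambda>x. f x * g x))"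
  unfolding borel_functional_def
proof (intro conjI ballI allI impI)
  obtain D where D: "\<And>x. a \<le> x \<Longrightarrow> x \<le> b \<Longrightarrow> \<bar>g x\<bar> \<le> D" "D \<ge> 0"
    using g bdd_borel_bound by blast
  fix F :: "nat \<Rightarrow> real \<Rightarrow> real" and f :: "real \<Rightarrow> real" and C :: real
  assume F: "\<forall>n. F n \<in> borel_measurable borel" "f \<in> borel_measurable borel"
    "\<forall>n::nat. \<forall>x\<in>{a..b}. \<bar>F n x\<bar> \<le> C" "\<forall>x\<in>{a..b}. (\<lambda>n. F n x) \<longlonglongrightarrow> f x"
  show "(\<lambda>n. L (\<lambda>x. F n x * g x)) \<longlonglongrightarrow> L (\<lambda>x. f x * g x)"
  proof (rule borel_functional_LIMSEQ[OF L, where C = "C * D"])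
    show "\<bar>F n x * g x\<bar> \<le> C * D" if "a \<le> x" "x \<le> b" for n x
    proof -
      have "\<bar>F n x\<bar> \<le> C" using F that by auto
      then show ?thesis unfolding abs_mult using D that by (intro mult_mono) auto
    qed
    show "(\<lambda>n. F n x * g x) \<longlonglongrightarrow> f x * g x" if "a \<le> x" "x \<le> b" for x
      using F that by (intro tendsto_intros) auto
  qed (use F g in \<open>auto intro!: borel_measurable_times simp: bdd_borel_measurable\<close>)
next
  fix f f' assume f: "f \<in> bdd_borel a b" "f' \<in> bdd_borel a b"
  show "L (\<lambda>x. (f x + f' x) * g x) = L (\<lambda>x. f x * g x) + L (\<lambda>x. f' x * g x)"
    using borel_functional_add[OF L bdd_borel_mult[OF f(1) g] bdd_borel_mult[OF f(2) g]]
    by (simp add: ring_distribs)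
next
  fix c f assume f: "f \<in> bdd_borel a b"
  show "L (\<lambda>x. c * f x * g x) = c * L (\<lambda>x. f x * g x)"
    using borel_functional_cmult[OF L bdd_borel_mult[OF f g], of c] by (simp add: mult.assoc)
qed

lemma integrable_bdd_borel:
  assumes "finite_measure M" "sets M = sets borel" "AE x in M. a \<le> x \<and> x \<le> b" "f \<in> bdd_borel a b"
  shows "integrable M f"
proof -
  interpret finite_measure M by fact
  obtain C where "\<And>x. a \<le> x \<Longrightarrow> x \<le> b \<Longrightarrow> \<bar>f x\<bar> \<le> C" using assms(4) bdd_borel_bound by blast
  then have "AE x in M. norm (f x) \<le> C" using assms(3) by auto
  then show ?thesis using assms(2,4)
    by (intro integrable_const_bound[where B = C])
       (auto simp: bdd_borel_measurable cong: measurable_cong_sets)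
qed

lemma borel_functional_integral:
  assumes M: "finite_measure M" "sets M = sets borel" "AE x in M. a \<le> x \<and> x \<le> b"
  shows "borel_functional a b (\<lambda>f. \<integral>x. f x \<partial>M)"
  unfolding borel_functional_def
proof (intro conjI ballI allI impI)
  interpret finite_measure M by fact
  fix F :: "nat \<Rightarrow> real \<Rightarrow> real" and f :: "real \<Rightarrow> real" and C :: real
  assume F: "\<forall>n. F n \<in> borel_measurable borel" "f \<in> borel_measurable borel"
    "\<forall>n::nat. \<forall>x\<in>{a..b}. \<bar>F n x\<bar> \<le> C" "\<forall>x\<in>{a..b}. (\<lambda>n. F n x) \<longlonglongrightarrow> f x"
  show "(\<lambda>n. integral\<^sup>L M (F n)) \<longlonglongrightarrow> integral\<^sup>L M f"
  proof (rule integral_dominated_convergence[where w = "\<lambda>_. C"])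
    show "AE x in M. (\<lambda>n. F n x) \<longlonglongrightarrow> f x" using M(3) by eventually_elim (use F in auto)
    show "AE x in M. norm (F n x) \<le> C" for n using M(3) by eventually_elim (use F in auto)
  qed (use F M in \<open>auto cong: measurable_cong_sets\<close>)
qed (use integrable_bdd_borel[OF M] in auto)

lemma borel_functional_sums:
  assumes L: "borel_functional a b L" and B: "\<And>n. B n \<in> sets borel" "disjoint_family B"
  shows "(\<lambda>n. L (indicator (B n))) sums L (indicator (\<Union>n. B n))"
proof -
  have *: "(\<Sum>i<n. indicator (B i) x) = (indicator (\<Union>i<n. B i) x :: real)" for n x
    using indicator_UN_disjoint[of "{..<n}" B x, where 'c = real] B(2)
    by (auto simp: disjoint_family_on_def)
  have "(\<lambda>n. L (\<lambda>x. \<Sum>i<n. indicator (B i) x)) \<longlonglongrightarrow> L (indicator (\<Union>i. B i))"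
  proof (rule borel_functional_LIMSEQ[OF L, where C = 1])
    fix x :: real
    show "(\<lambda>n. \<Sum>i<n. indicator (B i) x) \<longlonglongrightarrow> (indicator (\<Union>i. B i) x :: real)"
      unfolding * by (rule LIMSEQ_indicator_UN)
    show "\<bar>\<Sum>i<n. indicator (B i) x\<bar> \<le> (1::real)" for n
      unfolding * by (auto simp: indicator_def)
  qed (use B in auto)
  moreover have "L (\<lambda>x. \<Sum>i<n. indicator (B i) x) = (\<Sum>i<n. L (indicator (B i)))" for n
    by (rule borel_functional_sum[OF L]) (rule bdd_borel_indicator[OF B(1)])
  ultimately show ?thesis unfolding sums_def by (simp only:)
qed

text \<open>Half-lines are closed under intersection and generate the Borel sets; the sets on which
  \<open>L\<close> vanishes form a Dynkin system once the total mass is 0.\<close>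

lemma borel_functional_indicator_eq_0:
  assumes L: "borel_functional a b L" and 0: "\<And>x. L (indicator {..x}) = 0"
    and A: "A \<in> sets borel"
  shows "L (indicator A) = 0"
proof -
  \<comment> \<open>The half-lines exhaust the line, so the total mass is a limit of zeros.
    Complements need this.\<close>
  have "(\<lambda>n. L (indicator {..real n})) \<longlonglongrightarrow> L (\<lambda>x. 1)"
  proof (rule borel_functional_LIMSEQ[OF L, where C = 1])
    fix x :: real
    obtain N where "x \<le> real N" using real_arch_simple by blast
    then have "eventually (\<lambda>n. indicator {..real n} x = (1::real)) sequentially"
      by (intro eventually_sequentiallyI[of N]) (auto simp: indicator_def)
    then show "(\<lambda>n. indicator {..real n} x) \<longlonglongrightarrow> (1::real)"
      by (rule tendsto_eventually)
  qed (auto simp: indicator_def)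
  then have 1: "L (\<lambda>x. 1) = 0" using 0 LIMSEQ_const_iff by (simp add: LIMSEQ_const_iff)
  have A': "A \<in> sigma_sets UNIV (range (\<lambda>x::real. {..x}))"
    using A unfolding borel_eq_atMost by simp
  have "Int_stable (range (\<lambda>x::real. {..x}))" by (auto simp: Int_stable_def)
  moreover have "range (\<lambda>x::real. {..x}) \<subseteq> Pow UNIV" by simp
  ultimately show ?thesis
    using A'
  proof (induction rule: sigma_sets_induct_disjoint)
    case empty
    show ?case using borel_functional_0[OF L] by simp
  next
    case (compl A)
    have A: "A \<in> sets borel" using compl unfolding borel_eq_atMost by simp
    have "L (indicator (UNIV - A)) = L (\<lambda>x. 1 - indicator A x)"
      by (rule arg_cong[of _ _ L]) (auto simp: indicator_def)
    also have "\<dots> = 0" using borel_functional_diff[OF L bdd_borel_const bdd_borel_indicator[OF A]] 1 compl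
      by simp
    finally show ?case .
  next
    case (union A)
    have A: "A i \<in> sets borel" for i using union unfolding borel_eq_atMost by auto
    show ?case
      using sums_unique2[OF borel_functional_sums[OF L A union(1)]] union by simp
  next
    case (basic A)
    then show ?case using 0 by auto
  qed
qed

text \<open>Monotone approximation by simple functions settles bounded nonnegative functions; the
  rest is the splitting into positive and negative parts.\<close>

lemma borel_functional_eq_0:
  assumes L: "borel_functional a b L" and 0: "\<And>A. A \<in> sets borel \<Longrightarrow> L (indicator A) = 0"
    and f: "f \<in> bdd_borel a b"
  shows "L f = 0"
proof -
  \<comment> \<open>Boundedness is a premise inside the induction claim because the induction rule
    only carries measurability and nonnegativity.\<close>
  have nonneg: "(\<exists>C. \<forall>x. u x \<le> C) \<longrightarrow> L u = 0"
    if "u \<in> borel_measurable borel" "\<And>x. 0 \<le> u x" for u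
    using that
  proof (induction rule: borel_measurable_induct_real)
    case (set A)
    then show ?case using 0 by auto
  next
    case (mult u c)
    show ?case
    proof (intro impI, elim exE)
      fix C assume C: "\<forall>x. c * u x \<le> C"
      show "L (\<lambda>x. c * u x) = 0"
      proof (cases "c = 0")
        case True
        then show ?thesis using borel_functional_0[OF L] by simp
      next
        case False
        then have "\<forall>x. u x \<le> C / c" using C mult by (simp add: field_simps)
        then have "L u = 0" "u \<in> bdd_borel a b" using mult by (auto intro!: bdd_borelI[where C = "C/c"])
        then show ?thesis using borel_functional_cmult[OF L] by simp
      qed
    qed
  next
    case (add u v)
    show ?case
    proof (intro impI, elim exE)
      fix C assume C: "\<forall>x. v x + u x \<le> C"
      then have C': "\<forall>x. u x \<le> C" "\<forall>x. v x \<le> C" using add by (smt (verit))+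
      then have "L u = 0" "u \<in> bdd_borel a b" "L v = 0" "v \<in> bdd_borel a b"
        using add by (auto intro!: bdd_borelI[where C = C])
      then show "L (\<lambda>x. v x + u x) = 0" using borel_functional_add[OF L] by simp
    qed
  next
    case (seq U)
    show ?case
    proof (intro impI, elim exE)
      fix C assume C: "\<forall>x. u x \<le> C"
      have U: "U i x \<le> C" for i x
      proof -
        have "U i x \<le> u x"
          using seq(3) seq(4)[of x] by (intro incseq_le) (auto simp: incseq_def le_fun_def)
        then show ?thesis using C order_trans by blast
      qed
      have "(\<lambda>i. L (U i)) \<longlonglongrightarrow> L u"
        using seq U that by (intro borel_functional_LIMSEQ[OF L, where C = C]) auto
      moreover have "L (U i) = 0" for i using seq(5) U by blast
      ultimately show "L u = 0" by (simp add: LIMSEQ_const_iff)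
    qed
  qed
  obtain C where C: "\<And>x. a \<le> x \<Longrightarrow> x \<le> b \<Longrightarrow> \<bar>f x\<bar> \<le> C" "C \<ge> 0"
    using f bdd_borel_bound by blast
  \<comment> \<open>Cutting off outside the interval makes the function globally bounded, as
    \<open>nonneg\<close> demands, without changing the value of \<open>L\<close>.\<close>
  define g where "g x = indicator {a..b} x * f x" for x
  have g [measurable]: "g \<in> borel_measurable borel" using f unfolding g_def by (auto simp: bdd_borel_measurable)
  have gC: "\<bar>g x\<bar> \<le> C" for x using C by (auto simp: g_def indicator_def)
  have "L f = L g" by (rule borel_functional_cong[OF L f g]) (auto simp: g_def)
  also have "\<dots> = L (\<lambda>x. max 0 (g x) - max 0 (- g x))"
    by (rule arg_cong[of _ _ L]) (auto simp: max_def)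
  also have "\<dots> = L (\<lambda>x. max 0 (g x)) - L (\<lambda>x. max 0 (- g x))"
    using gC by (intro borel_functional_diff[OF L] bdd_borelI[where C = C])
       (use C(2) in \<open>auto simp: abs_le_iff\<close>)
  also have "L (\<lambda>x. max 0 (g x)) = 0"
    using gC by (intro nonneg[rule_format] exI[of _ C]) (auto simp: abs_le_iff C)
  also have "L (\<lambda>x. max 0 (- g x)) = 0"
    using gC by (intro nonneg[rule_format] exI[of _ C]) (auto simp: abs_le_iff C)
  finally show ?thesis by simp
qed

lemma borel_functional_eq_0_halflines:
  assumes "borel_functional a b L" "\<And>x. L (indicator {..x}) = 0" "f \<in> bdd_borel a b"
  shows "L f = 0"
  using borel_functional_eq_0[OF assms(1) borel_functional_indicator_eq_0[OF assms(1,2)] assms(3)] .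

text \<open>By Weierstrass, vanishing passes from polynomials to continuous functions, and from
  these to half-lines through continuous ramps.\<close>

lemma borel_functional_eq_0_moments:
  assumes L: "borel_functional a b L" and 0: "\<And>n. L (\<lambda>x. x ^ n) = 0" and f: "f \<in> bdd_borel a b"
  shows "L f = 0"
proof (rule borel_functional_eq_0_halflines[OF L _ f])
  have poly: "L p = 0" if p: "real_polynomial_function p" for p
  proof -
    obtain c n where "p = (\<lambda>x. \<Sum>i\<le>n. c i * x ^ i)"
      using p unfolding real_polynomial_function_iff_sum by auto
    moreover have "L (\<lambda>x. \<Sum>i\<le>n. c i * x ^ i) = (\<Sum>i\<le>n. c i * L (\<lambda>x. x ^ i))"
    proof -
      have "L (\<lambda>x. \<Sum>i\<le>n. c i * x ^ i) = (\<Sum>i\<le>n. L (\<lambda>x. c i * x ^ i))"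
        by (rule borel_functional_sum[OF L]) (rule bdd_borel_cmult[OF bdd_borel_power])
      also have "\<dots> = (\<Sum>i\<le>n. c i * L (\<lambda>x. x ^ i))"
        by (rule sum.cong[OF refl]) (rule borel_functional_cmult[OF L bdd_borel_power])
      finally show ?thesis .
    qed
    ultimately show ?thesis using 0 by simp
  qed
  have cont: "L g = 0" if g: "continuous_on UNIV g" for g
  proof -
    have "\<exists>p. real_polynomial_function p \<and> (\<forall>x\<in>{a..b}. \<bar>g x - p x\<bar> < inverse (Suc n))" for n
    proof -
      have "continuous_on {a..b} g" by (rule continuous_on_subset[OF g]) simp
      then obtain p where "real_polynomial_function p" "\<And>x. x \<in> {a..b} \<Longrightarrow> \<bar>g x - p x\<bar> < inverse (Suc n)"
        using Stone_Weierstrass_real_polynomial_function[of "{a..b}" g "inverse (Suc n)"] by auto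
      then show ?thesis by auto
    qed
    then obtain p where p: "\<And>n. real_polynomial_function (p n)"
      "\<And>n x. x \<in> {a..b} \<Longrightarrow> \<bar>g x - p n x\<bar> < inverse (Suc n)" by metis
    have gm: "g \<in> borel_measurable borel" using g by (rule borel_measurable_continuous_onI)
    have "g \<in> bdd_borel a b"
      by (intro bdd_borel_continuous gm continuous_on_subset[OF g]) simp
    then obtain C where C: "C \<ge> 0" "\<And>x. a \<le> x \<Longrightarrow> x \<le> b \<Longrightarrow> \<bar>g x\<bar> \<le> C"
      using bdd_borel_bound by blast
    have "(\<lambda>n. L (p n)) \<longlonglongrightarrow> L g"
    proof (rule borel_functional_LIMSEQ[OF L, where C = "C + 1"])
      show "p n \<in> borel_measurable borel" for n
        using p(1) by (intro borel_measurable_continuous_onI)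
          (simp add: continuous_on_polymonial_function real_polynomial_function_eq)
      fix x assume x: "a \<le> x" "x \<le> b"
      show "\<bar>p n x\<bar> \<le> C + 1" for n
      proof -
        have "inverse (real (Suc n)) \<le> 1" by (simp add: field_simps)
        then show ?thesis using C(2)[OF x] p(2)[of x n] x by auto
      qed
      have "(\<lambda>n. inverse (real (Suc n))) \<longlonglongrightarrow> 0" by (rule LIMSEQ_inverse_real_of_nat)
      then have "(\<lambda>n. p n x - g x) \<longlonglongrightarrow> 0"
        using p(2)[of x] x
        by (rule_tac tendsto_rabs_zero_cancel, rule_tac tendsto_sandwich[of "\<lambda>_. 0" _ _ "\<lambda>n. inverse (real (Suc n))"])
           (auto simp: abs_minus_commute less_imp_le)
      then show "(\<lambda>n. p n x) \<longlonglongrightarrow> g x" using LIM_zero_iff by blast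
    qed (use gm in auto)
    then show ?thesis using poly[OF p(1)] by (simp add: LIMSEQ_const_iff)
  qed
  fix y :: real
  \<comment> \<open>For positive \<open>n\<close> the ramp is 1 up to \<open>y\<close> and falls
    linearly to 0 at \<open>y + 1/n\<close>.\<close>
  have "(\<lambda>n. L (\<lambda>x. max 0 (min 1 (1 - real n * (x - y))))) \<longlonglongrightarrow> L (indicator {..y})"
  proof (rule borel_functional_LIMSEQ[OF L, where C = 1])
    fix x :: real
    show "(\<lambda>n. max 0 (min 1 (1 - real n * (x - y)))) \<longlonglongrightarrow> indicator {..y} x"
    proof (cases "x \<le> y")
      case True
      then have "max 0 (min 1 (1 - real n * (x - y))) = 1" for n
        using mult_nonneg_nonpos[of "real n" "x - y"] by (auto simp: min_def)
      then show ?thesis using True by simp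
    next
      case False
      then obtain N where N: "1 < real N * (x - y)" using reals_Archimedean3[of "x - y"] by auto
      have "max 0 (min 1 (1 - real n * (x - y))) = 0" if "n \<ge> N" for n
      proof -
        have "real N * (x - y) \<le> real n * (x - y)" using that False by (intro mult_right_mono) auto
        then show ?thesis using N by auto
      qed
      then have "eventually (\<lambda>n. max 0 (min 1 (1 - real n * (x - y))) = 0) sequentially"
        by (intro eventually_sequentiallyI)
      then show ?thesis using False by (auto intro: tendsto_eventually)
    qed
  qed auto
  moreover have "L (\<lambda>x. max 0 (min 1 (1 - real n * (x - y)))) = 0" for n
    by (intro cont continuous_intros)
  ultimately show "L (indicator {..y}) = 0" by (simp add: LIMSEQ_const_iff)
qed

section \<open>Moment measures\<close>

definition poly_op :: "('v::real_vector \<Rightarrow> 'v) \<Rightarrow> real poly \<Rightarrow> 'v \<Rightarrow> 'v" where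
  "poly_op T p v = (\<Sum>i\<le>degree p. coeff p i *\<^sub>R (T ^^ i) v)"

lemma poly_op_eq: "degree p \<le> n \<Longrightarrow> poly_op T p v = (\<Sum>i\<le>n. coeff p i *\<^sub>R (T ^^ i) v)"
  unfolding poly_op_def by (rule sum.mono_neutral_left) (auto simp: coeff_eq_0)

lemma poly_op_0 [simp]: "poly_op T 0 v = 0"
  by (simp add: poly_op_def)

lemma poly_op_add: "poly_op T (p + q) v = poly_op T p v + poly_op T q v"
proof -
  define n where "n = max (degree p) (degree q)"
  have "degree p \<le> n" "degree q \<le> n" "degree (p + q) \<le> n"
    by (auto simp: n_def degree_add_le)
  then show ?thesis by (simp add: poly_op_eq[of _ n] scaleR_add_left sum.distrib)
qed

lemma poly_op_smult: "poly_op T (smult c p) v = c *\<^sub>R poly_op T p v"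
  using degree_smult_le[of c p] by (simp add: poly_op_eq[of _ "degree p"] scaleR_sum_right)

lemma poly_op_sum: "poly_op T (\<Sum>i\<in>I. p i) v = (\<Sum>i\<in>I. poly_op T (p i) v)"
  by (induction I rule: infinite_finite_induct) (auto simp: poly_op_add)

lemma poly_op_pCons:
  assumes "linear T"
  shows "poly_op T (pCons a p) v = a *\<^sub>R v + T (poly_op T p v)"
proof -
  have "degree (pCons a p) \<le> Suc (degree p)" by (rule degree_pCons_le)
  then have "poly_op T (pCons a p) v = (\<Sum>i\<le>Suc (degree p). coeff (pCons a p) i *\<^sub>R (T ^^ i) v)"
    by (rule poly_op_eq)
  also have "\<dots> = a *\<^sub>R v + (\<Sum>i\<le>degree p. coeff p i *\<^sub>R T ((T ^^ i) v))"
    by (subst sum.atMost_Suc_shift) simp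
  also have "\<dots> = a *\<^sub>R v + T (poly_op T p v)"
    using assms by (simp add: poly_op_def linear_sum linear_scale)
  finally show ?thesis .
qed

lemma poly_op_mult:
  assumes "linear T"
  shows "poly_op T (p * q) v = poly_op T p (poly_op T q v)"
proof (induction p)
  case (pCons a p)
  have "poly_op T (pCons a p * q) v = a *\<^sub>R poly_op T q v + T (poly_op T (p * q) v)"
    by (simp add: mult_pCons_left poly_op_add poly_op_smult poly_op_pCons[OF assms])
  then show ?case using pCons by (simp add: poly_op_pCons[OF assms])
qed simp

lemma poly_op_X_power:
  assumes "linear T"
  shows "poly_op T ([:0, 1:] ^ n) v = (T ^^ n) v"
  using assms by (induction n) (auto simp: poly_op_mult poly_op_pCons one_pCons linear_0)

lemma inner_poly_op_symmetric:
  assumes "\<And>v w. inner (T v) w = inner v (T w)"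
  shows "inner (poly_op T p v) w = inner v (poly_op T p w)"
proof -
  have "inner ((T ^^ i) v) w = inner v ((T ^^ i) w)" for i
    by (induction i arbitrary: v w) (auto simp: assms funpow_swap1)
  then show ?thesis by (simp add: poly_op_def inner_sum_left inner_sum_right)
qed

text \<open>After splitting off a square \<open>q * q\<close>, at most one factor of each kind is
  left. Symmetry moves \<open>q\<close> across the inner product, and positivity of 1,
  \<open>T\<close> and \<open>1 - T\<close> does the rest.\<close>

lemma poly_op_bernstein_nonneg:
  fixes T :: "'v::real_inner \<Rightarrow> 'v"
  assumes lin: "linear T" and sym: "\<And>v w. inner (T v) w = inner v (T w)"
    and pos: "\<And>v. 0 \<le> inner (T v) v" and le: "\<And>v. inner (T v) v \<le> inner v v"
  shows "0 \<le> inner (poly_op T ([:0, 1:] ^ k * [:1, -1:] ^ j) v) v"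
proof -
  let ?X = "[:0, 1:] :: real poly" and ?Y = "[:1, -1:] :: real poly"
  have split: "inner (poly_op T (q * r) v) v = inner (poly_op T r v) (poly_op T q v)" for q r v
    using inner_poly_op_symmetric[OF sym, of q "poly_op T r v" v] by (simp add: poly_op_mult[OF lin])
  have ee: "0 \<le> inner (poly_op T (q * q) v) v" for q v
    by (simp add: split)
  have oe: "0 \<le> inner (poly_op T (?X * (q * q)) v) v" for q v
  proof -
    have *: "?X * (q * q) = q * (?X * q)" by (simp only: mult_ac)
    have "inner (poly_op T (?X * (q * q)) v) v = inner (T (poly_op T q v)) (poly_op T q v)"
      unfolding * split using lin by (simp add: poly_op_mult[OF lin] poly_op_pCons[OF lin] linear_0 del: mult_pCons_left)
    then show ?thesis using pos by simp
  qed
  have eo: "0 \<le> inner (poly_op T (?Y * (q * q)) v) v" for q v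
  proof -
    have *: "?Y * (q * q) = q * (?Y * q)" by (simp only: mult_ac)
    have "inner (poly_op T (?Y * (q * q)) v) v =
        inner (poly_op T q v) (poly_op T q v) - inner (T (poly_op T q v)) (poly_op T q v)"
      unfolding * split using lin
      by (simp add: poly_op_mult[OF lin] poly_op_pCons[OF lin] linear_0 linear_neg inner_diff_left del: mult_pCons_left)
    then show ?thesis using le[of "poly_op T q v"] by simp
  qed
  have oo: "0 \<le> inner (poly_op T (?X * ?Y * (q * q)) v) v" for q v
  proof -
    \<comment> \<open>With one factor of each kind left over, \<open>X + Y = 1\<close> gives
      \<open>X Y = Y X^2 + X Y^2\<close>, a sum of the two preceding cases.\<close>
    have "?X * ?Y * (q * q) = (?X + ?Y) * (?X * ?Y * (q * q))"
    proof -
      have "?X + ?Y = 1" by (simp add: one_pCons)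
      then show ?thesis by (simp only: mult_1_left)
    qed
    also have "\<dots> = ?Y * ((?X * q) * (?X * q)) + ?X * ((?Y * q) * (?Y * q))"
      by (simp only: ring_distribs mult_ac)
    finally show ?thesis using eo[of "?X * q" v] oe[of "?Y * q" v]
      by (simp only: poly_op_add inner_add_left)
  qed
  obtain a b where ab: "k = 2 * a \<or> k = 2 * a + 1" "j = 2 * b \<or> j = 2 * b + 1"
    by (metis oddE evenE)
  define q where "q = ?X ^ a * ?Y ^ b"
  have sq: "q * q = ?X ^ (2 * a) * ?Y ^ (2 * b)"
    unfolding q_def mult_2 power_add by (simp only: mult_ac)
  have "?X ^ k * ?Y ^ j = q * q" if "k = 2 * a" "j = 2 * b"
    unfolding sq that ..
  moreover have "?X ^ k * ?Y ^ j = ?X * (q * q)" if "k = 2 * a + 1" "j = 2 * b"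
    unfolding sq that power_add power_one_right by (simp only: mult_ac)
  moreover have "?X ^ k * ?Y ^ j = ?Y * (q * q)" if "k = 2 * a" "j = 2 * b + 1"
    unfolding sq that power_add power_one_right by (simp only: mult_ac)
  moreover have "?X ^ k * ?Y ^ j = ?X * ?Y * (q * q)" if "k = 2 * a + 1" "j = 2 * b + 1"
    unfolding sq that power_add power_one_right by (simp only: mult_ac)
  ultimately show ?thesis
    using ab ee[of q v] oe[of q v] eo[of q v] oo[of q v] by metis
qed

text \<open>By the absorption identity each factor lowers both entries of the binomial coefficient
  by one; if \<open>k < m\<close>, the factor with \<open>j = k\<close> is 0.\<close>

lemma bernstein_weight:
  assumes "m \<le> n" "k \<le> n"
  shows "(\<Prod>j<m. (real k - real j) / (real n - real j)) * real (n choose k) =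
    (if m \<le> k then real ((n - m) choose (k - m)) else 0)"
  using assms
proof (induction m)
  case (Suc m)
  let ?P = "\<lambda>m. (\<Prod>j<m. (real k - real j) / (real n - real j)) * real (n choose k)"
  have *: "?P (Suc m) = ?P m * ((real k - real m) / (real n - real m))"
    by (simp add: algebra_simps)
  show ?case
  proof (cases "Suc m \<le> k")
    case True
    have n: "n - m = Suc (n - Suc m)" and k: "k - m = Suc (k - Suc m)" using True Suc by auto
    have "real (k - m) * real ((n - m) choose (k - m)) = real (n - m) * real ((n - Suc m) choose (k - Suc m))"
      unfolding n k using Suc_times_binomial_eq[of "n - Suc m" "k - Suc m"]
      by (metis mult.commute of_nat_mult)
    then have "real ((n - m) choose (k - m)) * ((real k - real m) / (real n - real m)) =
       real ((n - Suc m) choose (k - Suc m))"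
      using Suc True by (simp add: field_simps of_nat_diff)
    then show ?thesis unfolding * using Suc True by simp
  next
    case False
    then show ?thesis unfolding * using Suc by (cases "k = m") auto
  qed
qed simp

text \<open>Falling factorials in place of powers make the discrete moments exact: by
  \<open>bernstein_weight\<close> the sum collapses to \<open>X^m (X + Y)^(n - m)\<close> with
  \<open>X + Y = 1\<close>.\<close>

lemma bernstein_moment:
  fixes T :: "'v::real_inner \<Rightarrow> 'v"
  assumes lin: "linear T" and m: "m \<le> n"
  shows "(\<Sum>k\<le>n. (\<Prod>j<m. (real k - real j) / (real n - real j)) *
     (real (n choose k) * inner (poly_op T ([:0, 1:] ^ k * [:1, -1:] ^ (n - k)) v) v)) =
     inner ((T ^^ m) v) v"
proof -
  let ?X = "[:0, 1:] :: real poly" and ?Y = "[:1, -1:] :: real poly"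
  let ?L = "\<lambda>p. inner (poly_op T p v) v"
  have "(\<Sum>k\<le>n. (\<Prod>j<m. (real k - real j) / (real n - real j)) * (real (n choose k) * ?L (?X ^ k * ?Y ^ (n - k))))
    = (\<Sum>k\<le>n. (if m \<le> k then real ((n - m) choose (k - m)) else 0) * ?L (?X ^ k * ?Y ^ (n - k)))"
  proof (rule sum.cong[OF refl])
    fix k assume k: "k \<in> {..n}"
    show "(\<Prod>j<m. (real k - real j) / (real n - real j)) * (real (n choose k) * ?L (?X ^ k * ?Y ^ (n - k)))
      = (if m \<le> k then real ((n - m) choose (k - m)) else 0) * ?L (?X ^ k * ?Y ^ (n - k))"
      unfolding mult.assoc[symmetric] using bernstein_weight[OF m, of k] k by simp
  qed
  also have "\<dots> = (\<Sum>k=m..n. real ((n - m) choose (k - m)) * ?L (?X ^ k * ?Y ^ (n - k)))"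
    by (rule sum.mono_neutral_cong_right) auto
  also have "\<dots> = (\<Sum>i\<le>n - m. real ((n - m) choose i) * ?L (?X ^ (i + m) * ?Y ^ (n - m - i)))"
    by (rule sum.reindex_bij_witness[of _ "\<lambda>i. i + m" "\<lambda>k. k - m"]) (use m in auto)
  also have "\<dots> = ?L (\<Sum>i\<le>n - m. smult (real ((n - m) choose i)) (?X ^ (i + m) * ?Y ^ (n - m - i)))"
    by (simp add: poly_op_sum poly_op_smult inner_sum_left)
  also have "(\<Sum>i\<le>n - m. smult (real ((n - m) choose i)) (?X ^ (i + m) * ?Y ^ (n - m - i))) =
      ?X ^ m * (\<Sum>i\<le>n - m. of_nat ((n - m) choose i) * ?X ^ i * ?Y ^ (n - m - i))"
    unfolding sum_distrib_left
    by (rule sum.cong[OF refl]) (simp add: power_add mult_ac of_nat_poly)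
  also have "\<dots> = ?X ^ m * (?X + ?Y) ^ (n - m)"
    by (simp only: binomial_ring)
  also have "?X + ?Y = 1" by (simp add: one_pCons)
  finally show ?thesis by (simp add: poly_op_X_power[OF lin])
qed

text \<open>A product of factors of modulus at most 1 changes by at most the sum of the changes of
  its factors.\<close>

lemma bernstein_weight_bound:
  assumes "2 * m \<le> n" "k \<le> n" "0 < n"
  shows "\<bar>(real k / real n) ^ m - (\<Prod>j<m. (real k - real j) / (real n - real j))\<bar> \<le> real m * (real m / (real n - real m))"
proof (cases "m = 0")
  case False
  have "\<bar>(\<Prod>j<m. real k / real n) - (\<Prod>j<m. (real k - real j) / (real n - real j))\<bar> \<le>
     (\<Sum>j<m. \<bar>real k / real n - (real k - real j) / (real n - real j)\<bar>)"
    unfolding real_norm_def[symmetric]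
  proof (rule norm_prod_diff)
    fix j assume j: "j \<in> {..<m}"
    show "norm (real k / real n) \<le> 1" using assms by simp
    \<comment> \<open>For \<open>k < j\<close> the numerator is negative, of modulus at most
      \<open>m\<close>; \<open>2 * m \<le> n\<close> keeps this below the denominator.\<close>
    show "norm ((real k - real j) / (real n - real j)) \<le> 1"
      using assms j by (auto simp: field_simps abs_le_iff)
  qed
  also have "\<dots> \<le> (\<Sum>j<m. real m / (real n - real m))"
  proof (rule sum_mono)
    fix j assume j: "j \<in> {..<m}"
    have "real k / real n - (real k - real j) / (real n - real j) = (real j / (real n - real j)) * (1 - real k / real n)"
      using assms j by (simp add: field_simps)
    then have "\<bar>real k / real n - (real k - real j) / (real n - real j)\<bar> =
        \<bar>(real j / (real n - real j)) * (1 - real k / real n)\<bar>" by simp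
    also have "\<dots> = (real j / (real n - real j)) * (1 - real k / real n)"
      using assms j by (intro abs_of_nonneg mult_nonneg_nonneg) (auto simp: field_simps)
    also have "\<dots> \<le> (real j / (real n - real j)) * 1"
      using assms j by (intro mult_left_mono) (auto simp: field_simps)
    also have "\<dots> \<le> real m / (real n - real m)"
      using assms j False unfolding mult_1_right by (intro frac_le) auto
    finally show "\<bar>real k / real n - (real k - real j) / (real n - real j)\<bar> \<le> real m / (real n - real m)" .
  qed
  finally show ?thesis by simp
qed simp

text \<open>For \<open>n \<ge> m\<close> the value \<open>inner ((T ^^ m) v) v\<close> is exactly
  the \<open>m\<close>-th factorial moment of the \<open>n\<close>-th grid measure. Factorial and
  power moments differ by a term of order \<open>1/n\<close>, so it is the power moment of a weak
  limit.\<close>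

theorem hausdorff_moment_measure:
  fixes T :: "'v::real_inner \<Rightarrow> 'v"
  assumes lin: "linear T" and sym: "\<And>v w. inner (T v) w = inner v (T w)"
    and pos: "\<And>v. 0 \<le> inner (T v) v" and le: "\<And>v. inner (T v) v \<le> inner v v"
    and v: "inner v v = 1"
  obtains M where "real_distribution M" "AE x in M. 0 \<le> x \<and> x \<le> 1"
    "\<And>m. (\<integral>x. x ^ m \<partial>M) = inner ((T ^^ m) v) v"
proof -
  define c where "c n k = real (n choose k) * inner (poly_op T ([:0, 1:] ^ k * [:1, -1:] ^ (n - k)) v) v" for n k
  have c0: "c n k \<ge> 0" for n k
    unfolding c_def using poly_op_bernstein_nonneg[OF lin sym pos le] by (intro mult_nonneg_nonneg) auto
  have c1: "(\<Sum>k\<le>n. c n k) = 1" for n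
    using bernstein_moment[OF lin, of 0 n v] v by (simp add: c_def)
  \<comment> \<open>The weight of the \<open>k\<close>-th term of \<open>(X + Y)^n\<close> is placed
    at the point \<open>k/n\<close>; at \<open>n = 0\<close> the only point is
    \<open>0/0 = 0\<close>.\<close>
  define \<mu> where "\<mu> n = distr (point_measure {..n} (\<lambda>k. ennreal (c n k))) borel (\<lambda>k. real k / real n)" for n
  have prob: "prob_space (point_measure {..n} (\<lambda>k. ennreal (c n k)))" for n
    by (rule prob_spaceI)
       (use c0 c1[of n] in \<open>simp add: space_point_measure emeasure_point_measure_finite sum_ennreal\<close>)
  have rd: "real_distribution (\<mu> n)" for n
    unfolding \<mu>_def by (intro prob_space.real_distribution_distr[OF prob]) simp
  have int: "(\<integral>x. f x \<partial>\<mu> n) = (\<Sum>k\<le>n. c n k * f (real k / real n))"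
    if [measurable]: "f \<in> borel_measurable borel" for f :: "real \<Rightarrow> real" and n
    unfolding \<mu>_def using c0 by (subst integral_distr) (auto simp: lebesgue_integral_point_measure_finite)
  \<comment> \<open>\<open>tight\<close> speaks of intervals open on the left, so the left end must
    lie strictly below the grid point 0.\<close>
  have tight: "tight \<mu>"
    unfolding tight_def
  proof (intro conjI allI impI)
    fix \<epsilon> :: real assume "\<epsilon> > 0"
    have "1 - \<epsilon> < measure (\<mu> n) {-1<..1}" for n
    proof -
    interpret real_distribution "\<mu> n" by (rule rd)
    have "measure (\<mu> n) {-1<..1} = (\<integral>x. indicator {-1<..1} x \<partial>\<mu> n)" by simp
    also have "\<dots> = (\<Sum>k\<le>n. c n k * indicator {-1<..1} (real k / real n))" by (rule int) simp
    also have "\<dots> = (\<Sum>k\<le>n. c n k)"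
    proof (rule sum.cong[OF refl])
      fix k assume "k \<in> {..n}"
      then have "-1 < real k / real n" "real k / real n \<le> 1"
        by (auto simp: divide_le_eq_1 intro: less_le_trans[of _ 0])
      then show "c n k * indicator {-1<..1} (real k / real n) = c n k" by (simp add: indicator_def)
    qed
    finally show ?thesis using c1 \<open>\<epsilon> > 0\<close> by simp
    qed
    then show "\<exists>a b. a < b \<and> (\<forall>n. 1 - \<epsilon> < measure (\<mu> n) {a<..b})"
      by (intro exI[of _ "-1::real"] exI[of _ "1::real"]) simp
  qed (use rd in auto)
  obtain r M where r: "strict_mono (r :: nat \<Rightarrow> nat)" and M: "real_distribution M" and w: "weak_conv_m (\<mu> \<circ> id \<circ> r) M"
    using tight_imp_convergent_subsubsequence[OF tight strict_mono_id] by blast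
  have lim: "(\<lambda>n. \<integral>x. f x \<partial>\<mu> (r n)) \<longlonglongrightarrow> (\<integral>x. f x \<partial>M)"
    if "\<And>x. isCont f x" "\<And>x. norm (f x) \<le> B" for f :: "real \<Rightarrow> real" and B
    using weak_conv_imp_integral_bdd_continuous_conv[of "\<mu> \<circ> id \<circ> r" M f B] that rd M w
    by (simp add: comp_def)
  interpret M: real_distribution M by (rule M)
  have AE: "AE x in M. 0 \<le> x \<and> x \<le> 1"
  proof -
    \<comment> \<open>Bounded, continuous and zero exactly on \<open>[0, 1]\<close>: its integral
      tests the support of the limit.\<close>
    define f :: "real \<Rightarrow> real" where "f x = min 1 (max 0 (- x) + max 0 (x - 1))" for x
    have f: "isCont f x" "norm (f x) \<le> 1" "0 \<le> f x" for x unfolding f_def by (auto intro!: continuous_intros)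
    have fm [measurable]: "f \<in> borel_measurable borel" unfolding f_def by measurable
    have "(\<lambda>n. \<integral>x. f x \<partial>\<mu> (r n)) \<longlonglongrightarrow> (\<integral>x. f x \<partial>M)" using f by (intro lim[of f 1]) auto
    moreover have "(\<integral>x. f x \<partial>\<mu> n) = 0" for n
      unfolding int[OF fm]
    proof (rule sum.neutral, rule ballI)
      fix k assume "k \<in> {..n}"
      then have "real k / real n \<le> 1" by (auto simp: divide_le_eq_1)
      then show "c n k * f (real k / real n) = 0" by (simp add: f_def)
    qed
    ultimately have "(\<integral>x. f x \<partial>M) = 0" by (simp add: LIMSEQ_const_iff)
    moreover have "integrable M f"
      using f by (intro M.integrable_const_bound[where B = 1]) auto
    ultimately have "AE x in M. f x = 0"
      using f(3) by (subst (asm) integral_nonneg_eq_0_iff_AE) auto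
    then show ?thesis by eventually_elim (auto simp: f_def min_def max_def split: if_splits)
  qed
  have "(\<integral>x. x ^ m \<partial>M) = inner ((T ^^ m) v) v" for m
  proof -
    \<comment> \<open>Weak convergence needs a bounded continuous integrand, so the power is
      truncated outside \<open>[0, 1]\<close>, where none of the measures has mass.\<close>
    define f :: "real \<Rightarrow> real" where "f x = (max 0 (min 1 x)) ^ m" for x
    have f: "isCont f x" "norm (f x) \<le> 1" for x
      unfolding f_def by (auto intro!: continuous_intros power_le_one simp: power_abs)
    have fm [measurable]: "f \<in> borel_measurable borel" unfolding f_def by measurable
    have "(\<integral>x. x ^ m \<partial>M) = (\<integral>x. f x \<partial>M)"
    proof (rule integral_cong_AE)
      show "AE x in M. x ^ m = f x" using AE by eventually_elim (auto simp: f_def)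
    qed auto
    moreover have "(\<lambda>n. \<integral>x. f x \<partial>\<mu> (r n)) \<longlonglongrightarrow> (\<integral>x. f x \<partial>M)" using f by (intro lim[of f 1]) auto
    moreover have "(\<lambda>n. \<integral>x. f x \<partial>\<mu> n) \<longlonglongrightarrow> inner ((T ^^ m) v) v"
    proof (rule LIM_zero_cancel, rule tendsto_rabs_zero_cancel,
        rule tendsto_sandwich[where f = "\<lambda>_. 0" and h = "\<lambda>n. real m * (real m / (real n - real m))"])
      show "(\<lambda>n. real m * (real m / (real n - real m))) \<longlonglongrightarrow> 0" by real_asymp
      show "\<forall>\<^sub>F n in sequentially. \<bar>(\<integral>x. f x \<partial>\<mu> n) - inner ((T ^^ m) v) v\<bar> \<le> real m * (real m / (real n - real m))"
      \<comment> \<open>From this index on both \<open>2 * m \<le> n\<close> and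
        \<open>0 < n\<close> hold, as \<open>bernstein_weight_bound\<close> requires.\<close>
      proof (rule eventually_sequentiallyI[of "2 * m + 1"])
        fix n assume n: "2 * m + 1 \<le> n"
        let ?W = "\<lambda>k. \<Prod>j<m. (real k - real j) / (real n - real j)"
        have "(\<integral>x. f x \<partial>\<mu> n) = (\<Sum>k\<le>n. c n k * (real k / real n) ^ m)"
          unfolding int[OF fm] using n by (intro sum.cong) (auto simp: f_def)
        moreover have "inner ((T ^^ m) v) v = (\<Sum>k\<le>n. ?W k * c n k)"
          using bernstein_moment[OF lin, of m n v] n by (simp add: c_def)
        ultimately have "\<bar>(\<integral>x. f x \<partial>\<mu> n) - inner ((T ^^ m) v) v\<bar> =
            \<bar>\<Sum>k\<le>n. ((real k / real n) ^ m - ?W k) * c n k\<bar>"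
          by (simp add: sum_subtractf algebra_simps)
        also have "\<dots> \<le> (\<Sum>k\<le>n. \<bar>((real k / real n) ^ m - ?W k) * c n k\<bar>)" by (rule sum_abs)
        also have "\<dots> \<le> (\<Sum>k\<le>n. (real m * (real m / (real n - real m))) * c n k)"
        proof (rule sum_mono)
          fix k assume "k \<in> {..n}"
          then have "\<bar>(real k / real n) ^ m - ?W k\<bar> \<le> real m * (real m / (real n - real m))"
            using n by (intro bernstein_weight_bound) auto
          then show "\<bar>((real k / real n) ^ m - ?W k) * c n k\<bar> \<le> (real m * (real m / (real n - real m))) * c n k"
            unfolding abs_mult abs_of_nonneg[OF c0] by (rule mult_right_mono[OF _ c0])
        qed
        also have "\<dots> = real m * (real m / (real n - real m))"
          unfolding sum_distrib_left[symmetric] c1 by simp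
        finally show "\<bar>(\<integral>x. f x \<partial>\<mu> n) - inner ((T ^^ m) v) v\<bar> \<le> real m * (real m / (real n - real m))" .
      qed
    qed auto
    then have "(\<lambda>n. \<integral>x. f x \<partial>\<mu> (r n)) \<longlonglongrightarrow> inner ((T ^^ m) v) v"
      using LIMSEQ_subseq_LIMSEQ[OF _ r] by (simp add: comp_def)
    ultimately show ?thesis using LIMSEQ_unique by metis
  qed
  then show ?thesis using that M AE by blast
qed

section \<open>Spectral measures of symmetric operators\<close>

lemma linear_funpow:
  fixes T :: "'v::real_vector \<Rightarrow> 'v"
  assumes "linear T"
  shows "linear (T ^^ n)"
proof (induction n)
  case 0
  show ?case by (rule linearI) simp_all
next
  case (Suc n)
  then show ?case unfolding funpow.simps by (rule linear_compose[OF _ assms])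
qed

text \<open>The moment theorem is applied to \<open>T / M\<close> and unit vectors, and the measure
  is stretched to \<open>[0, M]\<close>. It is chosen separately for each vector; relations between
  different vectors come later from uniqueness of moments.\<close>

lemma functional_calculus_exists:
  fixes T :: "'v::real_inner \<Rightarrow> 'v"
  assumes lin: "linear T" and sym: "\<And>v w. inner (T v) w = inner v (T w)"
    and pos: "\<And>v. 0 \<le> inner (T v) v" and le: "\<And>v. inner (T v) v \<le> M * inner v v" and M: "M > 0"
  obtains Q :: "(real \<Rightarrow> real) \<Rightarrow> 'v \<Rightarrow> real" where
    "\<And>v. borel_functional 0 M (\<lambda>f. Q f v)"
    "\<And>v n. Q (\<lambda>x. x ^ n) v = inner ((T ^^ n) v) v"
    "\<And>v f. f \<in> borel_measurable borel \<Longrightarrow> (\<And>x. 0 \<le> f x) \<Longrightarrow> 0 \<le> Q f v"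
proof -
  define S where "S v = (1 / M) *\<^sub>R T v" for v
  have linS: "linear S" unfolding S_def using lin by (rule linear_compose_scale_right)
  have pow: "(S ^^ n) v = (1 / M) ^ n *\<^sub>R (T ^^ n) v" for n v
    by (induction n) (simp_all add: S_def linear_scale[OF lin])
  have "\<exists>N. real_distribution N \<and> (AE x in N. 0 \<le> x \<and> x \<le> M) \<and> (\<forall>n. (\<integral>x. x ^ n \<partial>N) = inner ((T ^^ n) v) v)"
    if v: "inner v v = 1" for v
  proof -
    have "inner (S v) w = inner v (S w)" "0 \<le> inner (S v) v" "inner (S v) v \<le> inner v v" for v w
      using sym[of v w] pos[of v] le[of v] M by (auto simp: S_def field_simps)
    then obtain N where N: "real_distribution N" "AE x in N. 0 \<le> x \<and> x \<le> 1"
      "\<And>m. (\<integral>x. x ^ m \<partial>N) = inner ((S ^^ m) v) v"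
      using hausdorff_moment_measure[OF linS, of v] v by metis
    interpret N: real_distribution N by (rule N)
    have "real_distribution (distr N borel (\<lambda>x. M * x))" by (rule N.real_distribution_distr) simp
    moreover have "AE x in distr N borel (\<lambda>x. M * x). 0 \<le> x \<and> x \<le> M"
      using N(2) M by (subst AE_distr_iff) (auto simp: mult_le_cancel_left2)
    moreover have "(\<integral>x. x ^ n \<partial>distr N borel (\<lambda>x. M * x)) = inner ((T ^^ n) v) v" for n
      using M by (subst integral_distr) (simp_all add: power_mult_distrib N(3) pow power_one_over)
    ultimately show ?thesis by blast
  qed
  then obtain N where N: "\<And>v. inner v v = 1 \<Longrightarrow> real_distribution (N v)"
    "\<And>v. inner v v = 1 \<Longrightarrow> AE x in N v. 0 \<le> x \<and> x \<le> M"
    "\<And>v n. inner v v = 1 \<Longrightarrow> (\<integral>x. x ^ n \<partial>N v) = inner ((T ^^ n) v) v"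
    by metis
  \<comment> \<open>A quadratic form scales with the squared norm, which becomes the total
    mass.\<close>
  define Q where "Q f v = (if v = 0 then 0 else inner v v * (\<integral>x. f x \<partial>N (v /\<^sub>R norm v)))" for f v
  have unit: "inner (v /\<^sub>R norm v) (v /\<^sub>R norm v) = 1" if "v \<noteq> 0" for v :: 'v
    using that by (simp add: dot_square_norm power2_eq_square field_simps)
  have powT: "linear (T ^^ n)" for n
    by (rule linear_funpow[OF lin])
  show ?thesis
  proof
    show "borel_functional 0 M (\<lambda>f. Q f v)" for v
    proof (cases "v = 0")
      case True
      then show ?thesis by (simp add: Q_def borel_functional_zero)
    next
      case False
      interpret real_distribution "N (v /\<^sub>R norm v)" by (rule N(1)[OF unit[OF False]])
      have "borel_functional 0 M (\<lambda>f. \<integral>x. f x \<partial>N (v /\<^sub>R norm v))"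
        by (rule borel_functional_integral[OF _ _ N(2)[OF unit[OF False]]]) (auto intro: finite_measure_axioms)
      then show ?thesis using False by (simp add: Q_def borel_functional_scale)
    qed
    show "Q (\<lambda>x. x ^ n) v = inner ((T ^^ n) v) v" for v n
    proof (cases "v = 0")
      case False
      then show ?thesis using N(3)[OF unit[OF False], of n]
        by (simp add: Q_def linear_scale[OF powT] dot_square_norm power2_eq_square field_simps)
    qed (simp add: Q_def)
    show "0 \<le> Q f v" if "f \<in> borel_measurable borel" "\<And>x. 0 \<le> f x" for v f
      using that by (auto simp: Q_def intro!: mult_nonneg_nonneg)
  qed
qed

definition polar :: "('f \<Rightarrow> 'v::real_vector \<Rightarrow> real) \<Rightarrow> 'f \<Rightarrow> 'v \<Rightarrow> 'v \<Rightarrow> real" where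
  "polar Q f v w = (Q f (v + w) - Q f (v - w)) / 4"

lemma polar_form:
  fixes S :: "'v::real_inner \<Rightarrow> 'v"
  assumes "linear S" "\<And>v w. inner (S v) w = inner v (S w)" "\<And>v. Q f v = inner (S v) v"
  shows "polar Q f v w = inner (S v) w"
proof -
  have "inner (S w) v = inner (S v) w" using assms(2) inner_commute by metis
  then show ?thesis
    using assms(1) by (simp add: polar_def assms(3) linear_add linear_diff inner_simps)
qed

lemma borel_functional_polar:
  assumes "\<And>v. borel_functional a b (\<lambda>f. Q f v)"
  shows "borel_functional a b (\<lambda>f. polar Q f v w)"
proof -
  have "borel_functional a b (\<lambda>f. (1/4) * (Q f (v + w) - Q f (v - w)))"
    by (intro borel_functional_scale borel_functional_minus assms)
  then show ?thesis by (simp add: polar_def)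
qed

lemma linear_funpow_symmetric:
  fixes T :: "'v::real_inner \<Rightarrow> 'v"
  assumes "\<And>v w. inner (T v) w = inner v (T w)"
  shows "inner ((T ^^ n) v) w = inner v ((T ^^ n) w)"
  by (induction n arbitrary: v w) (auto simp: assms funpow_swap1)

text \<open>Moving \<open>S\<close> to the other slot turns linearity of \<open>S\<close> into that
  of the inner product, and vectors are determined by their inner products.\<close>

lemma symmetric_imp_linear:
  fixes S :: "'v::real_inner \<Rightarrow> 'v"
  assumes "\<And>v w. inner (S v) w = inner v (S w)"
  shows "linear S"
proof (rule linearI)
  show "S (v + w) = S v + S w" for v w
    by (rule vector_eq_rdot[THEN iffD1]) (simp add: inner_simps assms)
  show "S (c *\<^sub>R v) = c *\<^sub>R S v" for c v
    by (rule vector_eq_rdot[THEN iffD1]) (simp add: inner_simps assms)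
qed

lemma borel_functional_eqI:
  assumes "borel_functional a b L" "borel_functional a b L'" "f \<in> bdd_borel a b"
    and "\<And>A. A \<in> sets borel \<Longrightarrow> L (indicator A) = L' (indicator A)"
  shows "L f = L' f"
proof -
  have "L f - L' f = 0"
    by (rule borel_functional_eq_0[OF borel_functional_minus[OF assms(1,2)] _ assms(3)]) (simp only: assms(4))
  then show ?thesis by simp
qed

text \<open>\<open>E UNIV\<close> may be a proper projection: a spectral measure on
  \<open>ell2 S\<close>, extended by 0 to the whole Hilbert space, has the restriction to
  \<open>S\<close> as its total projection.\<close>

locale real_pvm =
  fixes E :: "real set \<Rightarrow> 'v::real_inner \<Rightarrow> 'v" and a b :: real
  assumes sym: "\<And>B v w. B \<in> sets borel \<Longrightarrow> inner (E B v) w = inner v (E B w)"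
    and mult: "\<And>A B v. A \<in> sets borel \<Longrightarrow> B \<in> sets borel \<Longrightarrow> E A (E B v) = E (A \<inter> B) v"
    and support: "\<And>v. E {a..b} v = E UNIV v"
    and sums: "\<And>B v. range B \<subseteq> sets borel \<Longrightarrow> disjoint_family (B :: nat \<Rightarrow> real set) \<Longrightarrow>
      (\<lambda>n. inner (E (B n) v) v) sums inner (E (\<Union>n. B n) v) v"
begin

definition meas :: "'v \<Rightarrow> real measure" where
  "meas v = measure_of UNIV (sets borel) (\<lambda>B. ennreal (inner (E B v) v))"

lemma linear: "B \<in> sets borel \<Longrightarrow> linear (E B)"
  using sym by (intro symmetric_imp_linear)

text \<open>\<open>E B\<close> is a symmetric idempotent, so the value is the squared norm of
  \<open>E B v\<close>.\<close>

lemma nonneg: "B \<in> sets borel \<Longrightarrow> 0 \<le> inner (E B v) v"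
  using sym[of B "E B v" v] mult[of B B v] by simp

lemma sets_meas [simp, measurable_cong]: "sets (meas v) = sets borel"
  unfolding meas_def using sets.sigma_sets_eq[of "borel :: real measure"] by simp

lemma space_meas [simp]: "space (meas v) = UNIV"
  unfolding meas_def by simp

lemma emeasure_meas: "B \<in> sets borel \<Longrightarrow> emeasure (meas v) B = ennreal (inner (E B v) v)"
proof (rule emeasure_measure_of[OF meas_def])
  \<comment> \<open>A constant series converges only if its term is 0.\<close>
  have "inner (E {} v) v = 0"
    using sums[of "\<lambda>_. {}" v]
    by (simp add: disjoint_family_on_def summable_const_iff sums_iff)
  then show "positive (sets (meas v)) (\<lambda>B. ennreal (inner (E B v) v))"
    by (simp add: positive_def)
  show "countably_additive (sets (meas v)) (\<lambda>B. ennreal (inner (E B v) v))"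
    unfolding countably_additive_def
  proof (intro allI impI)
    fix A :: "nat \<Rightarrow> real set" assume A: "range A \<subseteq> sets (meas v)" "disjoint_family A"
    have "(\<lambda>n. inner (E (A n) v) v) sums inner (E (\<Union>n. A n) v) v"
      using A by (intro sums) simp_all
    then show "suminf (\<lambda>n. ennreal (inner (E (A n) v) v)) = ennreal (inner (E (\<Union>n. A n) v) v)"
      using A by (intro suminf_ennreal_eq nonneg) auto
  qed
  show "sets borel \<subseteq> Pow (UNIV :: real set)" by simp
  show "B \<in> sets (meas v)" if "B \<in> sets borel" using that by simp
qed

lemma finite_measure_meas: "finite_measure (meas v)"
  by (rule finite_measureI) (simp add: emeasure_meas)

lemma measure_meas: "B \<in> sets borel \<Longrightarrow> measure (meas v) B = inner (E B v) v"
  by (simp add: measure_def emeasure_meas nonneg)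

lemma AE_meas: "AE x in meas v. a \<le> x \<and> x \<le> b"
proof -
  interpret finite_measure "meas v" by (rule finite_measure_meas)
  have "measure (meas v) (space (meas v) - {a..b}) = 0"
    by (subst finite_measure_compl) (simp_all add: measure_meas support)
  then show ?thesis
    by (intro AE_I[of _ _ "space (meas v) - {a..b}"]) (auto simp: emeasure_eq_measure)
qed

definition Q :: "(real \<Rightarrow> real) \<Rightarrow> 'v \<Rightarrow> real" where "Q f v = (\<integral>x. f x \<partial>meas v)"

lemma borel_functional_meas: "borel_functional a b (\<lambda>f. Q f v)"
  unfolding Q_def by (rule borel_functional_integral[OF finite_measure_meas sets_meas AE_meas])

lemma Q_indicator: "B \<in> sets borel \<Longrightarrow> Q (indicator B) v = inner (E B v) v"
  by (simp add: Q_def measure_meas)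

lemma borel_UNIV: "UNIV \<in> sets (borel :: real measure)"
  by simp

lemma polar_indicator: "B \<in> sets borel \<Longrightarrow> polar Q (indicator B) v w = inner (E B v) w"
  by (rule polar_form[OF linear]) (simp_all add: Q_indicator sym[symmetric])

lemma borel_functional_polar_Q: "borel_functional a b (\<lambda>f. polar Q f v w)"
  by (rule borel_functional_polar[OF borel_functional_meas])

text \<open>Only the first moment is tied to \<open>T\<close>. Multiplicativity of \<open>E\<close>
  makes \<open>E A\<close> act on the form as multiplication by the indicator of \<open>A\<close>,
  and hence \<open>T\<close> as multiplication by \<open>x\<close>; iteration reaches every
  power.\<close>

lemma moments:
  assumes lin: "linear T" and symT: "\<And>v w. inner (T v) w = inner v (T w)"
    and T: "\<And>v. inner (T v) v = (\<integral>x. x \<partial>meas v)"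
    and comm: "\<And>v. E UNIV (T v) = T (E UNIV v)"
  shows "(\<integral>x. x ^ n \<partial>meas v) = inner ((T ^^ n) (E UNIV v)) v"
proof -
  have diag: "Q f v = polar Q f v v" if "f \<in> bdd_borel a b" for f v
  proof (rule borel_functional_eqI[OF borel_functional_meas[of v] borel_functional_polar_Q[of v v] that])
    show "Q (indicator A) v = polar Q (indicator A) v v" if "A \<in> sets borel" for A
      by (simp only: polar_indicator[OF that] Q_indicator[OF that])
  qed
  have T': "polar Q (\<lambda>x. x) v w = inner (T v) w" for v w
    by (rule polar_form[OF lin symT]) (simp add: T Q_def)
  have shift: "polar Q f v (E A w) = polar Q (\<lambda>x. f x * indicator A x) v w"
    if A: "A \<in> sets borel" and f: "f \<in> bdd_borel a b" for f A v w
  proof (rule borel_functional_eqI[OF borel_functional_polar_Q[of v "E A w"]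
        borel_functional_weight[OF borel_functional_polar_Q[of v w] bdd_borel_indicator[OF A]] f])
    fix B :: "real set" assume B: "B \<in> sets borel"
    have "inner (E B v) (E A w) = inner (E (B \<inter> A) v) w"
      using sym[OF A, of "E B v" w] mult[OF A B] by (simp add: Int_commute)
    moreover have "(\<lambda>x. indicator B x * indicator A x :: real) = indicator (B \<inter> A)"
      by (auto simp: indicator_def)
    ultimately show "polar Q (indicator B) v (E A w) = polar Q (\<lambda>x. indicator B x * indicator A x) v w"
      using A B by (simp only: polar_indicator sets.Int)
  qed
  \<comment> \<open>On indicators, symmetry moves \<open>E A\<close> to the right slot, where
    \<open>shift\<close> with the identity function and \<open>T'\<close> evaluate the form.\<close>
  have T_left: "polar Q f (T v) w = polar Q (\<lambda>x. f x * x) v w" if f: "f \<in> bdd_borel a b" for f v w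
  proof (rule borel_functional_eqI[OF borel_functional_polar_Q[of "T v" w]
        borel_functional_weight[OF borel_functional_polar_Q[of v w] bdd_borel_id] f])
    fix A :: "real set" assume A: "A \<in> sets borel"
    have "polar Q (indicator A) (T v) w = inner (T v) (E A w)"
      by (simp only: polar_indicator[OF A] sym[OF A])
    also have "\<dots> = polar Q (\<lambda>x. x * indicator A x) v w"
      using shift[OF A bdd_borel_id] T' by simp
    finally show "polar Q (indicator A) (T v) w = polar Q (\<lambda>x. indicator A x * x) v w"
      by (simp only: mult.commute)
  qed
  have "polar Q (\<lambda>x. x ^ n) v w = inner ((T ^^ n) (E UNIV v)) w" for v w
  proof (induction n arbitrary: v)
    case 0
    \<comment> \<open>The zeroth moment is the form of the whole line; this is where
      \<open>E UNIV\<close> enters.\<close>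
    have "(\<lambda>x. x ^ 0) = (indicator UNIV :: real \<Rightarrow> real)" by auto
    then have "polar Q (\<lambda>x. x ^ 0) v w = inner (E UNIV v) w"
      by (simp only: polar_indicator[OF borel_UNIV])
    then show ?case by simp
  next
    case (Suc n)
    have "polar Q (\<lambda>x. x ^ Suc n) v w = polar Q (\<lambda>x. x ^ n) (T v) w"
      using T_left[OF bdd_borel_power] by (simp add: mult.commute)
    then show ?case by (simp add: Suc funpow_swap1 comm)
  qed
  then show ?thesis using diag[OF bdd_borel_power] by (simp add: Q_def)
qed

text \<open>Taking \<open>s\<close> as 1 or -1 gives lower and upper bounds of the support. A vector
  cut down to the forbidden set \<open>B\<close> has its measure on \<open>B\<close>, where the
  integrand is negative; the hypothesis then forces this vector to be 0.\<close>

lemma AE_sign: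
  assumes T: "\<And>v. inner (T v) v = (\<integral>x. x \<partial>meas v)"
    and s: "\<And>v. E UNIV v = v \<Longrightarrow> 0 \<le> s * (inner (T v) v - c * inner v v)"
  shows "AE x in meas v. 0 \<le> s * (x - c)"
proof -
  define B where "B = {x. s * (x - c) < 0}"
  have B [measurable]: "B \<in> sets borel" unfolding B_def by measurable
  define u where "u = E B v"
  have Eu: "E A u = E (A \<inter> B) v" if "A \<in> sets borel" for A
    unfolding u_def using that B by (rule mult)
  have u: "E UNIV u = u" using Eu[of UNIV] by (simp add: u_def)
  interpret finite_measure "meas u" by (rule finite_measure_meas)
  have int: "integrable (meas u) (\<lambda>x. x)"
    by (rule integrable_bdd_borel[OF finite_measure_meas sets_meas AE_meas bdd_borel_id])
  have "inner (E (- B) u) u = 0"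
  proof -
    have "inner (E {} u) u = 0" using measure_meas[of "{}" u] by simp
    moreover have "E (- B) u = E {} u" using Eu[of "- B"] Eu[of "{}"] B by simp
    ultimately show ?thesis by simp
  qed
  then have "emeasure (meas u) (- B) = 0" using B by (simp add: emeasure_meas)
  then have AE_B: "AE x in meas u. s * (x - c) < 0"
    by (intro AE_I[of _ _ "- B"]) (auto simp: B_def)
  have "(\<integral>x. s * (x - c) \<partial>meas u) = s * (inner (T u) u - c * inner u u)"
    using int measure_meas[of UNIV u] by (simp add: T u)
  then have "0 \<le> (\<integral>x. s * (x - c) \<partial>meas u)" using s[OF u] by (simp only:)
  moreover have nn: "AE x in meas u. 0 \<le> - (s * (x - c))" using AE_B by eventually_elim simp
  then have "0 \<le> (\<integral>x. - (s * (x - c)) \<partial>meas u)" by (rule integral_nonneg_AE)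
  ultimately have "(\<integral>x. - (s * (x - c)) \<partial>meas u) = 0" using int by simp
  then have "AE x in meas u. - (s * (x - c)) = 0"
    using integral_nonneg_eq_0_iff_AE[OF _ nn] int by simp
  with AE_B have "AE x in meas u. False" by eventually_elim simp
  then have "emeasure (meas u) UNIV = 0"
    using AE_iff_measurable[of UNIV "meas u" "\<lambda>_. False"] by simp
  then have "inner u u = 0" using emeasure_meas[of UNIV u] by (simp add: u)
  then have "emeasure (meas v) B = 0" using B by (simp add: emeasure_meas u_def)
  then show ?thesis by (intro AE_I[of _ _ B]) (auto simp: B_def)
qed

end

text \<open>
  \<open>E B\<close> represents the bilinear form obtained from \<open>v \<mapsto> \<mu>\<^sub>v(B)\<close> by polarization.  Identities
  between these operators reduce to equality of signed measures on \<open>[0, M]\<close>, hence of their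
  moments \<open>(T\<^sup>n v, w)\<close>.
\<close>

theorem spectral_theorem:
  fixes T :: "'v::real_inner \<Rightarrow> 'v"
  assumes lin: "linear T" and symT: "\<And>v w. inner (T v) w = inner v (T w)"
    and pos: "\<And>v. 0 \<le> inner (T v) v" and le: "\<And>v. inner (T v) v \<le> M * inner v v" and M: "M > 0"
    and riesz: "\<And>g :: 'v \<Rightarrow> real. bounded_linear g \<Longrightarrow> \<exists>u. \<forall>w. g w = inner u w"
  obtains E where "real_pvm E 0 M" "\<And>v. E UNIV v = v"
    "\<And>v. inner (T v) v = (\<integral>x. x \<partial>real_pvm.meas E v)"
    "\<And>B v w v' w'. B \<in> sets borel \<Longrightarrow> (\<And>n. inner ((T ^^ n) v) w = inner ((T ^^ n) v') w') \<Longrightarrow>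
       inner (E B v) w = inner (E B v') w'"
    "\<And>B v w. range B \<subseteq> sets borel \<Longrightarrow> disjoint_family (B :: nat \<Rightarrow> real set) \<Longrightarrow>
      (\<lambda>n. inner (E (B n) v) w) sums inner (E (\<Union>n. B n) v) w"
proof -
  obtain Q :: "(real \<Rightarrow> real) \<Rightarrow> 'v \<Rightarrow> real" where
    Qf: "\<And>v. borel_functional 0 M (\<lambda>f. Q f v)"
    and Qm: "\<And>v n. Q (\<lambda>x. x ^ n) v = inner ((T ^^ n) v) v"
    and Qp: "\<And>v f. f \<in> borel_measurable borel \<Longrightarrow> (\<And>x. 0 \<le> f x) \<Longrightarrow> 0 \<le> Q f v"
    using functional_calculus_exists[OF lin symT pos le M] by metis
  define b where "b = polar Q"
  have linp: "linear (T ^^ n)" for n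
    by (rule symmetric_imp_linear) (rule linear_funpow_symmetric[OF symT])
  have bf: "borel_functional 0 M (\<lambda>f. b f v w)" for v w
    unfolding b_def by (rule borel_functional_polar[OF Qf])
  have bm: "b (\<lambda>x. x ^ n) v w = inner ((T ^^ n) v) w" for n v w
    unfolding b_def by (rule polar_form[OF linp]) (rule linear_funpow_symmetric[OF symT], rule Qm)
  have eqI: "L f = L' f" if "borel_functional 0 M L" "borel_functional 0 M L'" "f \<in> bdd_borel 0 M"
    "\<And>n. L (\<lambda>x. x ^ n) = L' (\<lambda>x. x ^ n)" for L L' f
  proof -
    have "L f - L' f = 0"
      by (rule borel_functional_eq_0_moments[OF borel_functional_minus[OF that(1,2)] _ that(3)]) (simp only: that(4))
    then show ?thesis by simp
  qed
  have Qb: "Q f v = b f v v" if "f \<in> bdd_borel 0 M" for f v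
    by (rule eqI[OF Qf[of v] bf[of v v] that]) (simp only: Qm bm)
  have b_add: "b f v (w + w') = b f v w + b f v w'" if "f \<in> bdd_borel 0 M" for f v w w'
  proof -
    have "borel_functional 0 M (\<lambda>f. 1 * b f v w + 1 * b f v w')"
      by (rule borel_functional_lincomb[OF bf bf])
    from eqI[OF bf[of v "w + w'"] this that] show ?thesis by (simp add: bm inner_add_right)
  qed
  have b_scale: "b f v (c *\<^sub>R w) = c * b f v w" if "f \<in> bdd_borel 0 M" for f v w c
    by (rule eqI[OF bf[of v "c *\<^sub>R w"] borel_functional_scale[OF bf[of v w], of c] that])
      (simp add: bm)
  have b_sym: "b f v w = b f w v" if "f \<in> bdd_borel 0 M" for f v w
    by (rule eqI[OF bf[of v w] bf[of w v] that])
      (simp only: bm, metis linear_funpow_symmetric[OF symT] inner_commute)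
  \<comment> \<open>Exported, so that support in \<open>S\<close> and compatibility with
    multiplication by \<open>\<i>\<close> can later be checked on powers of \<open>T\<close>
    alone.\<close>
  have b_cong: "b f v w = b f v' w'"
    if "f \<in> bdd_borel 0 M" "\<And>n. inner ((T ^^ n) v) w = inner ((T ^^ n) v') w'" for f v w v' w'
    by (rule eqI[OF bf[of v w] bf[of v' w'] that(1)]) (simp only: bm that(2))
  have Q_le: "Q (indicator B) v \<le> inner v v" if B: "B \<in> sets borel" for B v
  proof -
    have "0 \<le> Q (\<lambda>x. 1 - indicator B x) v"
      using B by (intro Qp) (auto simp: indicator_def)
    also have "\<dots> = Q (\<lambda>x. x ^ 0) v - Q (indicator B) v"
      using borel_functional_diff[OF Qf[of v] bdd_borel_const[of 1] bdd_borel_indicator[OF B]] by simp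
    finally show ?thesis using Qm[of 0 v] by simp
  qed
  \<comment> \<open>Polarization bounds the form only by a sum of squared norms. Evaluating this at
    the normalized \<open>w\<close> and rescaling gives the homogeneous bound that
    \<open>riesz\<close> needs.\<close>
  have bounded: "bounded_linear (b (indicator B) v)" if B: "B \<in> sets borel" for B v
  proof (rule bounded_linear_intro)
    fix w
    have *: "\<bar>b (indicator B) v w\<bar> \<le> (inner v v + inner w w) / 2" for w
    proof -
      have "0 \<le> Q (indicator B) (v + w)" "0 \<le> Q (indicator B) (v - w)"
        using B by (auto intro!: Qp)
      then have "\<bar>b (indicator B) v w\<bar> \<le> (Q (indicator B) (v + w) + Q (indicator B) (v - w)) / 4"
        unfolding b_def polar_def by (simp add: abs_le_iff field_simps)
      also have "\<dots> \<le> (inner (v + w) (v + w) + inner (v - w) (v - w)) / 4"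
        using Q_le[OF B] by (intro divide_right_mono add_mono) auto
      also have "\<dots> = (inner v v + inner w w) / 2"
        by (simp add: inner_simps inner_commute field_simps)
      finally show ?thesis .
    qed
    show "norm (b (indicator B) v w) \<le> norm w * ((inner v v + 1) / 2)"
    proof (cases "w = 0")
      case True
      then show ?thesis using b_scale[OF bdd_borel_indicator[OF B], of v 0 0] by simp
    next
      case False
      have "w = norm w *\<^sub>R (w /\<^sub>R norm w)" using False by simp
      then have "b (indicator B) v w = norm w * b (indicator B) v (w /\<^sub>R norm w)"
        using b_scale[OF bdd_borel_indicator[OF B]] by metis
      moreover have "\<bar>b (indicator B) v (w /\<^sub>R norm w)\<bar> \<le> (inner v v + 1) / 2"
        using *[of "w /\<^sub>R norm w"] False by (simp add: dot_square_norm[of w] power2_eq_square field_simps)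
      ultimately show ?thesis
        by (simp only: real_norm_def abs_mult abs_norm_cancel) (intro mult_left_mono norm_ge_zero)
    qed
  qed (use b_add b_scale bdd_borel_indicator[OF B] in auto)
  define E where "E B v = (SOME u. \<forall>w. b (indicator B) v w = inner u w)" for B v
  have E: "inner (E B v) w = b (indicator B) v w" if "B \<in> sets borel" for B v w
  proof -
    have "\<forall>w. b (indicator B) v w = inner (E B v) w"
      unfolding E_def by (rule someI_ex[OF riesz[OF bounded[OF that]]])
    from this[rule_format, of w] show ?thesis by (rule HOL.sym)
  qed
  \<comment> \<open>Uniqueness of moments is used twice: first in the slot of \<open>f\<close>,
    which becomes a power, and then, with that power fixed, in the slot of the indicator of
    \<open>B\<close>.\<close>
  have b_E: "b f (E B v) w = b (\<lambda>x. f x * indicator B x) v w"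
    if B: "B \<in> sets borel" and f: "f \<in> bdd_borel 0 M" for f B v w
  proof (rule eqI[OF bf[of "E B v" w] borel_functional_weight[OF bf[of v w] bdd_borel_indicator[OF B]] f])
    fix n
    have "b (\<lambda>x. x ^ n) (E B v) w = inner (E B v) ((T ^^ n) w)"
      by (simp only: bm linear_funpow_symmetric[OF symT])
    also have "\<dots> = b (indicator B) v ((T ^^ n) w)" by (rule E[OF B])
    also have "\<dots> = b (\<lambda>x. indicator B x * x ^ n) v w"
    proof (rule eqI[OF bf[of v "(T ^^ n) w"] borel_functional_weight[OF bf[of v w] bdd_borel_power] bdd_borel_indicator[OF B]])
      fix m
      show "b (\<lambda>x. x ^ m) v ((T ^^ n) w) = b (\<lambda>x. x ^ m * x ^ n) v w"
        unfolding power_add[symmetric] bm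
        by (simp only: add.commute[of m n] funpow_add comp_def linear_funpow_symmetric[OF symT])
    qed
    finally show "b (\<lambda>x. x ^ n) (E B v) w = b (\<lambda>x. x ^ n * indicator B x) v w"
      by (simp only: mult.commute)
  qed
  have E_sums: "(\<lambda>n. inner (E (B n) v) w) sums inner (E (\<Union>n. B n) v) w"
    if B: "range B \<subseteq> sets borel" "disjoint_family (B :: nat \<Rightarrow> real set)" for B v w
  proof -
    have Bn: "B n \<in> sets borel" for n using B by auto
    have "(\<Union>i. B i) \<in> sets borel" using Bn by auto
    then show ?thesis using borel_functional_sums[OF bf[of v w] Bn B(2)] by (simp only: E Bn)
  qed
  have E_UNIV: "E UNIV v = v" for v
  proof (rule vector_eq_rdot[THEN iffD1], rule allI)
    fix w
    have "(\<lambda>x. x ^ 0) = (indicator UNIV :: real \<Rightarrow> real)" by auto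
    then have "b (indicator UNIV) v w = inner v w" using bm[of 0 v w] by simp
    then show "inner (E UNIV v) w = inner v w" by (simp add: E)
  qed
  have pvm: "real_pvm E 0 M"
  proof
    show "inner (E B v) w = inner v (E B w)" if "B \<in> sets borel" for B v w
      using b_sym[OF bdd_borel_indicator[OF that]] E[OF that] by (metis inner_commute)
    show "E A (E B v) = E (A \<inter> B) v" if "A \<in> sets borel" "B \<in> sets borel" for A B v
    proof (rule vector_eq_rdot[THEN iffD1], rule allI)
      fix w
      have "(\<lambda>x. indicator A x * indicator B x :: real) = indicator (A \<inter> B)"
        by (auto simp: indicator_def)
      then show "inner (E A (E B v)) w = inner (E (A \<inter> B) v) w"
        using b_E[OF that(2) bdd_borel_indicator[OF that(1)]] that by (simp only: E sets.Int)
    qed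
    show "E {0..M} v = E UNIV v" for v
      unfolding E_UNIV
    proof (rule vector_eq_rdot[THEN iffD1], rule allI)
      fix w
      have "b (indicator {0..M}) v w = b (\<lambda>x. x ^ 0) v w"
        by (rule borel_functional_cong[OF bf]) (auto intro!: bdd_borel_indicator)
      then show "inner (E {0..M} v) w = inner v w" using bm[of 0 v w] by (simp add: E)
    qed
  qed (rule E_sums)
  interpret real_pvm E 0 M by (rule pvm)
  have "inner (T v) v = (\<integral>x. x \<partial>meas v)" for v
  proof -
    have "(\<integral>x. x \<partial>meas v) = b (\<lambda>x. x) v v"
      unfolding Q_def[symmetric]
    proof (rule borel_functional_eqI[OF borel_functional_meas[of v] bf[of v v] bdd_borel_id])
      fix A :: "real set" assume "A \<in> sets borel"
      then show "real_pvm.Q E (indicator A) v = b (indicator A) v v" by (simp only: Q_indicator E)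
    qed
    then show ?thesis using bm[of 1 v v] by simp
  qed
  moreover have "inner (E B v) w = inner (E B v') w'"
    if "B \<in> sets borel" "\<And>n. inner ((T ^^ n) v) w = inner ((T ^^ n) v') w'" for B v w v' w'
    using b_cong[OF bdd_borel_indicator[OF that(1)] that(2)] E[OF that(1)] by simp
  ultimately show ?thesis using that pvm E_UNIV E_sums by blast
qed

section \<open>The Hilbert space of square-summable functions\<close>

text \<open>A type, so that the spectral theorem for \<open>real_inner\<close> applies;
  \<open>ell2 S\<close> reappears as the subspace of functions supported in
  \<open>S\<close>.\<close>

typedef 'i l2 = "{v :: 'i \<Rightarrow> complex. (\<lambda>x. (cmod (v x))\<^sup>2) summable_on UNIV}"
  morphisms l2_fun Abs_l2
  by (rule exI[of _ "\<lambda>_. 0"]) simp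

lemma summable_l2_fun: "(\<lambda>x. (cmod (l2_fun v x))\<^sup>2) summable_on UNIV"
  using l2_fun[of v] by simp

lemma l2_fun_Abs: "(\<lambda>x. (cmod (v x))\<^sup>2) summable_on UNIV \<Longrightarrow> l2_fun (Abs_l2 v) = v"
  by (rule Abs_l2_inverse) simp

lemma summable_l2_add:
  assumes "(\<lambda>x. (cmod (v x))\<^sup>2) summable_on UNIV" "(\<lambda>x. (cmod (w x))\<^sup>2) summable_on UNIV"
  shows "(\<lambda>x. (cmod (v x + w x))\<^sup>2) summable_on UNIV"
proof (rule summable_on_comparison_test)
  show "(\<lambda>x. 2 * (cmod (v x))\<^sup>2 + 2 * (cmod (w x))\<^sup>2) summable_on UNIV"
    using assms by (intro summable_on_add summable_on_cmult_right)
  fix x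
  have "(cmod (v x + w x))\<^sup>2 \<le> (cmod (v x) + cmod (w x))\<^sup>2"
    by (intro power_mono norm_triangle_ineq) auto
  also have "\<dots> \<le> 2 * (cmod (v x))\<^sup>2 + 2 * (cmod (w x))\<^sup>2"
    using sum_squares_bound[of "cmod (v x)" "cmod (w x)"] by (simp add: power2_sum)
  finally show "(cmod (v x + w x))\<^sup>2 \<le> 2 * (cmod (v x))\<^sup>2 + 2 * (cmod (w x))\<^sup>2" .
qed auto

lemma summable_l2_scale:
  assumes "(\<lambda>x. (cmod (v x))\<^sup>2) summable_on UNIV"
  shows "(\<lambda>x. (cmod (c * v x))\<^sup>2) summable_on UNIV"
  using assms by (simp add: norm_mult power_mult_distrib summable_on_cmult_right)

lemma summable_l2_product:
  assumes "(\<lambda>x. (cmod (v x))\<^sup>2) summable_on UNIV" "(\<lambda>x. (cmod (w x))\<^sup>2) summable_on UNIV"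
  shows "(\<lambda>x. v x * cnj (w x)) summable_on UNIV"
proof (rule abs_summable_summable, rule summable_on_comparison_test)
  show "(\<lambda>x. (cmod (v x))\<^sup>2 + (cmod (w x))\<^sup>2) summable_on UNIV"
    using assms by (intro summable_on_add)
  fix x
  have "0 \<le> (cmod (v x))\<^sup>2 + (cmod (w x))\<^sup>2" by simp
  then show "norm (v x * cnj (w x)) \<le> (cmod (v x))\<^sup>2 + (cmod (w x))\<^sup>2"
    using sum_squares_bound[of "cmod (v x)" "cmod (w x)"] unfolding norm_mult complex_mod_cnj by linarith
qed auto

instantiation l2 :: (type) real_inner
begin

definition "0 = Abs_l2 (\<lambda>_. 0)"
definition "v + w = Abs_l2 (\<lambda>x. l2_fun v x + l2_fun w x)"
definition "- v = Abs_l2 (\<lambda>x. - l2_fun v x)"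
definition "v - w = Abs_l2 (\<lambda>x. l2_fun v x - l2_fun w x)"
definition "scaleR c v = Abs_l2 (\<lambda>x. complex_of_real c * l2_fun v x)"
definition "inner v w = Re (\<Sum>\<^sub>\<infinity>x. l2_fun v x * cnj (l2_fun w x))"
definition "norm (v :: 'a l2) = sqrt (inner v v)"
definition "sgn (v :: 'a l2) = scaleR (inverse (norm v)) v"
definition "dist v (w :: 'a l2) = norm (v - w)"
definition "uniformity = (INF e\<in>{0<..}. principal {(v, w :: 'a l2). dist v w < e})"
definition "open (U :: 'a l2 set) \<longleftrightarrow>
  (\<forall>x\<in>U. eventually (\<lambda>(x', y). x' = x \<longrightarrow> y \<in> U) uniformity)"

lemma l2_fun_zero [simp]: "l2_fun 0 x = 0"
  by (simp add: zero_l2_def l2_fun_Abs)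

lemma l2_fun_add [simp]: "l2_fun (v + w) x = l2_fun v x + l2_fun w x"
  by (simp add: plus_l2_def l2_fun_Abs summable_l2_add summable_l2_fun)

lemma l2_fun_uminus [simp]: "l2_fun (- v) x = - l2_fun v x"
  by (simp add: uminus_l2_def l2_fun_Abs summable_l2_fun)

lemma l2_fun_diff [simp]: "l2_fun (v - w) x = l2_fun v x - l2_fun w x"
proof -
  have "(\<lambda>x. (cmod (l2_fun v x + - l2_fun w x))\<^sup>2) summable_on UNIV"
    by (rule summable_l2_add) (simp_all add: summable_l2_fun)
  then show ?thesis by (simp add: minus_l2_def l2_fun_Abs)
qed

lemma l2_fun_scaleR [simp]: "l2_fun (scaleR c v) x = complex_of_real c * l2_fun v x"
  by (simp add: scaleR_l2_def l2_fun_Abs summable_l2_scale summable_l2_fun)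

lemma l2_eqI: "(\<And>x. l2_fun v x = l2_fun w x) \<Longrightarrow> v = w"
  by (metis ext l2_fun_inject)

lemma inner_l2_self: "inner v v = (\<Sum>\<^sub>\<infinity>x. (cmod (l2_fun v x))\<^sup>2)"
proof -
  have "Re (l2_fun v x * cnj (l2_fun v x)) = (cmod (l2_fun v x))\<^sup>2" for x
    by (simp add: complex_norm_square[symmetric])
  then show ?thesis
    unfolding inner_l2_def infsum_Re[OF summable_l2_product[OF summable_l2_fun summable_l2_fun], symmetric]
    by simp
qed

instance
proof
  fix u v w :: "'a l2" and r s :: real
  note sm = summable_l2_product[OF summable_l2_fun summable_l2_fun]
  show "u + v + w = u + (v + w)" "u + v = v + u" "0 + u = u" "- u + u = 0" "u - v = u + - v"
    "scaleR r (u + v) = scaleR r u + scaleR r v" "scaleR (r + s) u = scaleR r u + scaleR s u"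
    "scaleR r (scaleR s u) = scaleR (r * s) u" "scaleR 1 u = u"
    by (auto intro!: l2_eqI simp: algebra_simps)
  show "dist u v = norm (u - v)" by (simp add: dist_l2_def)
  show "sgn u = inverse (norm u) *\<^sub>R u" by (simp add: sgn_l2_def)
  show "uniformity = (INF e\<in>{0<..}. principal {(v, w :: 'a l2). dist v w < e})"
    by (rule uniformity_l2_def)
  show "open U \<longleftrightarrow> (\<forall>x\<in>U. eventually (\<lambda>(x', y). x' = x \<longrightarrow> y \<in> U) uniformity)" for U :: "'a l2 set"
    by (rule open_l2_def)
  have "(\<Sum>\<^sub>\<infinity>x. l2_fun w x * cnj (l2_fun v x)) = (\<Sum>\<^sub>\<infinity>x. cnj (l2_fun v x * cnj (l2_fun w x)))"
    by (simp add: mult.commute)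
  then show "inner v w = inner w v"
    by (simp only: inner_l2_def infsum_cnj cnj.simps)
  show "inner (u + v) w = inner u w + inner v w"
    by (simp add: inner_l2_def ring_distribs infsum_add sm)
  show "inner (scaleR r v) w = r * inner v w"
    by (simp add: inner_l2_def mult.assoc infsum_cmult_right')
  show "0 \<le> inner v v" by (simp add: inner_l2_self infsum_nonneg)
  show "inner v v = 0 \<longleftrightarrow> v = 0"
  proof
    assume "inner v v = 0"
    then have "(cmod (l2_fun v x))\<^sup>2 = 0" for x
      using nonneg_infsum_le_0D[of "\<lambda>x. (cmod (l2_fun v x))\<^sup>2" UNIV x] summable_l2_fun[of v]
      by (simp add: inner_l2_self)
    then show "v = 0" by (auto intro!: l2_eqI)
  qed (simp add: inner_l2_self)
  show "norm v = sqrt (inner v v)" by (rule norm_l2_def)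
qed

end

definition l2_single :: "'i \<Rightarrow> complex \<Rightarrow> 'i l2" where
  "l2_single x c = Abs_l2 (\<lambda>y. if y = x then c else 0)"

definition l2_restrict :: "'i set \<Rightarrow> 'i l2 \<Rightarrow> 'i l2" where
  "l2_restrict S v = Abs_l2 (\<lambda>x. if x \<in> S then l2_fun v x else 0)"

definition l2_ii :: "'i l2 \<Rightarrow> 'i l2" where
  "l2_ii v = Abs_l2 (\<lambda>x. \<i> * l2_fun v x)"

lemma summable_on_finite_support:
  fixes f :: "'i \<Rightarrow> real"
  assumes "finite {x. f x \<noteq> 0}"
  shows "f summable_on UNIV"
proof -
  have "f summable_on {x. f x \<noteq> 0}" using assms by (rule summable_on_finite)
  also have "?this \<longleftrightarrow> f summable_on UNIV" by (rule summable_on_cong_neutral) auto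
  finally show ?thesis .
qed

lemma l2_fun_single [simp]: "l2_fun (l2_single x c) y = (if y = x then c else 0)"
proof -
  have "finite {y. (cmod (if y = x then c else 0))\<^sup>2 \<noteq> 0}"
    by (rule finite_subset[of _ "{x}"]) auto
  then show ?thesis
    unfolding l2_single_def by (subst l2_fun_Abs) (auto intro: summable_on_finite_support)
qed

lemma l2_fun_restrict [simp]: "l2_fun (l2_restrict S v) x = (if x \<in> S then l2_fun v x else 0)"
proof -
  have "(\<lambda>x. (cmod (if x \<in> S then l2_fun v x else 0))\<^sup>2) summable_on UNIV"
    by (rule summable_on_comparison_test[OF summable_l2_fun[of v]]) auto
  then show ?thesis by (simp add: l2_restrict_def l2_fun_Abs)
qed

lemma l2_fun_ii [simp]: "l2_fun (l2_ii v) x = \<i> * l2_fun v x"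
  by (simp add: l2_ii_def l2_fun_Abs summable_l2_fun summable_l2_scale)

lemma l2_fun_sum [simp]: "l2_fun (\<Sum>i\<in>I. f i) x = (\<Sum>i\<in>I. l2_fun (f i) x)"
  by (induction I rule: infinite_finite_induct) auto

lemma infsum_single: "(\<Sum>\<^sub>\<infinity>y. if y = x then f y else 0) = (f x :: 'b :: {comm_monoid_add, t2_space})"
proof -
  have "(\<Sum>\<^sub>\<infinity>y\<in>UNIV. if y = x then f y else 0) = (\<Sum>\<^sub>\<infinity>y\<in>{x}. f y)"
    by (rule infsum_cong_neutral) auto
  then show ?thesis by simp
qed

lemma inner_l2_single: "inner v (l2_single x c) = Re (l2_fun v x * cnj c)"
proof -
  have "(\<Sum>\<^sub>\<infinity>y. l2_fun v y * cnj (l2_fun (l2_single x c) y)) = (\<Sum>\<^sub>\<infinity>y. if y = x then l2_fun v y * cnj c else 0)"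
    by (rule infsum_cong) simp
  then show ?thesis by (simp only: inner_l2_def infsum_single)
qed

lemma l2_single_decomp: "l2_single x c = Re c *\<^sub>R l2_single x 1 + Im c *\<^sub>R l2_single x \<i>"
  by (rule l2_eqI) (auto simp: complex_eq_iff)

lemma l2_restrict_finite:
  "finite F \<Longrightarrow> l2_restrict F v = (\<Sum>x\<in>F. l2_single x (l2_fun v x))"
  by (rule l2_eqI) simp

lemma inner_l2_restrict_finite:
  "finite F \<Longrightarrow> inner v (l2_restrict F w) = (\<Sum>x\<in>F. Re (l2_fun v x * cnj (l2_fun w x)))"
  by (simp add: l2_restrict_finite inner_sum_right inner_l2_single)

text \<open>The squared distance to a truncation is the squared norm minus the partial sum of
  squared moduli.\<close>

lemma l2_restrict_tendsto:
  "((\<lambda>F. l2_restrict F v) \<longlongrightarrow> v) (finite_subsets_at_top UNIV)"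
proof -
  let ?A = "finite_subsets_at_top (UNIV :: 'a set)"
  have "((\<lambda>x. (cmod (l2_fun v x))\<^sup>2) has_sum inner v v) UNIV"
    using summable_l2_fun[of v] unfolding inner_l2_self by (rule has_sum_infsum)
  then have "((\<lambda>F. \<Sum>x\<in>F. (cmod (l2_fun v x))\<^sup>2) \<longlongrightarrow> inner v v) ?A"
    by (simp add: has_sum_def)
  then have "((\<lambda>F. sqrt (inner v v - (\<Sum>x\<in>F. (cmod (l2_fun v x))\<^sup>2))) \<longlongrightarrow> sqrt (inner v v - inner v v)) ?A"
    by (intro tendsto_intros)
  moreover have "eventually (\<lambda>F. sqrt (inner v v - (\<Sum>x\<in>F. (cmod (l2_fun v x))\<^sup>2)) = norm (l2_restrict F v - v)) ?A"
  proof (rule eventually_finite_subsets_at_top_weakI)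
    fix F :: "'a set" assume F: "finite F"
    have "inner v (l2_restrict F v) = (\<Sum>x\<in>F. (cmod (l2_fun v x))\<^sup>2)"
      unfolding inner_l2_restrict_finite[OF F]
      by (rule sum.cong) (simp_all add: complex_norm_square[symmetric])
    moreover have "inner (l2_restrict F v) (l2_restrict F v) = (\<Sum>x\<in>F. (cmod (l2_fun v x))\<^sup>2)"
      unfolding inner_l2_restrict_finite[OF F]
      by (rule sum.cong) (simp_all add: complex_norm_square[symmetric])
    ultimately show "sqrt (inner v v - (\<Sum>x\<in>F. (cmod (l2_fun v x))\<^sup>2)) = norm (l2_restrict F v - v)"
      unfolding norm_eq_sqrt_inner by (simp add: inner_diff_left inner_diff_right inner_commute)
  qed
  ultimately have "((\<lambda>F. norm (l2_restrict F v - v)) \<longlongrightarrow> 0) ?A"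
    by (simp add: tendsto_cong)
  then show ?thesis
    by (metis tendsto_norm_zero_iff LIM_zero_iff)
qed

text \<open>The values of \<open>g\<close> on coordinate vectors force the representing vector;
  boundedness makes it square-summable, and truncations extend the identity to all vectors.\<close>

lemma l2_riesz:
  fixes g :: "'i l2 \<Rightarrow> real"
  assumes g: "bounded_linear g"
  shows "\<exists>u. \<forall>w. g w = inner u w"
proof -
  interpret bounded_linear g by fact
  obtain K where K: "\<And>v. norm (g v) \<le> norm v * K" "K \<ge> 0" using nonneg_bounded by auto
  \<comment> \<open>A real functional sees a complex coordinate through its values at 1 and at
    \<open>\<i>\<close>.\<close>
  define u where "u x = Complex (g (l2_single x 1)) (g (l2_single x \<i>))" for x
  have gs: "g (l2_single x c) = Re (u x * cnj c)" for x c
    by (subst l2_single_decomp) (simp add: add scale u_def mult.commute)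
  have bound: "(\<Sum>x\<in>F. (cmod (u x))\<^sup>2) \<le> K\<^sup>2" if F: "finite F" for F
  proof -
    define s where "s = (\<Sum>x\<in>F. (cmod (u x))\<^sup>2)"
    \<comment> \<open>Testing \<open>g\<close> on the truncated candidate itself gives
      \<open>s \<le> sqrt s * K\<close>, hence a bound of the partial sums by the square of
      \<open>K\<close>.\<close>
    define w where "w = (\<Sum>x\<in>F. l2_single x (u x))"
    have "g w = s" unfolding w_def s_def sum gs
      by (rule sum.cong) (simp_all add: complex_norm_square[symmetric])
    moreover have "inner w w = s"
    proof -
      have "inner w w = (\<Sum>x\<in>F. Re (l2_fun w x * cnj (u x)))"
        unfolding w_def by (simp add: inner_sum_right inner_l2_single)
      also have "\<dots> = s" unfolding s_def w_def
        using F by (intro sum.cong) (simp_all add: complex_norm_square[symmetric])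
      finally show ?thesis .
    qed
    ultimately have s: "s \<le> sqrt s * K" "s \<ge> 0"
      using K(1)[of w] unfolding norm_eq_sqrt_inner s_def by (auto intro: sum_nonneg)
    have "sqrt s \<le> K"
    proof (cases "s = 0")
      case False
      then have "sqrt s * sqrt s \<le> sqrt s * K" "sqrt s > 0" using s by auto
      then show ?thesis using mult_le_cancel_left_pos by blast
    qed (use K in simp)
    then have "(sqrt s)\<^sup>2 \<le> K\<^sup>2" using s(2) by (intro power_mono) auto
    then have "s \<le> K\<^sup>2" using s(2) by simp
    then show ?thesis by (simp add: s_def)
  qed
  have "(\<lambda>x. (cmod (u x))\<^sup>2) summable_on UNIV"
    by (rule nonneg_bdd_above_summable_on) (auto intro!: bdd_aboveI2[where M = "K\<^sup>2"] bound)
  then have u: "l2_fun (Abs_l2 u) x = u x" for x by (simp add: l2_fun_Abs)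
  have "g w = inner (Abs_l2 u) w" for w
  proof (rule tendsto_unique[OF finite_subsets_at_top_neq_bot])
    show "((\<lambda>F. g (l2_restrict F w)) \<longlongrightarrow> g w) (finite_subsets_at_top UNIV)"
      by (rule tendsto[OF l2_restrict_tendsto])
    have "((\<lambda>F. inner (Abs_l2 u) (l2_restrict F w)) \<longlongrightarrow> inner (Abs_l2 u) w) (finite_subsets_at_top UNIV)"
      by (intro tendsto_intros l2_restrict_tendsto)
    moreover have "eventually (\<lambda>F. inner (Abs_l2 u) (l2_restrict F w) = g (l2_restrict F w)) (finite_subsets_at_top UNIV)"
      by (rule eventually_finite_subsets_at_top_weakI)
         (simp add: inner_l2_restrict_finite u, simp add: l2_restrict_finite sum gs)
    ultimately show "((\<lambda>F. g (l2_restrict F w)) \<longlongrightarrow> inner (Abs_l2 u) w) (finite_subsets_at_top UNIV)"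
      by (simp add: tendsto_cong)
  qed
  then show ?thesis by blast
qed

section \<open>The spaces \<open>ell2 S\<close> inside the real Hilbert space\<close>

lemma ell2_iff: "v \<in> ell2 S \<longleftrightarrow> (\<forall>x. x \<notin> S \<longrightarrow> v x = 0) \<and> (\<lambda>x. (cmod (v x))\<^sup>2) summable_on UNIV"
proof -
  have "(\<lambda>x. (cmod (v x))\<^sup>2) summable_on S \<longleftrightarrow> (\<lambda>x. (cmod (v x))\<^sup>2) summable_on UNIV"
    if "\<forall>x. x \<notin> S \<longrightarrow> v x = 0"
    using that by (intro summable_on_cong_neutral) auto
  then show ?thesis by (auto simp: ell2_def)
qed

lemma ell2_inner_commute: "ell2_inner S w v = cnj (ell2_inner S v w)"
  unfolding ell2_inner_def infsum_cnj[symmetric] by (simp add: mult.commute)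

lemma l2_fun_Abs_ell2: "v \<in> ell2 S \<Longrightarrow> l2_fun (Abs_l2 v) = v"
  by (simp add: ell2_iff l2_fun_Abs)

lemma l2_fun_in_ell2: "l2_fun v \<in> ell2 S \<longleftrightarrow> (\<forall>x. x \<notin> S \<longrightarrow> l2_fun v x = 0)"
  by (simp add: ell2_iff summable_l2_fun)

lemma restrict_in_ell2 [simp]: "l2_fun (l2_restrict S v) \<in> ell2 S"
  by (simp add: l2_fun_in_ell2)

lemma restrict_ell2: "l2_fun v \<in> ell2 S \<Longrightarrow> l2_restrict S v = v"
  by (rule l2_eqI) (simp add: l2_fun_in_ell2)

text \<open>
  \<open>'i l2\<close> is treated as a real Hilbert space; the complex inner product has imaginary part
  \<open>inner v (l2_ii w)\<close>.
\<close>

lemma inner_l2_ii: "inner v (l2_ii w) = Im (\<Sum>\<^sub>\<infinity>x. l2_fun v x * cnj (l2_fun w x))"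
proof -
  have "(\<Sum>\<^sub>\<infinity>x. l2_fun v x * cnj (l2_fun (l2_ii w) x)) = (\<Sum>\<^sub>\<infinity>x. - \<i> * (l2_fun v x * cnj (l2_fun w x)))"
    by (rule infsum_cong) simp
  also have "\<dots> = - \<i> * (\<Sum>\<^sub>\<infinity>x. l2_fun v x * cnj (l2_fun w x))"
    by (rule infsum_cmult_right')
  finally show ?thesis by (simp add: inner_l2_def)
qed

lemma inner_l2_ii_left: "inner (l2_ii v) w = - inner v (l2_ii w)"
proof -
  have "(\<Sum>\<^sub>\<infinity>x. l2_fun (l2_ii v) x * cnj (l2_fun w x)) = (\<Sum>\<^sub>\<infinity>x. \<i> * (l2_fun v x * cnj (l2_fun w x)))"
    by (rule infsum_cong) (simp add: mult.assoc)
  also have "\<dots> = \<i> * (\<Sum>\<^sub>\<infinity>x. l2_fun v x * cnj (l2_fun w x))"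
    by (rule infsum_cmult_right')
  finally show ?thesis by (simp add: inner_l2_ii) (simp add: inner_l2_def)
qed

lemma ell2_inner_l2:
  assumes "\<And>x. x \<notin> S \<Longrightarrow> l2_fun v x = 0 \<or> l2_fun w x = 0"
  shows "ell2_inner S (l2_fun v) (l2_fun w) = Complex (inner v w) (inner v (l2_ii w))"
proof -
  have "ell2_inner S (l2_fun v) (l2_fun w) = (\<Sum>\<^sub>\<infinity>x. l2_fun v x * cnj (l2_fun w x))"
    unfolding ell2_inner_def using assms by (intro infsum_cong_neutral) auto
  then show ?thesis by (simp add: complex_eq_iff inner_l2_ii) (simp add: inner_l2_def)
qed

lemma ell2_inner_l2':
  "l2_fun v \<in> ell2 S \<Longrightarrow> ell2_inner S (l2_fun v) (l2_fun w) = Complex (inner v w) (inner v (l2_ii w))"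
  "l2_fun w \<in> ell2 S \<Longrightarrow> ell2_inner S (l2_fun v) (l2_fun w) = Complex (inner v w) (inner v (l2_ii w))"
  by (auto intro!: ell2_inner_l2 simp: l2_fun_in_ell2)

lemma inner_l2_restrict:
  assumes "l2_fun v \<in> ell2 S"
  shows "inner v (l2_restrict S w) = inner v w"
  using assms unfolding inner_l2_def by (intro arg_cong[of _ _ Re] infsum_cong) (auto simp: l2_fun_in_ell2)

lemma l2_ii_restrict: "l2_restrict S (l2_ii v) = l2_ii (l2_restrict S v)"
  by (rule l2_eqI) simp

text \<open>Extension by 0 on the orthogonal complement of \<open>ell2 S\<close>: an operator on the
  subspace becomes one on the whole type.\<close>

definition l2_lift :: "'i set \<Rightarrow> (('i \<Rightarrow> complex) \<Rightarrow> 'i \<Rightarrow> complex) \<Rightarrow> 'i l2 \<Rightarrow> 'i l2" where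
  "l2_lift S T v = Abs_l2 (T (l2_fun (l2_restrict S v)))"

locale ell2_operator =
  fixes S :: "'i set" and T :: "('i \<Rightarrow> complex) \<Rightarrow> 'i \<Rightarrow> complex"
  assumes closed: "v \<in> ell2 S \<Longrightarrow> T v \<in> ell2 S"
    and sym: "v \<in> ell2 S \<Longrightarrow> w \<in> ell2 S \<Longrightarrow> ell2_inner S (T v) w = ell2_inner S v (T w)"
begin

lemma l2_fun_lift: "l2_fun (l2_lift S T v) = T (l2_fun (l2_restrict S v))"
  unfolding l2_lift_def by (rule l2_fun_Abs_ell2[of _ S]) (simp add: closed)

lemma lift_in_ell2 [simp]: "l2_fun (l2_lift S T v) \<in> ell2 S"
  by (simp add: l2_fun_lift closed)

lemma inner_lift:
  "Complex (inner (l2_lift S T v) w) (inner (l2_lift S T v) (l2_ii w)) =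
    ell2_inner S (T (l2_fun (l2_restrict S v))) (l2_fun (l2_restrict S w))"
  unfolding l2_fun_lift[symmetric] ell2_inner_l2'(1)[OF lift_in_ell2] l2_ii_restrict[symmetric]
  by (simp add: inner_l2_restrict)

lemma inner_lift_both:
  "inner (l2_lift S T v) w = inner v (l2_lift S T w)"
  "inner (l2_lift S T v) (l2_ii w) = inner v (l2_ii (l2_lift S T w))"
proof -
  have "Complex (inner (l2_lift S T v) w) (inner (l2_lift S T v) (l2_ii w)) =
      ell2_inner S (l2_fun (l2_restrict S v)) (l2_fun (l2_lift S T w))"
    unfolding inner_lift l2_fun_lift by (simp add: sym)
  also have "\<dots> = Complex (inner (l2_restrict S v) (l2_lift S T w)) (inner (l2_restrict S v) (l2_ii (l2_lift S T w)))"
    by (rule ell2_inner_l2'(2)) simp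
  also have "inner (l2_restrict S v) (l2_lift S T w) = inner v (l2_lift S T w)"
    using inner_l2_restrict[of "l2_lift S T w" S v] by (simp add: inner_commute)
  also have "inner (l2_restrict S v) (l2_ii (l2_lift S T w)) = inner v (l2_ii (l2_lift S T w))"
  proof -
    have "l2_fun (l2_ii (l2_lift S T w)) \<in> ell2 S"
      using lift_in_ell2[of w] by (simp add: l2_fun_in_ell2)
    from inner_l2_restrict[OF this] show ?thesis by (metis inner_commute)
  qed
  finally show "inner (l2_lift S T v) w = inner v (l2_lift S T w)"
    "inner (l2_lift S T v) (l2_ii w) = inner v (l2_ii (l2_lift S T w))" by auto
qed

lemma linear_lift: "linear (l2_lift S T)"
  by (rule symmetric_imp_linear) (rule inner_lift_both)

text \<open>The imaginary part of the symmetry relation says exactly this; with real linearity it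
  makes the lift complex linear.\<close>

lemma lift_ii: "l2_lift S T (l2_ii v) = l2_ii (l2_lift S T v)"
  by (rule vector_eq_ldot[THEN iffD1]) (metis inner_lift_both)

lemma lift_Abs: "v \<in> ell2 S \<Longrightarrow> l2_lift S T (Abs_l2 v) = Abs_l2 (T v)"
  by (simp add: l2_lift_def restrict_ell2 l2_fun_Abs_ell2)

lemma funpow_closed: "v \<in> ell2 S \<Longrightarrow> (T ^^ n) v \<in> ell2 S"
  by (induction n) (auto simp: closed)

lemma lift_funpow: "v \<in> ell2 S \<Longrightarrow> (l2_lift S T ^^ n) (Abs_l2 v) = Abs_l2 ((T ^^ n) v)"
  by (induction n) (auto simp: lift_Abs funpow_closed)

lemma inner_lift_Abs:
  assumes "v \<in> ell2 S" "w \<in> ell2 S"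
  shows "inner (l2_lift S T (Abs_l2 v)) (Abs_l2 w) = Re (ell2_inner S (T v) w)"
proof -
  have "Complex (inner (l2_lift S T (Abs_l2 v)) (Abs_l2 w)) (inner (l2_lift S T (Abs_l2 v)) (l2_ii (Abs_l2 w)))
    = ell2_inner S (T v) w"
    unfolding inner_lift using assms by (simp add: restrict_ell2 l2_fun_Abs_ell2)
  then show ?thesis by (metis complex.sel(1))
qed

end

lemma ell2_inner_Abs:
  assumes "v \<in> ell2 S" "w \<in> ell2 S"
  shows "ell2_inner S v w = Complex (inner (Abs_l2 v) (Abs_l2 w)) (inner (Abs_l2 v) (l2_ii (Abs_l2 w)))"
  using ell2_inner_l2'(1)[of "Abs_l2 v" S "Abs_l2 w"] assms by (simp add: l2_fun_Abs_ell2)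

lemma Re_ell2_inner_restrict:
  "Re (ell2_inner S (l2_fun (l2_restrict S v)) (l2_fun (l2_restrict S v))) \<le> inner v v"
proof -
  have "inner v (l2_restrict S v) = inner (l2_restrict S v) (l2_restrict S v)"
    using inner_l2_restrict[of "l2_restrict S v" S v] by (simp add: inner_commute)
  moreover have "0 \<le> inner (v - l2_restrict S v) (v - l2_restrict S v)" by simp
  ultimately show ?thesis
    by (simp add: ell2_inner_l2'(1) inner_diff_left inner_diff_right inner_commute)
qed

text \<open>The real spectral theorem is applied to the lift. It remains to see that the projections
  preserve \<open>ell2 S\<close> and are symmetric for the complex inner product; both are read off
  from powers of the lift.\<close>

theorem (in ell2_operator) spectral_measure_exists:
  assumes pos: "\<And>v. v \<in> ell2 S \<Longrightarrow> 0 \<le> Re (ell2_inner S (T v) v)"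
    and le: "\<And>v. v \<in> ell2 S \<Longrightarrow> Re (ell2_inner S (T v) v) \<le> M * Re (ell2_inner S v v)" and M: "M > 0"
  shows "\<exists>E. is_spectral_measure S T E"
proof -
  let ?T = "l2_lift S T"
  have T: "inner (?T v) v = Re (ell2_inner S (T (l2_fun (l2_restrict S v))) (l2_fun (l2_restrict S v)))" for v
    using inner_lift[of v v] by (metis complex.sel(1))
  have "0 \<le> inner (?T v) v" for v by (simp add: T pos)
  moreover have "inner (?T v) v \<le> M * inner v v" for v
    unfolding T using le[of "l2_fun (l2_restrict S v)"] Re_ell2_inner_restrict[of S v] M
    by (meson mult_left_mono order_trans less_imp_le restrict_in_ell2)
  ultimately obtain E where E: "real_pvm E 0 M" "\<And>v. E UNIV v = v"
    "\<And>v. inner (?T v) v = (\<integral>x. x \<partial>real_pvm.meas E v)"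
    and cong: "\<And>B v w v' w'. B \<in> sets borel \<Longrightarrow> (\<And>n. inner ((?T ^^ n) v) w = inner ((?T ^^ n) v') w') \<Longrightarrow>
       inner (E B v) w = inner (E B v') w'"
    and E_sums: "\<And>B v w. range B \<subseteq> sets borel \<Longrightarrow> disjoint_family (B :: nat \<Rightarrow> real set) \<Longrightarrow>
      (\<lambda>n. inner (E (B n) v) w) sums inner (E (\<Union>n. B n) v) w"
    by (rule spectral_theorem[OF linear_lift inner_lift_both(1) _ _ M l2_riesz]) blast+
  interpret real_pvm E 0 M by (rule E(1))
  have E_ell2: "l2_fun (E B (Abs_l2 v)) \<in> ell2 S" if B: "B \<in> sets borel" and v: "v \<in> ell2 S" for B v
    unfolding l2_fun_in_ell2
  proof (intro allI impI)
    fix x assume x: "x \<notin> S"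
    have "Re (l2_fun (E B (Abs_l2 v)) x * cnj c) = 0" for c
    proof -
      \<comment> \<open>Powers of the lift keep \<open>v\<close> supported in \<open>S\<close>, so
        against a coordinate outside \<open>S\<close> all moments are those of the zero
        vector.\<close>
      have "inner ((?T ^^ n) (Abs_l2 v)) (l2_single x c) = inner ((?T ^^ n) 0) (l2_single x c)" for n
        unfolding lift_funpow[OF v] inner_l2_single
        using funpow_closed[OF v, of n] x linear_0[OF linear_funpow[OF linear_lift], of n]
        by (simp add: ell2_iff l2_fun_Abs)
      from cong[OF B this] show ?thesis using linear_0[OF linear[OF B]] by (simp add: inner_l2_single)
    qed
    \<comment> \<open>Taking \<open>c\<close> to be the value itself turns the real part into a
      squared modulus.\<close>
    from this[of "l2_fun (E B (Abs_l2 v)) x"] show "l2_fun (E B (Abs_l2 v)) x = 0"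
      by (simp add: complex_norm_square[symmetric])
  qed
  have E_ii: "inner (E B v) (l2_ii w) = inner v (l2_ii (E B w))" if B: "B \<in> sets borel" for B v w
  proof -
    have ii: "(?T ^^ n) (l2_ii v) = l2_ii ((?T ^^ n) v)" for n v
      by (induction n) (auto simp: lift_ii)
    \<comment> \<open>Multiplication by \<open>\<i>\<close> is skew and commutes with the lift, so
      moving it to the left slot preserves all moments.\<close>
    have "inner (E B v) (l2_ii w) = inner (E B (- l2_ii v)) w"
    proof (rule cong[OF B])
      fix n
      have "(?T ^^ n) (- l2_ii v) = - l2_ii ((?T ^^ n) v)"
        using linear_neg[OF linear_funpow[OF linear_lift], of n "l2_ii v"] by (simp add: ii)
      then show "inner ((?T ^^ n) v) (l2_ii w) = inner ((?T ^^ n) (- l2_ii v)) w"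
        by (simp add: inner_l2_ii_left)
    qed
    also have "\<dots> = - inner (l2_ii v) (E B w)"
      using sym[OF B] by simp
    finally show ?thesis by (simp add: inner_l2_ii_left)
  qed
  define F where "F B v = l2_fun (E B (Abs_l2 v))" for B v
  have F_inner: "ell2_inner S (F B v) w = Complex (inner (E B (Abs_l2 v)) (Abs_l2 w)) (inner (E B (Abs_l2 v)) (l2_ii (Abs_l2 w)))"
    if "w \<in> ell2 S" for B v w
    using ell2_inner_l2'(2)[of "Abs_l2 w" S "E B (Abs_l2 v)"] that by (simp add: l2_fun_Abs_ell2 F_def)
  have F_inner': "ell2_inner S v (F B w) = Complex (inner (Abs_l2 v) (E B (Abs_l2 w))) (inner (Abs_l2 v) (l2_ii (E B (Abs_l2 w))))"
    if "v \<in> ell2 S" for B v w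
    using ell2_inner_l2'(1)[of "Abs_l2 v" S "E B (Abs_l2 w)"] that by (simp add: l2_fun_Abs_ell2 F_def)
  have AF: "Abs_l2 (F B v) = E B (Abs_l2 v)" for B v
    by (simp add: F_def l2_fun_inverse)
  have "is_spectral_measure S T F"
    unfolding is_spectral_measure_def projection_valued_measure_def orth_projection_def
  proof (intro conjI ballI allI impI)
    fix B :: "real set" and v assume B: "B \<in> sets borel" and v: "v \<in> ell2 S"
    show "F B v \<in> ell2 S" using E_ell2[OF B v] by (simp add: F_def)
    show "F B (F B v) = F B v" using mult[OF B B, of "Abs_l2 v"] by (simp add: F_def l2_fun_inverse)
    show "ell2_inner S (F B v) w = ell2_inner S v (F B w)" if "w \<in> ell2 S" for w
      by (simp only: F_inner[OF that] F_inner'[OF v] E_ii[OF B], simp only: sym[OF B])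
  next
    fix v assume v: "v \<in> ell2 S"
    show "F UNIV v = v" using v by (simp add: F_def E(2) l2_fun_Abs_ell2)
    show "F (A \<inter> B) v = F A (F B v)" if "A \<in> sets borel" "B \<in> sets borel" for A B
      using mult[OF that, of "Abs_l2 v"] by (simp add: F_def l2_fun_inverse)
    show "(\<lambda>n. ell2_inner S (F (B n) v) w) sums ell2_inner S (F (\<Union>n. B n) v) w"
      if "range B \<subseteq> sets borel" "disjoint_family B" "w \<in> ell2 S" for B :: "nat \<Rightarrow> real set" and w
      unfolding F_inner[OF that(3)] sums_complex_iff using E_sums[OF that(1,2)] by simp
    have "pvm_measure S F v = meas (Abs_l2 v)"
      unfolding pvm_measure_def meas_def by (simp add: F_inner[OF v])
    moreover have "Re (ell2_inner S (T v) v) = (\<integral>x. x \<partial>meas (Abs_l2 v))"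
      using inner_lift_Abs[OF v v] E(3) by simp
    moreover have "Im (ell2_inner S (T v) v) = 0"
    proof -
      have "ell2_inner S (T v) v = cnj (ell2_inner S (T v) v)"
        using ell2_inner_commute[of S "T v" v] ell2_operator.sym[OF ell2_operator_axioms v v] by simp
      then show ?thesis by (simp add: complex_eq_iff)
    qed
    ultimately show "ell2_inner S (T v) v = complex_of_real (LINT t|pvm_measure S F v. t)"
      by (simp add: complex_eq_iff)
  next
    \<comment> \<open>The definition of a spectral measure asks for an interval symmetric about 0,
      and this one contains \<open>[0, M]\<close>.\<close>
    have "E {-M..M} v = v" for v
    proof -
      have "{-M..M} \<inter> {0..M} = {0..M}" using M by auto
      with mult[of "{-M..M}" "{0..M}" v] show ?thesis by (simp only: support E(2) borel_closed closed_atLeastAtMost)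
    qed
    then show "\<exists>K. \<forall>v\<in>ell2 S. F {-K..K} v = v" by (auto simp: F_def l2_fun_Abs_ell2 intro!: exI[of _ M])
  qed
  then show ?thesis by blast
qed

text \<open>Stated for an arbitrary spectral measure because the one inside \<open>ln_det\<close> is
  chosen. Its lift is a \<open>real_pvm\<close>, where \<open>moments\<close> gives the powers and
  \<open>AE_sign\<close> sharpens the support from the unspecified \<open>[-K, K]\<close> to
  \<open>[m, M]\<close>.\<close>

theorem (in ell2_operator) spectral_measure_moments:
  assumes E: "is_spectral_measure S T E"
    and bounds: "\<And>v. v \<in> ell2 S \<Longrightarrow> m * Re (ell2_inner S v v) \<le> Re (ell2_inner S (T v) v)"
      "\<And>v. v \<in> ell2 S \<Longrightarrow> Re (ell2_inner S (T v) v) \<le> M * Re (ell2_inner S v v)"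
    and v: "v \<in> ell2 S"
  shows "finite_measure (pvm_measure S E v)" "sets (pvm_measure S E v) = sets borel"
    "AE x in pvm_measure S E v. m \<le> x \<and> x \<le> M"
    "\<And>B. B \<in> sets borel \<Longrightarrow> measure (pvm_measure S E v) B = Re (ell2_inner S (E B v) v)"
    "(\<integral>x. x ^ n \<partial>pvm_measure S E v) = Re (ell2_inner S ((T ^^ n) v) v)"
proof -
  let ?T = "l2_lift S T"
  define F where "F B = l2_lift S (E B)" for B
  have op: "ell2_operator S (E B)" if "B \<in> sets borel" for B
    using E that unfolding is_spectral_measure_def projection_valued_measure_def orth_projection_def
    by unfold_locales auto
  have mult: "E (A \<inter> B) v = E A (E B v)" if "A \<in> sets borel" "B \<in> sets borel" "v \<in> ell2 S" for A B v
    using E that unfolding is_spectral_measure_def projection_valued_measure_def by blast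
  have UNIV: "E UNIV v = v" if "v \<in> ell2 S" for v
    using E that unfolding is_spectral_measure_def projection_valued_measure_def by blast
  \<comment> \<open>The total projection of the lifted measure is the identity on
    \<open>ell2 S\<close> only.\<close>
  have FU: "F UNIV v = l2_restrict S v" for v
    by (simp add: F_def l2_lift_def UNIV l2_fun_inverse)
  obtain K where K: "\<And>v. v \<in> ell2 S \<Longrightarrow> E {-K..K} v = v"
    using E unfolding is_spectral_measure_def by blast
  have F_inner: "inner (F B v) v = Re (ell2_inner S (E B (l2_fun (l2_restrict S v))) (l2_fun (l2_restrict S v)))"
    if "B \<in> sets borel" for B v
    using ell2_operator.inner_lift[OF op[OF that], of v v] unfolding F_def by (metis complex.sel(1))
  interpret pvm: real_pvm F "-K" K
  proof
    show "inner (F B v) w = inner v (F B w)" if "B \<in> sets borel" for B v w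
      unfolding F_def by (rule ell2_operator.inner_lift_both(1)[OF op[OF that]])
    show "F A (F B v) = F (A \<inter> B) v" if "A \<in> sets borel" "B \<in> sets borel" for A B v
    proof -
      have "F A (F B v) = Abs_l2 (E A (l2_fun (l2_lift S (E B) v)))"
        unfolding F_def l2_lift_def[of S "E A"]
        using ell2_operator.lift_in_ell2[OF op[OF that(2)]] by (simp add: restrict_ell2)
      then show ?thesis
        unfolding ell2_operator.l2_fun_lift[OF op[OF that(2)]] by (simp add: F_def l2_lift_def mult that)
    qed
    show "F {-K..K} v = F UNIV v" for v
      unfolding F_def l2_lift_def by (simp add: K UNIV)
    show "(\<lambda>n. inner (F (B n) v) v) sums inner (F (\<Union>n. B n) v) v"
      if B: "range B \<subseteq> sets borel" "disjoint_family B" for B :: "nat \<Rightarrow> real set" and v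
    proof -
      have "\<forall>v\<in>ell2 S. \<forall>w\<in>ell2 S. (\<lambda>n. ell2_inner S (E (B n) v) w) sums ell2_inner S (E (\<Union>n. B n) v) w"
        using E B unfolding is_spectral_measure_def projection_valued_measure_def by blast
      then have "(\<lambda>n. Re (ell2_inner S (E (B n) (l2_fun (l2_restrict S v))) (l2_fun (l2_restrict S v)))) sums
          Re (ell2_inner S (E (\<Union>n. B n) (l2_fun (l2_restrict S v))) (l2_fun (l2_restrict S v)))"
        by (intro sums_Re) simp
      moreover have "B n \<in> sets borel" "(\<Union>n. B n) \<in> sets borel" for n using B by auto
      ultimately show ?thesis by (simp add: F_inner)
    qed
  qed
  have meas: "pvm.meas v = pvm_measure S E (l2_fun (l2_restrict S v))" for v
    unfolding pvm.meas_def pvm_measure_def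
  proof (rule measure_of_eq)
    fix B :: "real set" assume "B \<in> sigma_sets UNIV (sets borel)"
    then have "B \<in> sets borel" using sets.sigma_sets_eq[of "borel :: real measure"] by simp
    then show "ennreal (inner (F B v) v) =
        ennreal (Re (ell2_inner S (E B (l2_fun (l2_restrict S v))) (l2_fun (l2_restrict S v))))"
      by (simp add: F_inner)
  qed simp
  have T: "inner (?T v) v = (\<integral>x. x \<partial>pvm.meas v)" for v
  proof -
    let ?w = "l2_fun (l2_restrict S v)"
    have "inner (?T v) v = Re (ell2_inner S (T ?w) ?w)"
      using inner_lift[of v v] by (metis complex.sel(1))
    also have "ell2_inner S (T ?w) ?w = complex_of_real (LINT t|pvm_measure S E ?w. t)"
      using E unfolding is_spectral_measure_def by simp
    finally show ?thesis by (simp add: meas)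
  qed
  have mv: "pvm_measure S E v = pvm.meas (Abs_l2 v)"
    using v by (simp add: meas l2_fun_Abs_ell2 restrict_ell2)
  show "finite_measure (pvm_measure S E v)" "sets (pvm_measure S E v) = sets borel"
    unfolding mv by (rule pvm.finite_measure_meas, rule pvm.sets_meas)
  show "measure (pvm_measure S E v) B = Re (ell2_inner S (E B v) v)" if "B \<in> sets borel" for B
    unfolding mv using v by (simp add: pvm.measure_meas that F_inner l2_fun_Abs_ell2 restrict_ell2)
  have Tv: "inner (?T u) u = Re (ell2_inner S (T (l2_fun u)) (l2_fun u))"
    "inner u u = Re (ell2_inner S (l2_fun u) (l2_fun u))" "l2_fun u \<in> ell2 S" if "F UNIV u = u" for u
  proof -
    show u: "l2_fun u \<in> ell2 S" using that FU by (metis restrict_in_ell2)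
    then show "inner (?T u) u = Re (ell2_inner S (T (l2_fun u)) (l2_fun u))"
      using inner_lift_Abs[OF u u] by (simp add: l2_fun_inverse)
    show "inner u u = Re (ell2_inner S (l2_fun u) (l2_fun u))" using u by (simp add: ell2_inner_l2')
  qed
  have "AE x in pvm.meas (Abs_l2 v). 0 \<le> 1 * (x - m)"
    using bounds(1) by (intro pvm.AE_sign[OF T]) (simp add: Tv)
  moreover have "AE x in pvm.meas (Abs_l2 v). 0 \<le> - 1 * (x - M)"
    using bounds(2) by (intro pvm.AE_sign[OF T]) (simp add: Tv)
  ultimately show "AE x in pvm_measure S E v. m \<le> x \<and> x \<le> M" unfolding mv by eventually_elim simp
  have "(\<integral>x. x ^ n \<partial>pvm.meas (Abs_l2 v)) = inner ((?T ^^ n) (F UNIV (Abs_l2 v))) (Abs_l2 v)"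
  proof (rule pvm.moments[OF linear_lift inner_lift_both(1) T])
    show "F UNIV (?T v) = ?T (F UNIV v)" for v
      by (simp add: FU restrict_ell2) (simp add: l2_lift_def restrict_ell2)
  qed
  also have "F UNIV (Abs_l2 v) = Abs_l2 v" using v by (simp add: FU restrict_ell2 l2_fun_Abs_ell2)
  also have "inner ((?T ^^ n) (Abs_l2 v)) (Abs_l2 v) = Re (ell2_inner S ((T ^^ n) v) v)"
    unfolding lift_funpow[OF v] using ell2_inner_Abs[OF funpow_closed[OF v] v] by simp
  finally show "(\<integral>x. x ^ n \<partial>pvm_measure S E v) = Re (ell2_inner S ((T ^^ n) v) v)" unfolding mv .
qed

section \<open>Matrices over group rings\<close>

text \<open>Pairing with a function on the group. Product, star and push-forward become
  substitutions in that function, so identities between group ring elements are proved by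
  pairing.\<close>

definition gr_sum :: "('g \<Rightarrow>\<^sub>0 int) \<Rightarrow> ('g \<Rightarrow> complex) \<Rightarrow> complex" where
  "gr_sum a f = (\<Sum>x\<in>Poly_Mapping.keys a. of_int (Poly_Mapping.lookup a x) * f x)"

definition gr_push :: "('k \<Rightarrow> 'g) \<Rightarrow> ('k \<Rightarrow>\<^sub>0 int) \<Rightarrow> ('g \<Rightarrow>\<^sub>0 int)" where
  "gr_push h a = (\<Sum>x\<in>Poly_Mapping.keys a. Poly_Mapping.single (h x) (Poly_Mapping.lookup a x))"

definition gr_norm :: "('g \<Rightarrow>\<^sub>0 int) \<Rightarrow> real" where
  "gr_norm a = (\<Sum>x\<in>Poly_Mapping.keys a. \<bar>of_int (Poly_Mapping.lookup a x)\<bar>)"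

lemma gr_sum_superset:
  assumes "finite F" "Poly_Mapping.keys a \<subseteq> F"
  shows "gr_sum a f = (\<Sum>x\<in>F. of_int (Poly_Mapping.lookup a x) * f x)"
  unfolding gr_sum_def using assms by (intro sum.mono_neutral_left) (auto simp: in_keys_iff)

lemma gr_sum_0 [simp]: "gr_sum 0 f = 0"
  by (simp add: gr_sum_def)

lemma gr_sum_add: "gr_sum (a + b) f = gr_sum a f + gr_sum b f"
proof -
  let ?F = "Poly_Mapping.keys a \<union> Poly_Mapping.keys b"
  have "Poly_Mapping.keys (a + b) \<subseteq> ?F" by (rule keys_add)
  then show ?thesis
    by (simp add: gr_sum_superset[of ?F] lookup_add ring_distribs sum.distrib)
qed

lemma gr_sum_sum: "gr_sum (\<Sum>i\<in>I. a i) f = (\<Sum>i\<in>I. gr_sum (a i) f)"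
  by (induction I rule: infinite_finite_induct) (auto simp: gr_sum_add)

lemma gr_sum_single [simp]: "gr_sum (Poly_Mapping.single x c) f = of_int c * f x"
  by (cases "c = 0") (auto simp: gr_sum_def)

lemma gr_sum_sum_right: "gr_sum a (\<lambda>x. \<Sum>i\<in>I. f i x) = (\<Sum>i\<in>I. gr_sum a (f i))"
  unfolding gr_sum_def sum_distrib_left by (rule sum.swap)

lemma gr_sum_cong:
  "(\<And>x. x \<in> Poly_Mapping.keys a \<Longrightarrow> f x = g x) \<Longrightarrow> gr_sum a f = gr_sum a g"
  by (auto simp: gr_sum_def)

lemma gr_sum_delta: "gr_sum a (\<lambda>x. if x = z then 1 else 0) = of_int (Poly_Mapping.lookup a z)"
proof -
  have "gr_sum a (\<lambda>x. if x = z then 1 else 0) =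
      (\<Sum>x\<in>insert z (Poly_Mapping.keys a). of_int (Poly_Mapping.lookup a x) * (if x = z then 1 else 0))"
    by (rule gr_sum_superset) auto
  then show ?thesis by (simp add: if_distrib[where f = "\<lambda>y. _ * y"] cong: if_cong)
qed

text \<open>Functions concentrated at one point recover the coefficients.\<close>

lemma gr_eqI: "(\<And>f. gr_sum a f = gr_sum b f) \<Longrightarrow> a = b"
  by (rule poly_mapping_eqI) (metis gr_sum_delta of_int_eq_iff)

lemma gr_sum_mult:
  "gr_sum (gr_mult G a b) f = gr_sum a (\<lambda>x. gr_sum b (\<lambda>y. f (x \<otimes>\<^bsub>G\<^esub> y)))"
  unfolding gr_mult_def gr_sum_sum gr_sum_single
  by (simp add: gr_sum_def sum_distrib_left mult.assoc)

lemma gr_sum_star: "gr_sum (gr_star G a) f = gr_sum a (\<lambda>x. f (inv\<^bsub>G\<^esub> x))"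
  unfolding gr_star_def gr_sum_sum gr_sum_single by (simp add: gr_sum_def)

lemma gr_sum_push: "gr_sum (gr_push h a) f = gr_sum a (\<lambda>x. f (h x))"
  unfolding gr_push_def gr_sum_sum gr_sum_single by (simp add: gr_sum_def)

lemma gr_sum_one: "gr_sum (gr_one G) f = f \<one>\<^bsub>G\<^esub>"
  by (simp add: gr_one_def)

lemma gr_push_0 [simp]: "gr_push h 0 = 0"
  by (simp add: gr_push_def)

lemma gr_push_sum: "gr_push h (\<Sum>i\<in>I. a i) = (\<Sum>i\<in>I. gr_push h (a i))"
  by (rule gr_eqI) (simp add: gr_sum_push gr_sum_sum)

lemma gr_push_push: "gr_push h (gr_push f a) = gr_push (\<lambda>x. h (f x)) a"
  by (rule gr_eqI) (simp add: gr_sum_push)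

lemma gr_push_cong:
  "(\<And>x. x \<in> Poly_Mapping.keys a \<Longrightarrow> h x = h' x) \<Longrightarrow> gr_push h a = gr_push h' a"
  by (rule gr_eqI) (auto simp: gr_sum_push intro!: gr_sum_cong)

lemma gr_push_id: "gr_push (\<lambda>x. x) a = a"
  by (rule gr_eqI) (simp add: gr_sum_push)

lemma lookup_gr_push:
  "Poly_Mapping.lookup (gr_push h a) z = (\<Sum>x\<in>{x \<in> Poly_Mapping.keys a. h x = z}. Poly_Mapping.lookup a x)"
  unfolding gr_push_def lookup_sum lookup_single
  by (simp add: when_def sum.If_cases Int_def)

lemma keys_gr_push: "Poly_Mapping.keys (gr_push h a) \<subseteq> h ` Poly_Mapping.keys a"
proof
  fix z assume "z \<in> Poly_Mapping.keys (gr_push h a)"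
  then have "{x \<in> Poly_Mapping.keys a. h x = z} \<noteq> {}"
    unfolding in_keys_iff lookup_gr_push by (metis sum.empty)
  then show "z \<in> h ` Poly_Mapping.keys a" by auto
qed

text \<open>A coefficient of a push-forward is a sum over a fibre within the support, and
  \<open>h\<close> and \<open>f\<close> have the same fibres there.\<close>

lemma gr_push_eq_transfer:
  assumes "\<And>x y. x \<in> Poly_Mapping.keys a \<union> Poly_Mapping.keys b \<Longrightarrow>
      y \<in> Poly_Mapping.keys a \<union> Poly_Mapping.keys b \<Longrightarrow> h x = h y \<longleftrightarrow> f x = f y"
    and eq: "gr_push f a = gr_push f b"
  shows "gr_push h a = gr_push h b"
proof (rule poly_mapping_eqI)
  fix z
  show "Poly_Mapping.lookup (gr_push h a) z = Poly_Mapping.lookup (gr_push h b) z"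
  proof (cases "z \<in> h ` (Poly_Mapping.keys a \<union> Poly_Mapping.keys b)")
    case True
    then obtain y where y: "y \<in> Poly_Mapping.keys a \<union> Poly_Mapping.keys b" "z = h y" by auto
    have "{x \<in> Poly_Mapping.keys c. h x = z} = {x \<in> Poly_Mapping.keys c. f x = f y}" if "c = a \<or> c = b" for c
      using that y assms(1) by auto
    then have "Poly_Mapping.lookup (gr_push h c) z = Poly_Mapping.lookup (gr_push f c) (f y)" if "c = a \<or> c = b" for c
      using that by (simp add: lookup_gr_push)
    then show ?thesis using eq by metis
  next
    case False
    then have "z \<notin> Poly_Mapping.keys (gr_push h a)" "z \<notin> Poly_Mapping.keys (gr_push h b)"
      using keys_gr_push[of h] by blast+
    then show ?thesis by (simp add: in_keys_iff)
  qed
qed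

lemma gr_norm_superset:
  assumes "finite F" "Poly_Mapping.keys a \<subseteq> F"
  shows "gr_norm a = (\<Sum>x\<in>F. \<bar>of_int (Poly_Mapping.lookup a x)\<bar>)"
  unfolding gr_norm_def using assms by (intro sum.mono_neutral_left) (auto simp: in_keys_iff)

lemma gr_norm_nonneg: "0 \<le> gr_norm a"
  by (simp add: gr_norm_def sum_nonneg)

lemma gr_norm_add: "gr_norm (a + b) \<le> gr_norm a + gr_norm b"
proof -
  let ?F = "Poly_Mapping.keys a \<union> Poly_Mapping.keys b"
  have "Poly_Mapping.keys (a + b) \<subseteq> ?F" by (rule keys_add)
  then have "gr_norm (a + b) = (\<Sum>x\<in>?F. \<bar>of_int (Poly_Mapping.lookup a x) + of_int (Poly_Mapping.lookup b x)\<bar>)"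
    by (simp add: gr_norm_superset[of ?F] lookup_add)
  also have "\<dots> \<le> (\<Sum>x\<in>?F. \<bar>of_int (Poly_Mapping.lookup a x)\<bar> + \<bar>of_int (Poly_Mapping.lookup b x)\<bar>)"
    by (intro sum_mono abs_triangle_ineq)
  also have "\<dots> = gr_norm a + gr_norm b"
    by (simp add: gr_norm_superset[of ?F] sum.distrib)
  finally show ?thesis .
qed

lemma gr_norm_sum: "gr_norm (\<Sum>i\<in>I. a i) \<le> (\<Sum>i\<in>I. gr_norm (a i))"
proof (induction I rule: infinite_finite_induct)
  case (insert i I)
  then show ?case using gr_norm_add[of "a i" "\<Sum>i\<in>I. a i"] by simp
qed (simp_all add: gr_norm_def)

lemma gr_norm_single [simp]: "gr_norm (Poly_Mapping.single x c) = \<bar>of_int c\<bar>"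
  by (cases "c = 0") (auto simp: gr_norm_def)

lemma gr_norm_push: "gr_norm (gr_push h a) \<le> gr_norm a"
proof -
  have "gr_norm (gr_push h a) \<le> (\<Sum>x\<in>Poly_Mapping.keys a. gr_norm (Poly_Mapping.single (h x) (Poly_Mapping.lookup a x)))"
    unfolding gr_push_def by (rule gr_norm_sum)
  then show ?thesis by (simp add: gr_norm_def[of a])
qed

lemma group_ring_sum:
  "(\<And>i. i \<in> I \<Longrightarrow> f i \<in> group_ring G) \<Longrightarrow> (\<Sum>i\<in>I. f i) \<in> group_ring G"
  using keys_sum[of f I] by (fastforce simp: group_ring_def)

lemma (in group) gr_mult_closed:
  assumes "a \<in> group_ring G" "b \<in> group_ring G"
  shows "gr_mult G a b \<in> group_ring G"
  unfolding gr_mult_def using assms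
  by (intro group_ring_sum) (auto simp: group_ring_def split: if_splits)

lemma gr_matrices_carrier:
  "A \<in> gr_matrices G d \<Longrightarrow> i < d \<Longrightarrow> j < d \<Longrightarrow> x \<in> Poly_Mapping.keys (A i j) \<Longrightarrow> x \<in> carrier G"
  by (auto simp: gr_matrices_def group_ring_def)

lemma (in group) gr_star_closed:
  assumes "a \<in> group_ring G"
  shows "gr_star G a \<in> group_ring G"
  unfolding gr_star_def using assms
  by (intro group_ring_sum) (auto simp: group_ring_def split: if_splits)

lemma (in group) gr_one_closed: "gr_one G \<in> group_ring G"
  by (simp add: group_ring_def gr_one_def)

lemma gr_push_mult:
  assumes "h \<in> hom G H" "a \<in> group_ring G" "b \<in> group_ring G"
  shows "gr_push h (gr_mult G a b) = gr_mult H (gr_push h a) (gr_push h b)"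
  by (rule gr_eqI)
    (use assms in \<open>auto simp: gr_sum_push gr_sum_mult hom_mult group_ring_def subset_iff intro!: gr_sum_cong\<close>)

lemma gr_push_star:
  assumes "h \<in> hom G H" "group G" "group H" "a \<in> group_ring G"
  shows "gr_push h (gr_star G a) = gr_star H (gr_push h a)"
proof -
  interpret group_hom G H h using assms(1-3) by (simp add: group_hom_def group_hom_axioms_def)
  show ?thesis
    by (rule gr_eqI)
      (use assms(4) in \<open>auto simp: gr_sum_push gr_sum_star group_ring_def subset_iff intro!: gr_sum_cong\<close>)
qed

lemma gr_push_one:
  assumes "h \<in> hom G H" "group G" "group H"
  shows "gr_push h (gr_one G) = gr_one H"
  using hom_one[OF assms] by (intro gr_eqI) (simp add: gr_sum_push gr_sum_one)

lemma gr_push_closed: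
  assumes "h \<in> hom G H" "a \<in> group_ring G"
  shows "gr_push h a \<in> group_ring H"
  using keys_gr_push[of h a] assms by (auto simp: group_ring_def hom_def)

section \<open>Matrices as operators, and columns of their powers\<close>

lemma mat_op_gr_sum:
  "mat_op G d A v (i, g) = (if i < d \<and> g \<in> carrier G then
     \<Sum>j<d. gr_sum (A i j) (\<lambda>x. v (j, inv\<^bsub>G\<^esub> x \<otimes>\<^bsub>G\<^esub> g)) else 0)"
  by (simp add: mat_op_def gr_sum_def)

lemma mat_op_cong:
  "(\<And>i j. i < d \<Longrightarrow> j < d \<Longrightarrow> A i j = B i j) \<Longrightarrow> mat_op G d A = mat_op G d B"
  by (auto simp: mat_op_gr_sum fun_eq_iff)

lemma (in group) mat_mult_closed:
  "A \<in> gr_matrices G d \<Longrightarrow> B \<in> gr_matrices G d \<Longrightarrow> mat_mult G d A B \<in> gr_matrices G d"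
  by (auto simp: gr_matrices_def mat_mult_def intro!: group_ring_sum gr_mult_closed)

lemma (in group) mat_star_closed:
  "A \<in> gr_matrices G d \<Longrightarrow> mat_star G A \<in> gr_matrices G d"
  by (auto simp: gr_matrices_def mat_star_def intro!: gr_star_closed)

lemma (in group) mat_op_mult:
  assumes "A \<in> gr_matrices G d" "B \<in> gr_matrices G d"
  shows "mat_op G d (mat_mult G d A B) v = mat_op G d A (mat_op G d B v)"
proof (rule ext, clarify)
  fix i g
  show "mat_op G d (mat_mult G d A B) v (i, g) = mat_op G d A (mat_op G d B v) (i, g)"
  proof (cases "i < d \<and> g \<in> carrier G")
    case True
    have "(\<Sum>j<d. gr_sum (mat_mult G d A B i j) (\<lambda>x. v (j, inv x \<otimes> g)))
      = (\<Sum>j<d. \<Sum>k<d. gr_sum (A i k) (\<lambda>x. gr_sum (B k j) (\<lambda>y. v (j, inv (x \<otimes> y) \<otimes> g))))"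
      unfolding mat_mult_def gr_sum_sum gr_sum_mult ..
    also have "\<dots> = (\<Sum>k<d. \<Sum>j<d. gr_sum (A i k) (\<lambda>x. gr_sum (B k j) (\<lambda>y. v (j, inv (x \<otimes> y) \<otimes> g))))"
      by (rule sum.swap)
    also have "\<dots> = (\<Sum>k<d. gr_sum (A i k) (\<lambda>x. mat_op G d B v (k, inv x \<otimes> g)))"
    proof (rule sum.cong[OF refl])
      fix k assume k: "k \<in> {..<d}"
      show "(\<Sum>j<d. gr_sum (A i k) (\<lambda>x. gr_sum (B k j) (\<lambda>y. v (j, inv (x \<otimes> y) \<otimes> g)))) =
        gr_sum (A i k) (\<lambda>x. mat_op G d B v (k, inv x \<otimes> g))"
        unfolding gr_sum_sum_right[symmetric]
      proof (rule gr_sum_cong)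
        fix x assume "x \<in> Poly_Mapping.keys (A i k)"
        then have x: "x \<in> carrier G" using assms True k by (auto simp: gr_matrices_def group_ring_def)
        have "gr_sum (B k j) (\<lambda>y. v (j, inv (x \<otimes> y) \<otimes> g)) = gr_sum (B k j) (\<lambda>y. v (j, inv y \<otimes> (inv x \<otimes> g)))"
          if "j < d" for j
        proof (rule gr_sum_cong)
          fix y assume "y \<in> Poly_Mapping.keys (B k j)"
          then have "y \<in> carrier G" using gr_matrices_carrier[OF assms(2)] that k by auto
          then show "v (j, inv (x \<otimes> y) \<otimes> g) = v (j, inv y \<otimes> (inv x \<otimes> g))"
            using x True by (simp add: inv_mult_group m_assoc)
        qed
        then show "(\<Sum>j<d. gr_sum (B k j) (\<lambda>y. v (j, inv (x \<otimes> y) \<otimes> g))) = mat_op G d B v (k, inv x \<otimes> g)"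
          using x k True by (simp add: mat_op_gr_sum)
      qed
    qed
    finally show ?thesis using True by (simp add: mat_op_gr_sum)
  next
    case False
    then show ?thesis by (simp only: mat_op_gr_sum if_False)
  qed
qed

lemma (in group) mat_op_one:
  assumes "mat_is_one G d A" "\<And>p. p \<notin> ell2_index G d \<Longrightarrow> v p = 0"
  shows "mat_op G d A v = v"
proof (rule ext, clarify)
  fix i g
  show "mat_op G d A v (i, g) = v (i, g)"
  proof (cases "i < d \<and> g \<in> carrier G")
    case True
    have "mat_op G d A v (i, g) = (\<Sum>j<d. gr_sum (A i j) (\<lambda>x. v (j, inv x \<otimes> g)))"
      using True by (simp add: mat_op_gr_sum)
    also have "\<dots> = (\<Sum>j<d. if j = i then v (i, g) else 0)"
      using assms(1) True by (intro sum.cong) (auto simp: mat_is_one_def gr_sum_one)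
    finally show ?thesis using True by simp
  next
    case False
    then show ?thesis using assms(2)[of "(i, g)"] by (auto simp: mat_op_gr_sum ell2_index_def)
  qed
qed

text \<open>Column \<open>i\<close> of the \<open>n\<close>-th power of \<open>A\<close>. The
  coefficient of its entry \<open>i\<close> at the unit is the \<open>i\<close>-th summand of the
  trace of that power.\<close>

definition gr_column :: "('g, 'm) monoid_scheme \<Rightarrow> nat \<Rightarrow> 'g gr_matrix \<Rightarrow> nat \<Rightarrow> nat \<Rightarrow> nat \<Rightarrow> ('g \<Rightarrow>\<^sub>0 int)" where
  "gr_column G d A i n = ((\<lambda>c k. \<Sum>j<d. gr_mult G (A k j) (c j)) ^^ n) (\<lambda>k. if k = i then gr_one G else 0)"

lemma gr_column_Suc: "gr_column G d A i (Suc n) k = (\<Sum>j<d. gr_mult G (A k j) (gr_column G d A i n j))"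
  by (simp add: gr_column_def)

lemma gr_column_0: "gr_column G d A i 0 k = (if k = i then gr_one G else 0)"
  by (simp add: gr_column_def)

lemma (in group) gr_column_closed:
  assumes "A \<in> gr_matrices G d"
  shows "k < d \<Longrightarrow> gr_column G d A i n k \<in> group_ring G"
proof (induction n arbitrary: k)
  case 0
  then show ?case by (simp add: gr_column_0 gr_one_closed) (simp add: group_ring_def)
next
  case (Suc n)
  then show ?case using assms
    by (auto simp: gr_column_Suc gr_matrices_def intro!: group_ring_sum gr_mult_closed)
qed

text \<open>The link between analysis and algebra: moments at unit vectors become coefficients
  computed in the group ring, where homomorphisms can be applied.\<close>

lemma (in group) mat_op_funpow_unit_vec:
  assumes A: "A \<in> gr_matrices G d" and i: "i < d"
  shows "(mat_op G d A ^^ n) (unit_vec G i) =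
    (\<lambda>(k, g). if k < d \<and> g \<in> carrier G then of_int (Poly_Mapping.lookup (gr_column G d A i n k) g) else 0)"
proof (induction n)
  case 0
  show ?case using i
    by (auto simp: fun_eq_iff unit_vec_def gr_column_0 gr_one_def lookup_single when_def)
next
  case (Suc n)
  show ?case
  proof (rule ext, clarify)
    fix k g
    have "gr_sum (A k j) (\<lambda>x. of_int (Poly_Mapping.lookup (gr_column G d A i n j) (inv x \<otimes> g))) =
        of_int (Poly_Mapping.lookup (gr_mult G (A k j) (gr_column G d A i n j)) g)"
      if "k < d" "g \<in> carrier G" "j < d" for j
      unfolding gr_sum_delta[symmetric] gr_sum_mult
    proof (rule gr_sum_cong, rule gr_sum_cong)
      fix x y assume "x \<in> Poly_Mapping.keys (A k j)" "y \<in> Poly_Mapping.keys (gr_column G d A i n j)"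
      then have "x \<in> carrier G" "y \<in> carrier G"
        using A that gr_column_closed[OF A that(3), of i n] by (auto simp: gr_matrices_def group_ring_def)
      \<comment> \<open>Translating the argument by the inverse of \<open>x\<close> is the same as
        asking for the product \<open>x \<otimes> y\<close> to be \<open>g\<close>, which is
        convolution.\<close>
      then show "(if y = inv x \<otimes> g then 1 else 0) = (if x \<otimes> y = g then 1 else 0 :: complex)"
        using that by (metis inv_solve_left')
    qed
    moreover have "inv x \<otimes> g \<in> carrier G"
      if "k < d" "g \<in> carrier G" "j < d" "x \<in> Poly_Mapping.keys (A k j)" for x j
      using gr_matrices_carrier[OF A] that by auto
    ultimately show "(mat_op G d A ^^ Suc n) (unit_vec G i) (k, g) =
       (if k < d \<and> g \<in> carrier G then of_int (Poly_Mapping.lookup (gr_column G d A i (Suc n) k) g) else 0)"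
      by (auto simp: Suc mat_op_gr_sum gr_column_Suc lookup_sum intro!: sum.cong cong: gr_sum_cong)
  qed
qed

section \<open>Change of group\<close>

definition mat_push :: "('k \<Rightarrow> 'g) \<Rightarrow> 'k gr_matrix \<Rightarrow> 'g gr_matrix" where
  "mat_push h A = (\<lambda>i j. gr_push h (A i j))"

lemma mat_push_closed:
  "h \<in> hom G H \<Longrightarrow> A \<in> gr_matrices G d \<Longrightarrow> mat_push h A \<in> gr_matrices H d"
  by (auto simp: gr_matrices_def mat_push_def intro!: gr_push_closed)

lemma mat_push_mult:
  assumes "h \<in> hom G H" "A \<in> gr_matrices G d" "B \<in> gr_matrices G d" "i < d" "j < d"
  shows "mat_push h (mat_mult G d A B) i j = mat_mult H d (mat_push h A) (mat_push h B) i j"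
  using assms by (auto simp: mat_push_def mat_mult_def gr_push_sum gr_matrices_def gr_push_mult intro!: sum.cong)

lemma mat_push_star_mult:
  assumes "h \<in> hom G H" "group G" "group H" "A \<in> gr_matrices G d" "i < d" "j < d"
  shows "mat_push h (mat_mult G d (mat_star G A) A) i j =
    mat_mult H d (mat_star H (mat_push h A)) (mat_push h A) i j"
proof -
  have "mat_push h (mat_mult G d (mat_star G A) A) i j = mat_mult H d (mat_push h (mat_star G A)) (mat_push h A) i j"
    using assms by (intro mat_push_mult group.mat_star_closed)
  also have "\<dots> = mat_mult H d (mat_star H (mat_push h A)) (mat_push h A) i j"
    using assms unfolding mat_mult_def
    by (intro sum.cong) (auto simp: mat_push_def mat_star_def gr_push_star gr_matrices_def)
  finally show ?thesis .
qed

text \<open>Agreement of \<open>B\<close> with the pushed matrix is asked below \<open>d\<close>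
  only, which is what \<open>mat_push_star_mult\<close> provides.\<close>

lemma gr_column_push:
  assumes h: "h \<in> hom G H" and "group G" "group H" and A: "A \<in> gr_matrices G d"
    and B: "\<And>i j. i < d \<Longrightarrow> j < d \<Longrightarrow> B i j = mat_push h A i j"
  shows "k < d \<Longrightarrow> gr_column H d B i n k = gr_push h (gr_column G d A i n k)"
proof (induction n arbitrary: k)
  case 0
  then show ?case using assms by (simp add: gr_column_0 gr_push_one)
next
  case (Suc n)
  have "gr_mult H (B k j) (gr_column H d B i n j) = gr_push h (gr_mult G (A k j) (gr_column G d A i n j))"
    if "j < d" for j
    using Suc that A B group.gr_column_closed[OF assms(2) A that, of i n]
    by (simp add: gr_push_mult[OF h] mat_push_def gr_matrices_def)
  then show ?case by (simp add: gr_column_Suc gr_push_sum)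
qed

section \<open>Determinants of invertible matrices\<close>

lemma ell2_add: "v \<in> ell2 S \<Longrightarrow> w \<in> ell2 S \<Longrightarrow> (\<lambda>x. v x + w x) \<in> ell2 S"
  by (simp add: ell2_iff summable_l2_add)

lemma ell2_scale: "v \<in> ell2 S \<Longrightarrow> (\<lambda>x. c * v x) \<in> ell2 S"
  by (simp add: ell2_iff summable_l2_scale)

lemma ell2_zero: "(\<lambda>x. 0) \<in> ell2 S"
  by (simp add: ell2_iff)

lemma ell2_sum: "(\<And>i. i \<in> I \<Longrightarrow> f i \<in> ell2 S) \<Longrightarrow> (\<lambda>x. \<Sum>i\<in>I. f i x) \<in> ell2 S"
  by (induction I rule: infinite_finite_induct) (auto simp: ell2_zero ell2_add)

lemma ell2_inner_summable:
  assumes "v \<in> ell2 S" "w \<in> ell2 S"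
  shows "(\<lambda>x. v x * cnj (w x)) summable_on S"
  using assms by (intro summable_on_subset_banach[OF summable_l2_product]) (auto simp: ell2_iff)

lemma ell2_inner_scale_left: "ell2_inner S (\<lambda>x. c * v x) w = c * ell2_inner S v w"
  by (simp add: ell2_inner_def mult.assoc infsum_cmult_right')

lemma ell2_inner_sum_left:
  assumes "\<And>i. i \<in> I \<Longrightarrow> f i \<in> ell2 S" "w \<in> ell2 S"
  shows "ell2_inner S (\<lambda>x. \<Sum>i\<in>I. f i x) w = (\<Sum>i\<in>I. ell2_inner S (f i) w)"
  using assms(1)
proof (induction I rule: infinite_finite_induct)
  case (insert i I)
  have "ell2_inner S (\<lambda>x. f i x + (\<Sum>i\<in>I. f i x)) w = ell2_inner S (f i) w + ell2_inner S (\<lambda>x. \<Sum>i\<in>I. f i x) w"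
    using insert ell2_inner_summable[OF _ assms(2)] unfolding ell2_inner_def ring_distribs
    by (intro infsum_add) (auto intro!: ell2_sum)
  then show ?case using insert by simp
qed (simp_all add: ell2_inner_def)

lemma ell2_inner_sum_right:
  assumes "\<And>i. i \<in> I \<Longrightarrow> f i \<in> ell2 S" "w \<in> ell2 S"
  shows "ell2_inner S w (\<lambda>x. \<Sum>i\<in>I. f i x) = (\<Sum>i\<in>I. ell2_inner S w (f i))"
proof -
  have "ell2_inner S w (f i) = cnj (ell2_inner S (f i) w)" for i by (rule ell2_inner_commute)
  then show ?thesis
    using ell2_inner_commute[of S w "\<lambda>x. \<Sum>i\<in>I. f i x"] ell2_inner_sum_left[of I f S w, OF assms] by simp
qed

lemma ell2_inner_scale_right: "ell2_inner S w (\<lambda>x. c * v x) = cnj c * ell2_inner S w v"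
  using ell2_inner_commute[of S w "\<lambda>x. c * v x"] ell2_inner_commute[of S w v]
  by (simp add: ell2_inner_scale_left)

lemma inner_Abs_l2: "v \<in> ell2 S \<Longrightarrow> inner (Abs_l2 v) (Abs_l2 v) = Re (ell2_inner S v v)"
  by (simp add: ell2_inner_Abs)

section \<open>Matrix operators as finite sums of translations\<close>

lemma gr_sum_zero_fun [simp]: "gr_sum a (\<lambda>x. 0) = 0"
  by (simp add: gr_sum_def)

text \<open>A matrix unit times a left translation. Every matrix operator is a finite integer
  combination of these, so bounds and adjoints need to be found only for them.\<close>

definition gr_shift ::
  "('g, 'm) monoid_scheme \<Rightarrow> nat \<Rightarrow> nat \<Rightarrow> 'g \<Rightarrow> (nat \<times> 'g \<Rightarrow> complex) \<Rightarrow> nat \<times> 'g \<Rightarrow> complex" where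
  "gr_shift G i j x v = (\<lambda>(k, g). if k = i \<and> g \<in> carrier G then v (j, inv\<^bsub>G\<^esub> x \<otimes>\<^bsub>G\<^esub> g) else 0)"

definition mat_terms :: "nat \<Rightarrow> 'g gr_matrix \<Rightarrow> ((nat \<times> nat) \<times> 'g) set" where
  "mat_terms d A = (SIGMA q:{..<d} \<times> {..<d}. Poly_Mapping.keys (A (fst q) (snd q)))"

abbreviation mat_coeff :: "'g gr_matrix \<Rightarrow> (nat \<times> nat) \<times> 'g \<Rightarrow> int" where
  "mat_coeff A t \<equiv> Poly_Mapping.lookup (A (fst (fst t)) (snd (fst t))) (snd t)"

definition mat_norm :: "nat \<Rightarrow> 'g gr_matrix \<Rightarrow> real" where
  "mat_norm d A = (\<Sum>i<d. \<Sum>j<d. gr_norm (A i j))"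

lemma sum_mat_terms:
  "(\<Sum>t\<in>mat_terms d A. F (fst (fst t)) (snd (fst t)) (snd t)) =
    (\<Sum>i<d. \<Sum>j<d. \<Sum>x\<in>Poly_Mapping.keys (A i j). F i j x)"
  unfolding mat_terms_def
  by (subst sum.Sigma[symmetric, where B = "\<lambda>q. Poly_Mapping.keys (A (fst q) (snd q))" and g = "\<lambda>q x. F (fst q) (snd q) x", unfolded case_prod_unfold])
     (auto simp: sum.cartesian_product case_prod_unfold)

lemma mat_norm_terms: "mat_norm d A = (\<Sum>t\<in>mat_terms d A. \<bar>of_int (mat_coeff A t)\<bar>)"
  using sum_mat_terms[of "\<lambda>i j x. \<bar>of_int (Poly_Mapping.lookup (A i j) x)\<bar> :: real" d A]
  by (simp add: mat_norm_def gr_norm_def)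

lemma mat_op_terms:
  "mat_op G d A v = (\<lambda>p. \<Sum>t\<in>mat_terms d A. of_int (mat_coeff A t) * gr_shift G (fst (fst t)) (snd (fst t)) (snd t) v p)"
proof (rule ext, clarify)
  fix k g
  have "(\<Sum>t\<in>mat_terms d A. of_int (mat_coeff A t) * gr_shift G (fst (fst t)) (snd (fst t)) (snd t) v (k, g)) =
    (\<Sum>i<d. \<Sum>j<d. gr_sum (A i j) (\<lambda>x. gr_shift G i j x v (k, g)))"
    unfolding gr_sum_def
    using sum_mat_terms[of "\<lambda>i j x. of_int (Poly_Mapping.lookup (A i j) x) * gr_shift G i j x v (k, g)" d A] by simp
  also have "\<dots> = (\<Sum>i<d. if i = k then mat_op G d A v (k, g) else 0)"
    by (intro sum.cong refl) (auto simp: mat_op_gr_sum gr_shift_def gr_sum_def)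
  also have "\<dots> = mat_op G d A v (k, g)"
    by (auto simp: mat_op_gr_sum)
  finally show "mat_op G d A v (k, g) =
    (\<Sum>t\<in>mat_terms d A. of_int (mat_coeff A t) * gr_shift G (fst (fst t)) (snd (fst t)) (snd t) v (k, g))" ..
qed

lemma mat_op_star_terms:
  "mat_op G d (mat_star G A) v = (\<lambda>p. \<Sum>t\<in>mat_terms d A. of_int (mat_coeff A t) *
     gr_shift G (snd (fst t)) (fst (fst t)) (inv\<^bsub>G\<^esub> (snd t)) v p)"
proof (rule ext, clarify)
  fix k g
  have "(\<Sum>t\<in>mat_terms d A. of_int (mat_coeff A t) * gr_shift G (snd (fst t)) (fst (fst t)) (inv\<^bsub>G\<^esub> (snd t)) v (k, g)) =
    (\<Sum>i<d. \<Sum>j<d. gr_sum (A i j) (\<lambda>x. gr_shift G j i (inv\<^bsub>G\<^esub> x) v (k, g)))"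
    unfolding gr_sum_def
    using sum_mat_terms[of "\<lambda>i j x. of_int (Poly_Mapping.lookup (A i j) x) * gr_shift G j i (inv\<^bsub>G\<^esub> x) v (k, g)" d A] by simp
  also have "\<dots> = (\<Sum>i<d. \<Sum>j<d. if j = k then gr_sum (A i k) (\<lambda>x. gr_shift G k i (inv\<^bsub>G\<^esub> x) v (k, g)) else 0)"
    by (intro sum.cong refl) (auto simp: gr_shift_def gr_sum_def)
  also have "\<dots> = mat_op G d (mat_star G A) v (k, g)"
    by (cases "k < d"; cases "g \<in> carrier G")
       (simp_all add: mat_op_gr_sum mat_star_def gr_sum_star gr_shift_def)
  finally show "mat_op G d (mat_star G A) v (k, g) =
    (\<Sum>t\<in>mat_terms d A. of_int (mat_coeff A t) * gr_shift G (snd (fst t)) (fst (fst t)) (inv\<^bsub>G\<^esub> (snd t)) v (k, g))" ..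
qed

context group
begin

text \<open>Row \<open>i\<close> of the shift reads \<open>v\<close> along an injective map of
  indices, so its sum of squares is part of that of \<open>v\<close>.\<close>

lemma gr_shift_norm:
  assumes v: "v \<in> ell2 (ell2_index G d)" and i: "i < d" and x: "x \<in> carrier G"
  shows "gr_shift G i j x v \<in> ell2 (ell2_index G d)"
    and "inner (Abs_l2 (gr_shift G i j x v)) (Abs_l2 (gr_shift G i j x v)) \<le> inner (Abs_l2 v) (Abs_l2 v)"
proof -
  let ?w = "gr_shift G i j x v" and ?h = "\<lambda>p. (j, inv x \<otimes> snd p)"
  let ?N = "\<lambda>v p. (cmod (v p))\<^sup>2"
  have inj: "inj_on ?h ({i} \<times> carrier G)"
    using x by (auto simp: inj_on_def)
  have sv: "?N v summable_on UNIV" using v by (simp add: ell2_iff)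
  then have im: "?N v summable_on ?h ` ({i} \<times> carrier G)"
    by (rule summable_on_subset_banach) simp
  then have "(?N v \<circ> ?h) summable_on ({i} \<times> carrier G)"
    using summable_on_reindex[OF inj] by blast
  also have "?this \<longleftrightarrow> ?N ?w summable_on UNIV"
    by (rule summable_on_cong_neutral) (auto simp: gr_shift_def split: if_splits)
  finally have sw: "?N ?w summable_on UNIV" .
  show "?w \<in> ell2 (ell2_index G d)"
    using sw i by (auto simp: ell2_iff gr_shift_def ell2_index_def)
  have "infsum (?N ?w) UNIV = infsum (?N v \<circ> ?h) ({i} \<times> carrier G)"
    by (rule infsum_cong_neutral) (auto simp: gr_shift_def split: if_splits)
  also have "\<dots> = infsum (?N v) (?h ` ({i} \<times> carrier G))"
    by (rule infsum_reindex[OF inj, symmetric])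
  also have "\<dots> \<le> infsum (?N v) UNIV"
    by (rule infsum_mono2[OF im sv]) auto
  finally show "inner (Abs_l2 ?w) (Abs_l2 ?w) \<le> inner (Abs_l2 v) (Abs_l2 v)"
    by (simp add: inner_l2_self l2_fun_Abs sw sv)
qed

text \<open>Substitution of \<open>x \<otimes> g\<close> for \<open>g\<close> in the sum over one
  row.\<close>

lemma gr_shift_adjoint:
  assumes i: "i < d" and j: "j < d" and x: "x \<in> carrier G"
  shows "ell2_inner (ell2_index G d) (gr_shift G i j x v) w =
    ell2_inner (ell2_index G d) v (gr_shift G j i (inv x) w)"
proof -
  have "ell2_inner (ell2_index G d) (gr_shift G i j x v) w =
      infsum (\<lambda>p. v (j, inv x \<otimes> snd p) * cnj (w p)) ({i} \<times> carrier G)"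
    unfolding ell2_inner_def using i by (intro infsum_cong_neutral) (auto simp: gr_shift_def ell2_index_def split: if_splits)
  also have "\<dots> = infsum (\<lambda>p. v p * cnj (w (i, x \<otimes> snd p))) ({j} \<times> carrier G)"
    by (rule infsum_reindex_bij_witness[of _ "\<lambda>p. (i, x \<otimes> snd p)" "\<lambda>p. (j, inv x \<otimes> snd p)"])
       (use x in \<open>auto simp: m_assoc[symmetric]\<close>)
  also have "\<dots> = ell2_inner (ell2_index G d) v (gr_shift G j i (inv x) w)"
    unfolding ell2_inner_def using x j by (intro infsum_cong_neutral) (auto simp: gr_shift_def ell2_index_def split: if_splits)
  finally show ?thesis .
qed

lemma mat_terms_carrier:
  assumes "A \<in> gr_matrices G d" "t \<in> mat_terms d A"
  shows "fst (fst t) < d" "snd (fst t) < d" "snd t \<in> carrier G"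
  using assms gr_matrices_carrier[OF assms(1)] by (auto simp: mat_terms_def)

lemma mat_op_closed:
  assumes A: "A \<in> gr_matrices G d" and v: "v \<in> ell2 (ell2_index G d)"
  shows "mat_op G d A v \<in> ell2 (ell2_index G d)"
  unfolding mat_op_terms using mat_terms_carrier[OF A] v
  by (intro ell2_sum ell2_scale gr_shift_norm(1)) auto

text \<open>Triangle inequality over \<open>mat_op_terms\<close>, in which every shift is a
  contraction.\<close>

lemma mat_op_bounded:
  assumes A: "A \<in> gr_matrices G d" and v: "v \<in> ell2 (ell2_index G d)"
  shows "norm (Abs_l2 (mat_op G d A v)) \<le> mat_norm d A * norm (Abs_l2 v)"
proof -
  let ?s = "\<lambda>t. gr_shift G (fst (fst t)) (snd (fst t)) (snd t) v"
  have s: "?s t \<in> ell2 (ell2_index G d)" "norm (Abs_l2 (?s t)) \<le> norm (Abs_l2 v)" if "t \<in> mat_terms d A" for t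
    using gr_shift_norm[OF v, of "fst (fst t)" "snd t" "snd (fst t)"] mat_terms_carrier[OF A that]
    by (simp_all add: norm_eq_sqrt_inner)
  have "Abs_l2 (mat_op G d A v) = (\<Sum>t\<in>mat_terms d A. of_int (mat_coeff A t) *\<^sub>R Abs_l2 (?s t))"
  proof (rule l2_eqI)
    fix p
    have "l2_fun (Abs_l2 (mat_op G d A v)) p = mat_op G d A v p"
      using mat_op_closed[OF A v] by (simp add: l2_fun_Abs_ell2)
    also have "\<dots> = (\<Sum>t\<in>mat_terms d A. of_int (mat_coeff A t) * ?s t p)"
      by (simp add: mat_op_terms)
    also have "\<dots> = l2_fun (\<Sum>t\<in>mat_terms d A. of_int (mat_coeff A t) *\<^sub>R Abs_l2 (?s t)) p"
      by (auto intro!: sum.cong simp: l2_fun_Abs_ell2[OF s(1)])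
    finally show "l2_fun (Abs_l2 (mat_op G d A v)) p = \<dots>" .
  qed
  then have "norm (Abs_l2 (mat_op G d A v)) \<le> (\<Sum>t\<in>mat_terms d A. norm (of_int (mat_coeff A t) *\<^sub>R Abs_l2 (?s t)))"
    by (simp only: norm_sum)
  also have "\<dots> \<le> (\<Sum>t\<in>mat_terms d A. \<bar>of_int (mat_coeff A t)\<bar> * norm (Abs_l2 v))"
    using s(2) by (intro sum_mono) (auto intro!: mult_left_mono)
  finally show ?thesis by (simp add: mat_norm_terms sum_distrib_right)
qed

lemma mat_op_adjoint:
  assumes A: "A \<in> gr_matrices G d" and v: "v \<in> ell2 (ell2_index G d)" and w: "w \<in> ell2 (ell2_index G d)"
  shows "ell2_inner (ell2_index G d) (mat_op G d A v) w = ell2_inner (ell2_index G d) v (mat_op G d (mat_star G A) w)"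
proof -
  let ?I = "ell2_inner (ell2_index G d)"
  note t = mat_terms_carrier[OF A]
  have "?I (mat_op G d A v) w = (\<Sum>t\<in>mat_terms d A. of_int (mat_coeff A t) * ?I (gr_shift G (fst (fst t)) (snd (fst t)) (snd t) v) w)"
    unfolding mat_op_terms
    by (subst ell2_inner_sum_left) (auto simp: ell2_inner_scale_left intro!: ell2_scale gr_shift_norm(1) v w t)
  also have "\<dots> = (\<Sum>t\<in>mat_terms d A. of_int (mat_coeff A t) * ?I v (gr_shift G (snd (fst t)) (fst (fst t)) (inv (snd t)) w))"
    using t by (intro sum.cong refl) (simp add: gr_shift_adjoint)
  also have "\<dots> = ?I v (mat_op G d (mat_star G A) w)"
    unfolding mat_op_star_terms
    by (subst ell2_inner_sum_right) (auto simp: ell2_inner_scale_right intro!: ell2_scale gr_shift_norm(1) v w t inv_closed)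
  finally show ?thesis .
qed

lemma unit_vec_in_ell2:
  assumes "i < d"
  shows "unit_vec G i \<in> ell2 (ell2_index G d)"
proof -
  have "finite {p. (cmod (unit_vec G i p))\<^sup>2 \<noteq> 0}"
    by (rule finite_subset[of _ "{(i, \<one>)}"]) (auto simp: unit_vec_def split: if_splits)
  then have "(\<lambda>p. (cmod (unit_vec G i p))\<^sup>2) summable_on UNIV"
    by (rule summable_on_finite_support)
  moreover have "unit_vec G i p = 0" if "p \<notin> ell2_index G d" for p
    using that assms by (auto simp: unit_vec_def ell2_index_def)
  ultimately show ?thesis by (simp add: ell2_iff)
qed

lemma ell2_inner_unit_vec:
  assumes "i < d"
  shows "ell2_inner (ell2_index G d) v (unit_vec G i) = v (i, \<one>)"
proof -
  have "ell2_inner (ell2_index G d) v (unit_vec G i) = infsum (\<lambda>p. v p) {(i, \<one>)}"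
    unfolding ell2_inner_def using assms
    by (intro infsum_cong_neutral) (auto simp: unit_vec_def ell2_index_def)
  then show ?thesis by simp
qed

end

text \<open>The integral in \<open>ln_det\<close> is taken against the Stieltjes measure of
  \<open>F\<close>, whereas the moments belong to the \<open>\<mu> i\<close>. Both sides are
  functionals on one interval away from 0 and agree on half-lines, hence on
  \<open>ln\<close>.\<close>

lemma interval_measure_sum_ln:
  fixes \<mu> :: "nat \<Rightarrow> real measure"
  assumes fin: "\<And>i. i < d \<Longrightarrow> finite_measure (\<mu> i)" and sets: "\<And>i. i < d \<Longrightarrow> sets (\<mu> i) = sets borel"
    and AE: "\<And>i. i < d \<Longrightarrow> AE x in \<mu> i. m \<le> x \<and> x \<le> M" and m: "0 < m"
    and F: "\<And>l. F l = (\<Sum>i<d. measure (\<mu> i) {0..l})"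
  shows "set_integrable (interval_measure F) {0<..} ln"
    and "(LINT l:{0<..}|interval_measure F. ln l) = (\<Sum>i<d. \<integral>x. ln x \<partial>\<mu> i)"
proof -
  have fb: "finite_borel_measure (\<mu> i)" if "i < d" for i
    using fin[OF that] sets[OF that] by (simp add: finite_borel_measure_def finite_borel_measure_axioms_def)
  \<comment> \<open>No mass lies below \<open>m > 0\<close>, so closed intervals from 0 may be
    replaced by half-lines, and \<open>F\<close> is a sum of distribution functions.\<close>
  have Fc: "F l = (\<Sum>i<d. cdf (\<mu> i) l)" for l
    unfolding F cdf_def
  proof (rule sum.cong[OF refl])
    fix i assume i: "i \<in> {..<d}"
    show "measure (\<mu> i) {0..l} = measure (\<mu> i) {..l}"
    proof (rule measure_eq_AE)
      show "AE x in \<mu> i. x \<in> {0..l} \<longleftrightarrow> x \<in> {..l}"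
        using AE[of i] i m by (auto elim!: eventually_mono)
    qed (use sets i in auto)
  qed
  let ?\<nu> = "interval_measure F"
  have F_mono: "F x \<le> F y" if "x \<le> y" for x y
    unfolding Fc using that by (intro sum_mono finite_borel_measure.cdf_nondecreasing fb) auto
  have F_cont: "continuous (at_right a) F" for a
    unfolding Fc by (intro continuous_sum finite_borel_measure.cdf_is_right_cont fb) auto
  have F_bot: "(F \<longlongrightarrow> 0) at_bot"
  proof -
    have "((\<lambda>l. \<Sum>i<d. cdf (\<mu> i) l) \<longlongrightarrow> (\<Sum>i<d. 0)) at_bot"
      by (intro tendsto_sum finite_borel_measure.cdf_lim_at_bot fb) auto
    then show ?thesis unfolding Fc by simp
  qed
  have F_top: "(F \<longlongrightarrow> (\<Sum>i<d. measure (\<mu> i) (space (\<mu> i)))) at_top"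
    unfolding Fc by (intro tendsto_sum finite_borel_measure.cdf_lim_at_top fb) auto
  interpret \<nu>: finite_borel_measure ?\<nu>
    by (rule finite_borel_measure_interval_measure[OF F_mono F_cont F_bot F_top]) (auto intro: sum_nonneg)
  have \<nu>_Iic: "measure ?\<nu> {..x} = F x" for x
    by (rule measure_interval_measure_Iic[OF F_mono F_cont F_bot])
  \<comment> \<open>Half of \<open>m\<close> is used because an atom at \<open>m\<close> may make
    \<open>F m\<close> positive.\<close>
  have F0: "F (m / 2) = 0"
    unfolding F
  proof (intro sum.neutral ballI)
    fix i assume i: "i \<in> {..<d}"
    have "measure (\<mu> i) {0..m/2} = measure (\<mu> i) {}"
    proof (rule measure_eq_AE)
      show "AE x in \<mu> i. x \<in> {0..m/2} \<longleftrightarrow> x \<in> {}"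
        using AE[of i] i m by (auto elim!: eventually_mono)
    qed (use sets i in auto)
    then show "measure (\<mu> i) {0..m/2} = 0" by simp
  qed
  have FM: "F M = measure ?\<nu> UNIV"
  proof -
    have "F M = (\<Sum>i<d. measure (\<mu> i) (space (\<mu> i)))"
      unfolding F
    proof (rule sum.cong[OF refl])
      fix i assume i: "i \<in> {..<d}"
      show "measure (\<mu> i) {0..M} = measure (\<mu> i) (space (\<mu> i))"
      proof (rule measure_eq_AE)
        show "AE x in \<mu> i. x \<in> {0..M} \<longleftrightarrow> x \<in> space (\<mu> i)"
          using AE[of i] AE_space[of "\<mu> i"] i m by (auto elim!: eventually_elim2)
      qed (use sets i in auto)
    qed
    also have "\<dots> = measure ?\<nu> UNIV"
    proof -
      have nn: "0 \<le> (\<Sum>i<d. measure (\<mu> i) (space (\<mu> i)))" by (auto intro: sum_nonneg)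
      have "emeasure ?\<nu> UNIV = ennreal (\<Sum>i<d. measure (\<mu> i) (space (\<mu> i)))"
        by (rule interval_measure_UNIV[OF F_mono F_cont F_bot F_top nn])
      then show ?thesis unfolding measure_def[of ?\<nu>] by (simp only: enn2real_ennreal[OF nn])
    qed
    finally show ?thesis .
  qed
  have AE_low: "AE x in ?\<nu>. \<not> x \<le> m / 2"
    using \<nu>_Iic[of "m/2"] F0 by (intro AE_I[of _ _ "{..m/2}"]) (auto simp: \<nu>.emeasure_eq_measure)
  have AE_high: "AE x in ?\<nu>. x \<le> M"
  proof -
    have "measure ?\<nu> (UNIV - {..M}) = 0"
      using \<nu>.finite_measure_compl[of "{..M}"] \<nu>_Iic[of M] FM by simp
    then show ?thesis by (intro AE_I[of _ _ "UNIV - {..M}"]) (auto simp: \<nu>.emeasure_eq_measure)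
  qed
  have AE_\<nu>: "AE x in ?\<nu>. m / 2 \<le> x \<and> x \<le> M"
    using AE_low AE_high by eventually_elim auto
  have AE_\<mu>: "AE x in \<mu> i. m / 2 \<le> x \<and> x \<le> M" if "i < d" for i
    using AE[OF that] m by (auto elim!: eventually_mono)
  have fin_\<nu>: "finite_measure ?\<nu>" by (rule \<nu>.finite_measure_axioms)
  have bf_\<nu>: "borel_functional (m/2) M (\<lambda>f. \<integral>x. f x \<partial>?\<nu>)"
    by (rule borel_functional_integral[OF fin_\<nu> _ AE_\<nu>]) simp
  have bf_\<mu>: "borel_functional (m/2) M (\<lambda>f. \<Sum>i<d. \<integral>x. f x \<partial>\<mu> i)"
    by (intro borel_functional_sum_functionals borel_functional_integral fin sets AE_\<mu>) auto
  have ln: "ln \<in> bdd_borel (m/2) M"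
    using m by (intro bdd_borel_continuous borel_measurable_ln) (auto intro!: continuous_on_ln)
  have "(\<integral>x. ln x \<partial>?\<nu>) - (\<Sum>i<d. \<integral>x. ln x \<partial>\<mu> i) = 0"
  proof (rule borel_functional_eq_0_halflines[OF borel_functional_minus[OF bf_\<nu> bf_\<mu>] _ ln])
    fix x
    have "integral\<^sup>L (\<mu> i) (indicat_real {..x}) = cdf (\<mu> i) x" if "i < d" for i
      using Bochner_Integration.integral_indicator[of "\<mu> i" "{..x}"] sets_eq_imp_space_eq[OF sets[OF that]]
      by (simp add: cdf_def)
    then have "(\<Sum>i<d. integral\<^sup>L (\<mu> i) (indicat_real {..x})) = F x"
      unfolding Fc by (intro sum.cong) auto
    moreover have "integral\<^sup>L ?\<nu> (indicat_real {..x}) = F x"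
      using Bochner_Integration.integral_indicator[of ?\<nu> "{..x}"] by (simp add: \<nu>_Iic)
    ultimately show "integral\<^sup>L ?\<nu> (indicat_real {..x}) - (\<Sum>i<d. integral\<^sup>L (\<mu> i) (indicat_real {..x})) = 0"
      by simp
  qed
  moreover have "(LINT l:{0<..}|?\<nu>. ln l) = (\<integral>x. ln x \<partial>?\<nu>)"
    unfolding set_lebesgue_integral_def
  proof (rule integral_cong_AE)
    show "AE x in ?\<nu>. indicat_real {0<..} x *\<^sub>R ln x = ln x"
      using AE_low m by (auto elim!: eventually_mono)
  qed auto
  ultimately show "(LINT l:{0<..}|?\<nu>. ln l) = (\<Sum>i<d. \<integral>x. ln x \<partial>\<mu> i)" by simp
  have "(\<lambda>x. indicat_real {0<..} x * ln x) \<in> bdd_borel (m/2) M"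
    by (intro bdd_borel_mult bdd_borel_indicator ln) simp
  then show "set_integrable ?\<nu> {0<..} ln"
    unfolding set_integrable_def real_scaleR_def by (intro integrable_bdd_borel[OF fin_\<nu> _ AE_\<nu>]) simp_all
qed

text \<open>\<open>L\<close> is the sum of the integrals of \<open>ln\<close> against the spectral
  measures of the \<open>d\<close> unit vectors. These have mass 1, so replacing \<open>ln\<close>
  by the polynomial costs at most \<open>\<delta>\<close> for each, and the polynomial integrates to
  traces of powers.\<close>

lemma (in group) ln_det_approx:
  fixes c :: "nat \<Rightarrow> real"
  assumes A: "A \<in> gr_matrices G d" and B: "B \<in> gr_matrices G d"
    and BA: "mat_is_one G d (mat_mult G d B A)"
    and C: "C > 0" "mat_norm d A \<le> C" "mat_norm d B \<le> C"
    and poly: "\<And>x. 1 / C\<^sup>2 \<le> x \<Longrightarrow> x \<le> C\<^sup>2 \<Longrightarrow> \<bar>ln x - (\<Sum>k\<le>n. c k * x ^ k)\<bar> \<le> \<delta>"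
  defines "\<Delta> \<equiv> mat_mult G d (mat_star G A) A"
  obtains L where "ln_det G d (mat_op G d \<Delta>) = ereal L"
    "\<bar>L - (\<Sum>k\<le>n. c k * (\<Sum>i<d. of_int (Poly_Mapping.lookup (gr_column G d \<Delta> i k i) \<one>)))\<bar> \<le> \<delta> * real d"
proof -
  let ?S = "ell2_index G d"
  let ?T = "mat_op G d \<Delta>" and ?A = "mat_op G d A"
  have \<Delta>: "\<Delta> \<in> gr_matrices G d"
    unfolding \<Delta>_def by (intro mat_mult_closed mat_star_closed A)
  have T: "?T v = mat_op G d (mat_star G A) (?A v)" for v
    unfolding \<Delta>_def by (intro mat_op_mult mat_star_closed A)
  note closed = mat_op_closed[OF A]
  have T_right: "ell2_inner ?S v (?T w) = ell2_inner ?S (?A v) (?A w)" if "v \<in> ell2 ?S" "w \<in> ell2 ?S" for v w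
    unfolding T using that by (intro mat_op_adjoint[OF A, symmetric] closed)
  have T_left: "ell2_inner ?S (?T v) w = ell2_inner ?S (?A v) (?A w)" if "v \<in> ell2 ?S" "w \<in> ell2 ?S" for v w
    using T_right[OF that(2,1)] ell2_inner_commute by metis
  interpret T: ell2_operator ?S ?T
  proof
    show "?T v \<in> ell2 ?S" if "v \<in> ell2 ?S" for v by (rule mat_op_closed[OF \<Delta> that])
    show "ell2_inner ?S (?T v) w = ell2_inner ?S v (?T w)" if "v \<in> ell2 ?S" "w \<in> ell2 ?S" for v w
      using T_left[OF that] T_right[OF that] by simp
  qed
  have norm2: "Re (ell2_inner ?S v v) = (norm (Abs_l2 v))\<^sup>2" if "v \<in> ell2 ?S" for v
    using inner_Abs_l2[OF that] by (simp add: dot_square_norm)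
  have upper: "Re (ell2_inner ?S (?T v) v) \<le> C\<^sup>2 * Re (ell2_inner ?S v v)" if v: "v \<in> ell2 ?S" for v
  proof -
    have "norm (Abs_l2 (?A v)) \<le> mat_norm d A * norm (Abs_l2 v)" by (rule mat_op_bounded[OF A v])
    also have "\<dots> \<le> C * norm (Abs_l2 v)" using C(2) by (intro mult_right_mono) auto
    finally have "(norm (Abs_l2 (?A v)))\<^sup>2 \<le> (C * norm (Abs_l2 v))\<^sup>2" by (intro power_mono) auto
    then show ?thesis using v by (simp add: T_left norm2 closed power_mult_distrib)
  qed
  \<comment> \<open>Boundedness from below comes from the left inverse: \<open>v\<close> is
    \<open>B\<close> applied to \<open>A v\<close>.\<close>
  have lower: "1 / C\<^sup>2 * Re (ell2_inner ?S v v) \<le> Re (ell2_inner ?S (?T v) v)" if v: "v \<in> ell2 ?S" for v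
  proof -
    have "mat_op G d B (?A v) = v"
      using mat_op_one[OF BA, of v] v mat_op_mult[OF B A, of v] by (auto simp: ell2_iff)
    then have "norm (Abs_l2 v) \<le> mat_norm d B * norm (Abs_l2 (?A v))"
      using mat_op_bounded[OF B closed[OF v]] by simp
    also have "\<dots> \<le> C * norm (Abs_l2 (?A v))"
      using C(3) by (intro mult_right_mono) auto
    finally have "norm (Abs_l2 v) \<le> C * norm (Abs_l2 (?A v))" .
    then have "(norm (Abs_l2 v))\<^sup>2 \<le> (C * norm (Abs_l2 (?A v)))\<^sup>2" by (intro power_mono) auto
    then show ?thesis using v C(1) by (simp add: T_left norm2 closed power_mult_distrib field_simps)
  qed
  define E where "E = spectral_projection ?S ?T"
  have "\<exists>E. is_spectral_measure ?S ?T E"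
  proof (rule T.spectral_measure_exists[OF _ upper])
    show "0 \<le> Re (ell2_inner ?S (?T v) v)" if "v \<in> ell2 ?S" for v
      using that by (simp add: T_left norm2 closed)
  qed (use C in auto)
  then have E: "is_spectral_measure ?S ?T E"
    unfolding E_def spectral_projection_def by (rule someI_ex)
  define \<mu> where "\<mu> i = pvm_measure ?S E (unit_vec G i)" for i
  note facts = T.spectral_measure_moments[OF E lower upper unit_vec_in_ell2]
  have fin: "finite_measure (\<mu> i)" and sets: "sets (\<mu> i) = sets borel"
    and AE: "AE x in \<mu> i. 1 / C\<^sup>2 \<le> x \<and> x \<le> C\<^sup>2"
    and measure: "D \<in> sets borel \<Longrightarrow> measure (\<mu> i) D = Re (ell2_inner ?S (E D (unit_vec G i)) (unit_vec G i))"
    and mom: "(\<integral>x. x ^ k \<partial>\<mu> i) = Re (ell2_inner ?S ((?T ^^ k) (unit_vec G i)) (unit_vec G i))"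
    if "i < d" for i k D
    unfolding \<mu>_def
    by ((rule facts(1)[OF _ _ that]; assumption), (rule facts(2)[OF _ _ that]; assumption),
        (rule facts(3)[OF _ _ that]; assumption), (rule facts(4)[OF _ _ that]; assumption),
        (rule facts(5)[OF _ _ that]; assumption))
  have mom': "(\<integral>x. x ^ k \<partial>\<mu> i) = of_int (Poly_Mapping.lookup (gr_column G d \<Delta> i k i) \<one>)" if "i < d" for i k
    unfolding mom[OF that] ell2_inner_unit_vec[OF that] mat_op_funpow_unit_vec[OF \<Delta> that]
    using that by simp
  have F: "spectral_density G d ?T l = (\<Sum>i<d. measure (\<mu> i) {0..l})" for l
    unfolding spectral_density_def vn_trace_def E_def[symmetric] Re_sum
    by (intro sum.cong refl) (simp add: measure)
  have pos: "0 < 1 / C\<^sup>2" using C by simp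
  define L where "L = (\<Sum>i<d. \<integral>x. ln x \<partial>\<mu> i)"
  have "ln_det G d ?T = ereal L"
    unfolding ln_det_def Let_def L_def
    using interval_measure_sum_ln[OF fin sets AE pos F] by simp
  moreover have "\<bar>L - (\<Sum>k\<le>n. c k * (\<Sum>i<d. of_int (Poly_Mapping.lookup (gr_column G d \<Delta> i k i) \<one>)))\<bar> \<le> \<delta> * real d"
  proof -
    have ln: "ln \<in> bdd_borel (1 / C\<^sup>2) (C\<^sup>2)"
      using pos by (intro bdd_borel_continuous borel_measurable_ln) (auto intro!: continuous_on_ln)
    have p: "(\<lambda>x. \<Sum>k\<le>n. c k * x ^ k) \<in> bdd_borel (1 / C\<^sup>2) (C\<^sup>2)"
      by (intro bdd_borel_sum bdd_borel_cmult bdd_borel_power)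
    have "\<bar>(\<integral>x. ln x \<partial>\<mu> i) - (\<Sum>k\<le>n. c k * (\<integral>x. x ^ k \<partial>\<mu> i))\<bar> \<le> \<delta>" if i: "i < d" for i
    proof -
      note int = integrable_bdd_borel[OF fin[OF i] sets[OF i] AE[OF i]]
      interpret finite_measure "\<mu> i" by (rule fin[OF i])
      have space: "space (\<mu> i) = UNIV" using sets_eq_imp_space_eq[OF sets[OF i]] by simp
      \<comment> \<open>The zeroth column has coefficient 1 at the unit in entry \<open>i\<close>,
        so each \<open>\<mu> i\<close> is a probability measure.\<close>
      have "(\<integral>x. x ^ 0 \<partial>\<mu> i) = 1"
        unfolding mom'[OF i] by (simp add: gr_column_0 gr_one_def)
      then have mass: "measure (\<mu> i) UNIV = 1" by (simp add: space)
      have "(\<integral>x. ln x \<partial>\<mu> i) - (\<Sum>k\<le>n. c k * (\<integral>x. x ^ k \<partial>\<mu> i)) = (\<integral>x. ln x - (\<Sum>k\<le>n. c k * x ^ k) \<partial>\<mu> i)"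
        using int[OF ln] int[OF p] int[OF bdd_borel_power] int[OF bdd_borel_cmult[OF bdd_borel_power]] by simp
      also have "\<bar>\<dots>\<bar> \<le> (\<integral>x. \<bar>ln x - (\<Sum>k\<le>n. c k * x ^ k)\<bar> \<partial>\<mu> i)"
        by (rule integral_abs_bound)
      also have "\<dots> \<le> (\<integral>x. \<delta> \<partial>\<mu> i)"
      proof (rule integral_mono_AE)
        show "integrable (\<mu> i) (\<lambda>x. \<bar>ln x - (\<Sum>k\<le>n. c k * x ^ k)\<bar>)"
          using int[OF ln] int[OF p] by simp
        show "AE x in \<mu> i. \<bar>ln x - (\<Sum>k\<le>n. c k * x ^ k)\<bar> \<le> \<delta>"
          using AE[OF i] by eventually_elim (rule poly, auto)
      qed simp
      also have "\<dots> = \<delta>" by (simp add: space mass)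
      finally show ?thesis .
    qed
    then have "(\<Sum>i<d. \<bar>(\<integral>x. ln x \<partial>\<mu> i) - (\<Sum>k\<le>n. c k * (\<integral>x. x ^ k \<partial>\<mu> i))\<bar>) \<le> (\<Sum>i<d. \<delta>)"
      by (intro sum_mono) auto
    then have "\<bar>\<Sum>i<d. (\<integral>x. ln x \<partial>\<mu> i) - (\<Sum>k\<le>n. c k * (\<integral>x. x ^ k \<partial>\<mu> i))\<bar> \<le> \<delta> * real d"
      by (rule order_trans[OF sum_abs order_trans]) (simp add: mult.commute)
    moreover have "L - (\<Sum>k\<le>n. c k * (\<Sum>i<d. of_int (Poly_Mapping.lookup (gr_column G d \<Delta> i k i) \<one>))) =
       (\<Sum>i<d. (\<integral>x. ln x \<partial>\<mu> i) - (\<Sum>k\<le>n. c k * (\<integral>x. x ^ k \<partial>\<mu> i)))"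
    proof -
      have "(\<Sum>k\<le>n. c k * (\<Sum>i<d. of_int (Poly_Mapping.lookup (gr_column G d \<Delta> i k i) \<one>))) =
        (\<Sum>i<d. \<Sum>k\<le>n. c k * (\<integral>x. x ^ k \<partial>\<mu> i))"
        unfolding sum_distrib_left by (subst sum.swap) (simp add: mom')
      then show ?thesis by (simp add: L_def sum_subtractf)
    qed
    ultimately show ?thesis by (simp only:)
  qed
  ultimately show ?thesis by (rule that)
qed

section \<open>Transfer of determinants along homomorphisms\<close>

lemma mat_norm_push: "mat_norm d (mat_push h A) \<le> mat_norm d A"
  unfolding mat_norm_def mat_push_def by (intro sum_mono gr_norm_push)

lemma mat_norm_nonneg: "0 \<le> mat_norm d A"
  unfolding mat_norm_def by (intro sum_nonneg gr_norm_nonneg)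

text \<open>Puts the inverse equations into the form of equal push-forwards, to which
  \<open>gr_push_eq_transfer\<close> applies.\<close>

lemma mat_is_one_push_iff:
  assumes h: "h \<in> hom K H" "group K" "group H" and A: "A \<in> gr_matrices K d" and B: "B \<in> gr_matrices K d"
  shows "mat_is_one H d (mat_mult H d (mat_push h A) (mat_push h B)) \<longleftrightarrow>
    (\<forall>i<d. \<forall>j<d. gr_push h (mat_mult K d A B i j) = gr_push h (if i = j then gr_one K else 0))"
  using mat_push_mult[OF h(1) A B] unfolding mat_is_one_def
  by (auto simp: mat_push_def gr_push_one[OF h])

text \<open>Reduces coincidence of images to triviality of one image, which is all that the choice
  of an auxiliary group controls.\<close>

lemma hom_eq_iff:
  assumes "h \<in> hom K H" "group K" "group H" "x \<in> carrier K" "y \<in> carrier K"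
  shows "h x = h y \<longleftrightarrow> h (x \<otimes>\<^bsub>K\<^esub> inv\<^bsub>K\<^esub> y) = \<one>\<^bsub>H\<^esub>"
proof -
  interpret group_hom K H h using assms(1-3) by (simp add: group_hom_def group_hom_axioms_def)
  show ?thesis using assms(4,5)
    by (metis H.inv_closed H.inv_equality H.inv_inv H.r_inv G.inv_closed hom_closed hom_inv hom_mult)
qed

text \<open>
  The hypothesis is applied to the quotients \<open>x y\<^sup>-\<^sup>1\<close> that decide whether the pushed matrices stay
  inverse to each other, and to the supports of the traces of powers.
\<close>

theorem ln_det_push_eq_0:
  fixes K :: "('k, 'm) monoid_scheme" and G :: "('g, 'n) monoid_scheme"
  assumes K: "group K" and G: "group G" and f: "f \<in> hom K G"
    and A: "A \<in> gr_matrices K d" and B: "B \<in> gr_matrices K d"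
    and AB: "mat_is_one G d (mat_mult G d (mat_push f A) (mat_push f B))"
    and BA: "mat_is_one G d (mat_mult G d (mat_push f B) (mat_push f A))"
    and ex: "\<And>F. finite F \<Longrightarrow> F \<subseteq> carrier K \<Longrightarrow>
      \<exists>(H :: 'h monoid) h. group H \<and> whitehead_trivial_det H \<and> h \<in> hom K H \<and>
        (\<forall>x\<in>F. h x = \<one>\<^bsub>H\<^esub> \<longleftrightarrow> f x = \<one>\<^bsub>G\<^esub>)"
  shows "ln_det G d (mat_op G d (mat_mult G d (mat_star G (mat_push f A)) (mat_push f A))) = 0"
proof -
  \<comment> \<open>The summand 1 keeps \<open>C\<close> positive even when both norms are 0, as for
    \<open>d = 0\<close>.\<close>
  define C where "C = 1 + mat_norm d A + mat_norm d B"
  have C: "C > 0" "mat_norm d A \<le> C" "mat_norm d B \<le> C"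
    using mat_norm_nonneg[of d A] mat_norm_nonneg[of d B] by (auto simp: C_def)
  define \<Delta> where "\<Delta> = mat_mult K d (mat_star K A) A"
  have \<Delta>: "\<Delta> \<in> gr_matrices K d"
    unfolding \<Delta>_def by (intro group.mat_mult_closed[OF K] group.mat_star_closed[OF K] A)
  let ?det = "ln_det G d (mat_op G d (mat_mult G d (mat_star G (mat_push f A)) (mat_push f A)))"
  \<comment> \<open>The determinants over \<open>G\<close> and over \<open>H\<close> both lie within
    \<open>\<delta> * d\<close> of the same combination of traces, and the one over \<open>H\<close>
    is 0.\<close>
  have small: "\<exists>L. ?det = ereal L \<and> \<bar>L\<bar> \<le> 2 * \<delta> * real d" if \<delta>: "\<delta> > 0" for \<delta>
  proof -
    have "continuous_on {1 / C\<^sup>2..C\<^sup>2} (ln :: real \<Rightarrow> real)"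
    proof (intro continuous_on_ln continuous_on_id ballI)
      show "x \<noteq> 0" if "x \<in> {1 / C\<^sup>2..C\<^sup>2}" for x
      proof -
        have "0 < 1 / C\<^sup>2" using C by simp
        then show ?thesis using that by (auto simp del: zero_less_divide_iff)
      qed
    qed
    then obtain p where p: "real_polynomial_function p" "\<And>x. x \<in> {1 / C\<^sup>2..C\<^sup>2} \<Longrightarrow> \<bar>ln x - p x\<bar> < \<delta>"
      using Stone_Weierstrass_real_polynomial_function[of "{1 / C\<^sup>2..C\<^sup>2}" ln \<delta>] \<delta> by auto
    obtain c n where cn: "p = (\<lambda>x. \<Sum>i\<le>n. c i * x ^ i)"
      using p(1) unfolding real_polynomial_function_iff_sum by auto
    have poly: "\<bar>ln x - (\<Sum>k\<le>n. c k * x ^ k)\<bar> \<le> \<delta>" if "1 / C\<^sup>2 \<le> x" "x \<le> C\<^sup>2" for x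
      using p(2)[of x] that unfolding cn by simp
    define one where "one i j = (if i = j then gr_one K else 0)" for i j :: nat
    \<comment> \<open>Entries of both products are compared with entries of the identity matrix,
      whose supports must be included too.\<close>
    define M where "M i j = {mat_mult K d A B i j, mat_mult K d B A i j, one i j}" for i j
    define X where "X = (\<Union>i<d. \<Union>j<d. \<Union>a\<in>M i j. Poly_Mapping.keys a)"
    define F where "F = (\<lambda>(x, y). x \<otimes>\<^bsub>K\<^esub> inv\<^bsub>K\<^esub> y) ` (X \<times> X) \<union>
      (\<Union>i<d. \<Union>k\<le>n. Poly_Mapping.keys (gr_column K d \<Delta> i k i))"
    have "M i j \<subseteq> group_ring K" if "i < d" "j < d" for i j
      using group.mat_mult_closed[OF K A B] group.mat_mult_closed[OF K B A] group.gr_one_closed[OF K] that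
      by (auto simp: M_def one_def gr_matrices_def) (auto simp: group_ring_def)
    then have X: "X \<subseteq> carrier K" "finite X"
      unfolding X_def by (fastforce simp: group_ring_def M_def)+
    have "Poly_Mapping.keys (gr_column K d \<Delta> i k i) \<subseteq> carrier K" if "i < d" for i k
      using group.gr_column_closed[OF K \<Delta> that] by (simp add: group_ring_def)
    moreover have "x \<otimes>\<^bsub>K\<^esub> inv\<^bsub>K\<^esub> y \<in> carrier K" if "x \<in> X" "y \<in> X" for x y
      using that X(1) K by (simp add: subset_iff group.inv_closed group.is_monoid monoid.m_closed)
    ultimately have "F \<subseteq> carrier K" "finite F"
      using X(2) unfolding F_def by auto
    then obtain H :: "'h monoid" and h where H: "group H" "whitehead_trivial_det H" and h: "h \<in> hom K H"
      and hF: "\<And>x. x \<in> F \<Longrightarrow> h x = \<one>\<^bsub>H\<^esub> \<longleftrightarrow> f x = \<one>\<^bsub>G\<^esub>"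
      using ex[of F] by blast
    have sep: "h x = h y \<longleftrightarrow> f x = f y" if "x \<in> X" "y \<in> X" for x y
    proof -
      have "(\<lambda>(x, y). x \<otimes>\<^bsub>K\<^esub> inv\<^bsub>K\<^esub> y) (x, y) \<in> F"
        unfolding F_def by (rule UnI1, rule imageI) (use that in simp)
      then have "x \<otimes>\<^bsub>K\<^esub> inv\<^bsub>K\<^esub> y \<in> F" by simp
      moreover have "x \<in> carrier K" "y \<in> carrier K" using that X(1) by auto
      ultimately show ?thesis
        using hF hom_eq_iff[OF h K H(1), of x y] hom_eq_iff[OF f K G, of x y] by simp
    qed
    have transfer: "gr_push h a = gr_push h (one i j)"
      if "i < d" "j < d" "a \<in> M i j" "gr_push f a = gr_push f (one i j)" for a i j
    proof (rule gr_push_eq_transfer[OF _ that(4)])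
      fix x y assume "x \<in> Poly_Mapping.keys a \<union> Poly_Mapping.keys (one i j)"
        "y \<in> Poly_Mapping.keys a \<union> Poly_Mapping.keys (one i j)"
      then have "x \<in> X" "y \<in> X" using that(1-3) unfolding X_def by (auto simp: M_def)
      then show "h x = h y \<longleftrightarrow> f x = f y" by (rule sep)
    qed
    \<comment> \<open>Triviality of determinants over \<open>H\<close> can be used only once the
      pushed matrix is known to be invertible there, so both inverse equations are carried
      over.\<close>
    have AB_H: "mat_is_one H d (mat_mult H d (mat_push h A) (mat_push h B))"
      unfolding mat_is_one_push_iff[OF h K H(1) A B]
    proof (intro allI impI)
      fix i j assume ij: "i < d" "j < d"
      then have "gr_push f (mat_mult K d A B i j) = gr_push f (one i j)"
        using AB unfolding mat_is_one_push_iff[OF f K G A B] one_def by blast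
      moreover have "mat_mult K d A B i j \<in> M i j" by (simp add: M_def)
      ultimately show "gr_push h (mat_mult K d A B i j) = gr_push h (if i = j then gr_one K else 0)"
        using transfer[OF ij] unfolding one_def by blast
    qed
    have BA_H: "mat_is_one H d (mat_mult H d (mat_push h B) (mat_push h A))"
      unfolding mat_is_one_push_iff[OF h K H(1) B A]
    proof (intro allI impI)
      fix i j assume ij: "i < d" "j < d"
      then have "gr_push f (mat_mult K d B A i j) = gr_push f (one i j)"
        using BA unfolding mat_is_one_push_iff[OF f K G B A] one_def by blast
      moreover have "mat_mult K d B A i j \<in> M i j" by (simp add: M_def)
      ultimately show "gr_push h (mat_mult K d B A i j) = gr_push h (if i = j then gr_one K else 0)"
        using transfer[OF ij] unfolding one_def by blast
    qed
    have "mat_push h A \<in> GL_group_ring H d"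
      using AB_H BA_H mat_push_closed[OF h A] mat_push_closed[OF h B] by (auto simp: GL_group_ring_def)
    then have det_H: "ln_det H d (mat_op H d (mat_mult H d (mat_star H (mat_push h A)) (mat_push h A))) = 0"
      using H(2) by (simp add: whitehead_trivial_det_def)
    let ?tr = "\<lambda>k. \<Sum>i<d. of_int (Poly_Mapping.lookup (gr_push f (gr_column K d \<Delta> i k i)) \<one>\<^bsub>G\<^esub>) :: real"
    have tr_G: "gr_column G d (mat_mult G d (mat_star G (mat_push f A)) (mat_push f A)) i k i =
        gr_push f (gr_column K d \<Delta> i k i)" if "i < d" for i k
      by (rule gr_column_push[OF f K G \<Delta> _ that]) (simp add: \<Delta>_def mat_push_star_mult[OF f K G A])
    have tr_H: "gr_column H d (mat_mult H d (mat_star H (mat_push h A)) (mat_push h A)) i k i =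
        gr_push h (gr_column K d \<Delta> i k i)" if "i < d" for i k
      by (rule gr_column_push[OF h K H(1) \<Delta> _ that]) (simp add: \<Delta>_def mat_push_star_mult[OF h K H(1) A])
    \<comment> \<open>The coefficient at the unit sums over the support elements that become
      trivial, and these are the same for \<open>h\<close> and \<open>f\<close>.\<close>
    have tr_eq: "Poly_Mapping.lookup (gr_push h (gr_column K d \<Delta> i k i)) \<one>\<^bsub>H\<^esub> =
        Poly_Mapping.lookup (gr_push f (gr_column K d \<Delta> i k i)) \<one>\<^bsub>G\<^esub>" if "i < d" "k \<le> n" for i k
    proof -
      have "{x \<in> Poly_Mapping.keys (gr_column K d \<Delta> i k i). h x = \<one>\<^bsub>H\<^esub>} =
          {x \<in> Poly_Mapping.keys (gr_column K d \<Delta> i k i). f x = \<one>\<^bsub>G\<^esub>}"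
        using hF that unfolding F_def by blast
      then show ?thesis by (simp add: lookup_gr_push)
    qed
    obtain L where L: "?det = ereal L" "\<bar>L - (\<Sum>k\<le>n. c k * ?tr k)\<bar> \<le> \<delta> * real d"
      by (rule group.ln_det_approx[OF G mat_push_closed[OF f A] mat_push_closed[OF f B] BA C(1)
            order_trans[OF mat_norm_push C(2)] order_trans[OF mat_norm_push C(3)] poly])
         (simp_all add: tr_G)
    obtain L' where L': "ln_det H d (mat_op H d (mat_mult H d (mat_star H (mat_push h A)) (mat_push h A))) = ereal L'"
      "\<bar>L' - (\<Sum>k\<le>n. c k * ?tr k)\<bar> \<le> \<delta> * real d"
      by (rule group.ln_det_approx[OF H(1) mat_push_closed[OF h A] mat_push_closed[OF h B] BA_H C(1)
            order_trans[OF mat_norm_push C(2)] order_trans[OF mat_norm_push C(3)] poly])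
         (simp_all add: tr_H tr_eq)
    have "L' = 0" using L'(1) det_H by (simp add: zero_ereal_def)
    then have "\<bar>L\<bar> \<le> 2 * \<delta> * real d" using L(2) L'(2) by auto
    then show ?thesis using L(1) by blast
  qed
  obtain L where L: "?det = ereal L" using small[of 1] by auto
  have "\<bar>L\<bar> \<le> e" if "e > 0" for e
  proof -
    \<comment> \<open>The denominator has \<open>d + 1\<close> so that \<open>d = 0\<close> is
      covered as well.\<close>
    have "0 < e / (2 * (real d + 1))" using that by simp
    from small[OF this] L have "\<bar>L\<bar> \<le> 2 * (e / (2 * (real d + 1))) * real d" by auto
    also have "\<dots> = e * (real d / (real d + 1))" by (simp add: field_simps)
    also have "\<dots> \<le> e * 1" using that by (intro mult_left_mono) auto
    finally show ?thesis by simp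
  qed
  then have "L = 0" using field_le_epsilon[of "\<bar>L\<bar>" 0] by force
  then show ?thesis using L by (simp add: zero_ereal_def)
qed

text \<open>The case \<open>K = G\<close> with the identity map. Homomorphisms preserve the unit, so
  the required equivalence reduces to one implication.\<close>

corollary whitehead_trivial_det_residual:
  fixes G :: "('g, 'n) monoid_scheme"
  assumes G: "group G"
    and ex: "\<And>F. finite F \<Longrightarrow> F \<subseteq> carrier G \<Longrightarrow>
      \<exists>(H :: 'h monoid) h. group H \<and> whitehead_trivial_det H \<and> h \<in> hom G H \<and>
        (\<forall>x\<in>F. h x = \<one>\<^bsub>H\<^esub> \<longrightarrow> x = \<one>\<^bsub>G\<^esub>)"
  shows "whitehead_trivial_det G"
  unfolding whitehead_trivial_det_def
proof (intro allI ballI)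
  fix d A assume "A \<in> GL_group_ring G d"
  then obtain B where A: "A \<in> gr_matrices G d" and B: "B \<in> gr_matrices G d"
    and AB: "mat_is_one G d (mat_mult G d A B)" "mat_is_one G d (mat_mult G d B A)"
    by (auto simp: GL_group_ring_def)
  have id: "mat_push (\<lambda>x. x) A = A" for A :: "'g gr_matrix"
    by (simp add: mat_push_def gr_push_id)
  have "ln_det G d (mat_op G d (mat_mult G d (mat_star G (mat_push (\<lambda>x. x) A)) (mat_push (\<lambda>x. x) A))) = 0"
  proof (rule ln_det_push_eq_0[OF G G _ A B])
    fix F :: "'g set" assume F: "finite F" "F \<subseteq> carrier G"
    obtain H :: "'h monoid" and h where H: "group H" "whitehead_trivial_det H" "h \<in> hom G H"
      "\<forall>x\<in>F. h x = \<one>\<^bsub>H\<^esub> \<longrightarrow> x = \<one>\<^bsub>G\<^esub>" using ex[OF F] by blast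
    have "h \<one>\<^bsub>G\<^esub> = \<one>\<^bsub>H\<^esub>" by (rule hom_one[OF H(3) G H(1)])
    then show "\<exists>(H :: 'h monoid) h. group H \<and> whitehead_trivial_det H \<and> h \<in> hom G H \<and>
        (\<forall>x\<in>F. h x = \<one>\<^bsub>H\<^esub> \<longleftrightarrow> x = \<one>\<^bsub>G\<^esub>)"
      using H by blast
  qed (use AB in \<open>auto simp: id hom_def\<close>)
  then show "ln_det G d (mat_op G d (mat_mult G d (mat_star G A) A)) = 0" by (simp only: id)
qed

section \<open>Subgroups and inverse limits\<close>

lemma directed_index_finite:
  assumes "directed_index I R" "finite J" "J \<subseteq> I"
  shows "\<exists>k\<in>I. \<forall>j\<in>J. R j k"
  using assms(2,3)
proof (induction J)
  case empty
  then show ?case using assms(1) by (auto simp: directed_index_def)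
next
  case (insert j J)
  then obtain k where k: "k \<in> I" "\<forall>j\<in>J. R j k" by auto
  moreover have "j \<in> I" "J \<subseteq> I" using insert.prems by auto
  ultimately obtain l where l: "l \<in> I" "R j l" "R k l"
    using assms(1) unfolding directed_index_def by blast
  have "transp_on I R" using assms(1) by (simp add: directed_index_def)
  then have "R x l" if "x \<in> J" for x
    using transp_onD[of I R x k l] that k l \<open>J \<subseteq> I\<close> by blast
  then show ?case using l by blast
qed

text \<open>The inclusion into \<open>\<pi>\<close> is injective, so it serves for every finite set
  at once.\<close>

theorem whitehead_trivial_det_subgroup:
  fixes \<pi> :: "'c monoid"
  assumes \<pi>: "group \<pi>" "whitehead_trivial_det \<pi>" and U: "subgroup U \<pi>"
  shows "whitehead_trivial_det (\<pi>\<lparr>carrier := U\<rparr>)"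
proof (rule whitehead_trivial_det_residual)
  show "group (\<pi>\<lparr>carrier := U\<rparr>)" using U \<pi>(1) by (rule subgroup.subgroup_is_group)
  have "(\<lambda>x. x) \<in> hom (\<pi>\<lparr>carrier := U\<rparr>) \<pi>"
    using subgroup.subset[OF U] by (auto simp: hom_def)
  then show "\<exists>(H :: 'c monoid) h. group H \<and> whitehead_trivial_det H \<and> h \<in> hom (\<pi>\<lparr>carrier := U\<rparr>) H \<and>
      (\<forall>x\<in>F. h x = \<one>\<^bsub>H\<^esub> \<longrightarrow> x = \<one>\<^bsub>\<pi>\<lparr>carrier := U\<rparr>\<^esub>)" for F
    using \<pi> by (intro exI[of _ \<pi>] exI[of _ "\<lambda>x. x"]) simp
qed

text \<open>A nontrivial element has a nontrivial coordinate, and all coordinates above that index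
  are nontrivial because a structure map sends them to it. An index above finitely many such indices
  serves for all of \<open>F\<close>.\<close>

theorem whitehead_trivial_det_inverse_limit:
  fixes G :: "'i \<Rightarrow> 'a monoid" and \<pi> :: "'p monoid"
  assumes sys: "inverse_system I R G p" and triv: "\<And>i. i \<in> I \<Longrightarrow> whitehead_trivial_det (G i)"
    and \<pi>: "group \<pi>" and iso: "\<pi> \<cong> inverse_limit I R G p"
  shows "whitehead_trivial_det \<pi>"
proof (rule whitehead_trivial_det_residual[OF \<pi>])
  fix F assume F: "finite F" "F \<subseteq> carrier \<pi>"
  have dir: "directed_index I R" and grp: "\<And>i. i \<in> I \<Longrightarrow> group (G i)"
    and p: "\<And>i j. i \<in> I \<Longrightarrow> j \<in> I \<Longrightarrow> R i j \<Longrightarrow> p i j \<in> hom (G j) (G i)"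
    using sys by (auto simp: inverse_system_def)
  obtain \<theta> where \<theta>: "\<theta> \<in> hom \<pi> (inverse_limit I R G p)" "inj_on \<theta> (carrier \<pi>)"
    using iso by (auto simp: is_iso_def iso_def bij_betw_def)
  have car: "\<theta> x \<in> (\<Pi>\<^sub>E i\<in>I. carrier (G i))" "\<And>i j. i \<in> I \<Longrightarrow> j \<in> I \<Longrightarrow> R i j \<Longrightarrow> p i j (\<theta> x j) = \<theta> x i"
    if "x \<in> carrier \<pi>" for x
    using \<theta>(1) that by (auto simp: hom_def inverse_limit_def Pi_iff)
  have hom: "(\<lambda>x. \<theta> x i) \<in> hom \<pi> (G i)" if "i \<in> I" for i
  proof (rule homI)
    show "\<theta> x i \<in> carrier (G i)" if "x \<in> carrier \<pi>" for x using car(1)[OF that] \<open>i \<in> I\<close> by auto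
    show "\<theta> (x \<otimes>\<^bsub>\<pi>\<^esub> y) i = \<theta> x i \<otimes>\<^bsub>G i\<^esub> \<theta> y i" if "x \<in> carrier \<pi>" "y \<in> carrier \<pi>" for x y
      using hom_mult[OF \<theta>(1) that] \<open>i \<in> I\<close> by (simp add: inverse_limit_def)
  qed
  have one: "\<theta> \<one>\<^bsub>\<pi>\<^esub> i = \<one>\<^bsub>G i\<^esub>" if "i \<in> I" for i
    using hom_one[OF hom[OF that] \<pi> grp[OF that]] .
  have "\<exists>i\<in>I. \<theta> x i \<noteq> \<one>\<^bsub>G i\<^esub>" if "x \<in> carrier \<pi>" "x \<noteq> \<one>\<^bsub>\<pi>\<^esub>" for x
  proof (rule ccontr)
    assume "\<not> ?thesis"
    moreover have "\<one>\<^bsub>\<pi>\<^esub> \<in> carrier \<pi>" using \<pi> by (simp add: group.is_monoid monoid.one_closed)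
    ultimately have "\<theta> x = \<theta> \<one>\<^bsub>\<pi>\<^esub>"
      using car(1)[OF that(1)] car(1)[of "\<one>\<^bsub>\<pi>\<^esub>"] one by (intro PiE_ext[of _ I "\<lambda>i. carrier (G i)"]) auto
    then show False using inj_onD[OF \<theta>(2)] that \<open>\<one>\<^bsub>\<pi>\<^esub> \<in> carrier \<pi>\<close> by blast
  qed
  then obtain \<iota> where \<iota>: "\<And>x. x \<in> carrier \<pi> \<Longrightarrow> x \<noteq> \<one>\<^bsub>\<pi>\<^esub> \<Longrightarrow> \<iota> x \<in> I \<and> \<theta> x (\<iota> x) \<noteq> \<one>\<^bsub>G (\<iota> x)\<^esub>" by metis
  have "\<iota> ` (F - {\<one>\<^bsub>\<pi>\<^esub>}) \<subseteq> I" using F \<iota> by blast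
  then obtain k where k: "k \<in> I" "\<And>x. x \<in> F \<Longrightarrow> x \<noteq> \<one>\<^bsub>\<pi>\<^esub> \<Longrightarrow> R (\<iota> x) k"
    using directed_index_finite[OF dir, of "\<iota> ` (F - {\<one>\<^bsub>\<pi>\<^esub>})"] F(1) by auto
  have "x = \<one>\<^bsub>\<pi>\<^esub>" if x: "x \<in> F" "\<theta> x k = \<one>\<^bsub>G k\<^esub>" for x
  proof (rule ccontr)
    assume nx: "x \<noteq> \<one>\<^bsub>\<pi>\<^esub>"
    have xc: "x \<in> carrier \<pi>" using F x by auto
    have "\<theta> x (\<iota> x) = p (\<iota> x) k \<one>\<^bsub>G k\<^esub>"
      using car(2)[OF xc, of "\<iota> x" k] \<iota>[OF xc nx] k nx x by simp
    also have "\<dots> = \<one>\<^bsub>G (\<iota> x)\<^esub>"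
      using \<iota>[OF xc nx] k nx x by (intro hom_one[OF p] grp) auto
    finally show False using \<iota>[OF xc nx] by blast
  qed
  then show "\<exists>(H :: 'a monoid) h. group H \<and> whitehead_trivial_det H \<and> h \<in> hom \<pi> H \<and>
      (\<forall>x\<in>F. h x = \<one>\<^bsub>H\<^esub> \<longrightarrow> x = \<one>\<^bsub>\<pi>\<^esub>)"
    using grp triv hom k(1) by (intro exI[of _ "G k"] exI[of _ "\<lambda>x. \<theta> x k"]) auto
qed

section \<open>Direct limits\<close>

context
  fixes I :: "'i set" and R and G :: "'i \<Rightarrow> 'a monoid" and \<phi>
  assumes sys: "direct_system I R G \<phi>"
begin

lemma direct_system_directed: "directed_index I R"
  using sys by (simp add: direct_system_def)

lemma direct_system_ub:
  assumes "i \<in> I" "j \<in> I"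
  obtains k where "k \<in> I" "R i k" "R j k"
  using direct_system_directed assms by (auto simp: directed_index_def)

lemma direct_system_trans: "i \<in> I \<Longrightarrow> j \<in> I \<Longrightarrow> k \<in> I \<Longrightarrow> R i j \<Longrightarrow> R j k \<Longrightarrow> R i k"
  using direct_system_directed unfolding directed_index_def transp_on_def by blast

lemma direct_system_refl: "i \<in> I \<Longrightarrow> R i i"
  using direct_system_directed unfolding directed_index_def reflp_on_def by blast

lemma direct_system_group: "i \<in> I \<Longrightarrow> group (G i)"
  using sys by (simp add: direct_system_def)

lemma direct_system_hom: "i \<in> I \<Longrightarrow> j \<in> I \<Longrightarrow> R i j \<Longrightarrow> \<phi> i j \<in> hom (G i) (G j)"
  using sys by (simp add: direct_system_def)

lemma direct_system_comp:
  "i \<in> I \<Longrightarrow> j \<in> I \<Longrightarrow> k \<in> I \<Longrightarrow> R i j \<Longrightarrow> R j k \<Longrightarrow> x \<in> carrier (G i) \<Longrightarrow> \<phi> j k (\<phi> i j x) = \<phi> i k x"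
  using sys by (simp add: direct_system_def)

lemma direct_system_closed:
  "i \<in> I \<Longrightarrow> j \<in> I \<Longrightarrow> R i j \<Longrightarrow> x \<in> carrier (G i) \<Longrightarrow> \<phi> i j x \<in> carrier (G j)"
  using direct_system_hom by (auto simp: hom_def)

abbreviation (input) "cls i x \<equiv> direct_limit_rel I R G \<phi> `` {(i, x)}"

text \<open>Applying a further structure map preserves the coincidence at \<open>k\<close>. In this
  form several relations can be brought to one common upper bound.\<close>

lemma direct_limit_rel_mono:
  assumes "((i, x), (j, y)) \<in> direct_limit_rel I R G \<phi>"
  obtains k where "k \<in> I" "R i k" "R j k" "\<And>m. m \<in> I \<Longrightarrow> R k m \<Longrightarrow> \<phi> i m x = \<phi> j m y"
proof -
  obtain k where "i \<in> I" "x \<in> carrier (G i)" "j \<in> I" "y \<in> carrier (G j)"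
    "k \<in> I" "R i k" "R j k" "\<phi> i k x = \<phi> j k y"
    using assms by (auto simp: direct_limit_rel_def)
  then show ?thesis using that direct_system_comp by metis
qed

lemma direct_limit_rel_equiv: "equiv (SIGMA i:I. carrier (G i)) (direct_limit_rel I R G \<phi>)"
proof (rule equivI)
  show "direct_limit_rel I R G \<phi> \<subseteq> (SIGMA i:I. carrier (G i)) \<times> (SIGMA i:I. carrier (G i))"
    by (auto simp: direct_limit_rel_def)
  show "refl_on (SIGMA i:I. carrier (G i)) (direct_limit_rel I R G \<phi>)"
    using direct_system_refl by (auto simp: refl_on_def direct_limit_rel_def)
  show "Relation.sym (direct_limit_rel I R G \<phi>)"
    by (auto simp: sym_def direct_limit_rel_def)
  show "trans (direct_limit_rel I R G \<phi>)"
  proof (rule transI, clarify)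
    fix i x j y k z
    assume 1: "((i, x), (j, y)) \<in> direct_limit_rel I R G \<phi>" and 2: "((j, y), (k, z)) \<in> direct_limit_rel I R G \<phi>"
    obtain l where l: "l \<in> I" "R i l" "R j l" "\<And>m. m \<in> I \<Longrightarrow> R l m \<Longrightarrow> \<phi> i m x = \<phi> j m y"
      using direct_limit_rel_mono[OF 1] by blast
    obtain l' where l': "l' \<in> I" "R j l'" "R k l'" "\<And>m. m \<in> I \<Longrightarrow> R l' m \<Longrightarrow> \<phi> j m y = \<phi> k m z"
      using direct_limit_rel_mono[OF 2] by blast
    obtain m where "m \<in> I" "R l m" "R l' m" using direct_system_ub l(1) l'(1) by blast
    moreover have "i \<in> I" "x \<in> carrier (G i)" "k \<in> I" "z \<in> carrier (G k)"
      using 1 2 by (auto simp: direct_limit_rel_def)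
    ultimately show "((i, x), (k, z)) \<in> direct_limit_rel I R G \<phi>"
      using l l' direct_system_trans[of i l m] direct_system_trans[of k l' m]
      by (auto simp: direct_limit_rel_def intro!: bexI[of _ m])
  qed
qed

text \<open>The product is a union over all representatives and upper bounds; \<open>eq\<close>
  shows that each of them contributes the same class. This makes \<open>x \<mapsto> cls i x\<close>
  multiplicative, while the group laws are taken from \<open>\<pi>\<close>.\<close>

lemma direct_limit_mult:
  assumes i: "i \<in> I" and x: "x \<in> carrier (G i)" and y: "y \<in> carrier (G i)"
  shows "cls i x \<otimes>\<^bsub>direct_limit I R G \<phi>\<^esub> cls i y = cls i (x \<otimes>\<^bsub>G i\<^esub> y)"
proof -
  let ?r = "direct_limit_rel I R G \<phi>"
  have eq: "cls k (\<phi> a k x' \<otimes>\<^bsub>G k\<^esub> \<phi> b k y') = cls i (x \<otimes>\<^bsub>G i\<^esub> y)"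
    if ax: "((i, x), (a, x')) \<in> ?r" and bY: "((i, y), (b, y')) \<in> ?r" and k: "k \<in> I" "R a k" "R b k" for a x' b y' k
  proof -
    obtain l where l: "l \<in> I" "R i l" "R a l" "\<And>m. m \<in> I \<Longrightarrow> R l m \<Longrightarrow> \<phi> i m x = \<phi> a m x'"
      using direct_limit_rel_mono[OF ax] by blast
    obtain l' where l': "l' \<in> I" "R i l'" "R b l'" "\<And>m. m \<in> I \<Longrightarrow> R l' m \<Longrightarrow> \<phi> i m y = \<phi> b m y'"
      using direct_limit_rel_mono[OF bY] by blast
    obtain m where m: "m \<in> I" "R k m" "R l m" "R l' m"
      using directed_index_finite[OF direct_system_directed, of "{k, l, l'}"] k(1) l(1) l'(1) by auto
    have c: "a \<in> I" "b \<in> I" "x' \<in> carrier (G a)" "y' \<in> carrier (G b)"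
      using ax bY by (auto simp: direct_limit_rel_def)
    have im: "R i m" using direct_system_trans i l m by blast
    have "\<phi> k m (\<phi> a k x' \<otimes>\<^bsub>G k\<^esub> \<phi> b k y') = \<phi> a m x' \<otimes>\<^bsub>G m\<^esub> \<phi> b m y'"
      using c k m hom_mult[OF direct_system_hom[OF k(1) m(1) m(2)]]
      by (simp add: direct_system_closed direct_system_comp)
    also have "\<dots> = \<phi> i m x \<otimes>\<^bsub>G m\<^esub> \<phi> i m y"
      using l(4)[OF m(1) m(3)] l'(4)[OF m(1) m(4)] by simp
    also have "\<dots> = \<phi> i m (x \<otimes>\<^bsub>G i\<^esub> y)"
      using hom_mult[OF direct_system_hom[OF i m(1) im] x y] by simp
    finally have "((k, \<phi> a k x' \<otimes>\<^bsub>G k\<^esub> \<phi> b k y'), (i, x \<otimes>\<^bsub>G i\<^esub> y)) \<in> ?r"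
      using i k m im c x y direct_system_group[OF i] direct_system_group[OF k(1)]
      by (auto simp: direct_limit_rel_def direct_system_closed group.is_monoid monoid.m_closed intro!: bexI[of _ m])
    then show ?thesis by (rule equiv_class_eq[OF direct_limit_rel_equiv])
  qed
  have self: "((i, z), (i, z)) \<in> ?r" if "z \<in> carrier (G i)" for z
    using i that direct_system_refl[OF i] by (auto simp: direct_limit_rel_def)
  show ?thesis
  proof (rule equalityI)
    show "cls i x \<otimes>\<^bsub>direct_limit I R G \<phi>\<^esub> cls i y \<subseteq> cls i (x \<otimes>\<^bsub>G i\<^esub> y)"
      unfolding direct_limit_def using eq by fastforce
    have "cls i (x \<otimes>\<^bsub>G i\<^esub> y) = cls i (\<phi> i i x \<otimes>\<^bsub>G i\<^esub> \<phi> i i y)"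
      using eq[OF self[OF x] self[OF y] i direct_system_refl[OF i] direct_system_refl[OF i]] by simp
    then show "cls i (x \<otimes>\<^bsub>G i\<^esub> y) \<subseteq> cls i x \<otimes>\<^bsub>direct_limit I R G \<phi>\<^esub> cls i y"
      unfolding direct_limit_def using self[OF x] self[OF y] i direct_system_refl[OF i] by fastforce
  qed
qed

text \<open>The matrix and its inverse are lifted to a single \<open>G i\<close>, and the transfer
  theorem is applied with \<open>K = G i\<close> and auxiliary group \<open>G k\<close>, for
  \<open>k\<close> so large that the elements of \<open>F\<close> trivial in \<open>\<pi>\<close>
  are already trivial in \<open>G k\<close>.\<close>

theorem whitehead_trivial_det_direct_limit:
  fixes \<pi> :: "'p monoid"
  assumes triv: "\<And>i. i \<in> I \<Longrightarrow> whitehead_trivial_det (G i)"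
    and \<pi>: "group \<pi>" and iso: "\<pi> \<cong> direct_limit I R G \<phi>"
  shows "whitehead_trivial_det \<pi>"
  unfolding whitehead_trivial_det_def
proof (intro allI ballI)
  fix d A assume "A \<in> GL_group_ring \<pi> d"
  then obtain B where A: "A \<in> gr_matrices \<pi> d" and B: "B \<in> gr_matrices \<pi> d"
    and AB: "mat_is_one \<pi> d (mat_mult \<pi> d A B)" and BA: "mat_is_one \<pi> d (mat_mult \<pi> d B A)"
    by (auto simp: GL_group_ring_def)
  obtain \<theta> where \<theta>: "\<theta> \<in> Group.iso \<pi> (direct_limit I R G \<phi>)" using iso by (auto simp: is_iso_def)
  define \<psi> where "\<psi> = inv_into (carrier \<pi>) \<theta>"
  have \<psi>: "\<psi> \<in> Group.iso (direct_limit I R G \<phi>) \<pi>"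
    unfolding \<psi>_def by (rule group.iso_set_sym[OF \<pi> \<theta>])
  \<comment> \<open>The canonical map from \<open>G i\<close> into the limit, followed by the
    isomorphism onto \<open>\<pi>\<close>.\<close>
  define f where "f i x = \<psi> (cls i x)" for i x
  have cls_in: "cls i x \<in> carrier (direct_limit I R G \<phi>)" if "i \<in> I" "x \<in> carrier (G i)" for i x
    using that by (auto simp: direct_limit_def intro!: quotientI)
  have f_hom: "f i \<in> hom (G i) \<pi>" if i: "i \<in> I" for i
  proof (rule homI)
    show "f i x \<in> carrier \<pi>" if "x \<in> carrier (G i)" for x
      using \<psi> cls_in[OF i that] by (auto simp: f_def iso_def hom_def)
    show "f i (x \<otimes>\<^bsub>G i\<^esub> y) = f i x \<otimes>\<^bsub>\<pi>\<^esub> f i y" if "x \<in> carrier (G i)" "y \<in> carrier (G i)" for x y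
      using \<psi> cls_in[OF i] that unfolding f_def direct_limit_mult[OF i that, symmetric]
      by (auto simp: iso_def hom_def)
  qed
  have f_eq: "f i x = f j y \<longleftrightarrow> ((i, x), (j, y)) \<in> direct_limit_rel I R G \<phi>"
    if "i \<in> I" "x \<in> carrier (G i)" "j \<in> I" "y \<in> carrier (G j)" for i x j y
  proof -
    have "inj_on \<psi> (carrier (direct_limit I R G \<phi>))" using \<psi> by (simp add: iso_def bij_betw_def)
    then have "f i x = f j y \<longleftrightarrow> cls i x = cls j y"
      unfolding f_def using cls_in that by (auto dest: inj_onD)
    then show ?thesis using that by (simp add: eq_equiv_class_iff[OF direct_limit_rel_equiv])
  qed
  have f_\<phi>: "f j (\<phi> i j x) = f i x" if "i \<in> I" "j \<in> I" "R i j" "x \<in> carrier (G i)" for i j x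
    using that direct_system_refl[of j] direct_system_closed[of i j x] direct_system_comp[of i j j x]
    by (subst f_eq) (auto simp: direct_limit_rel_def intro!: bexI[of _ j])
  have f_surj: "\<exists>i\<in>I. \<exists>x\<in>carrier (G i). f i x = z" if "z \<in> carrier \<pi>" for z
  proof -
    have "z \<in> \<psi> ` carrier (direct_limit I R G \<phi>)" using \<psi> that by (auto simp: iso_def bij_betw_def)
    then show ?thesis by (auto simp: direct_limit_def f_def elim!: quotientE)
  qed
  define X where "X = (\<Union>i<d. \<Union>j<d. Poly_Mapping.keys (A i j) \<union> Poly_Mapping.keys (B i j))"
  have X: "finite X" "X \<subseteq> carrier \<pi>"
    using gr_matrices_carrier[OF A] gr_matrices_carrier[OF B] by (auto simp: X_def)
  obtain \<iota> g where \<iota>: "\<And>z. z \<in> X \<Longrightarrow> \<iota> z \<in> I \<and> g z \<in> carrier (G (\<iota> z)) \<and> f (\<iota> z) (g z) = z"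
    using f_surj X(2) by (metis subsetD)
  obtain i where i: "i \<in> I" "\<And>z. z \<in> X \<Longrightarrow> R (\<iota> z) i"
    using directed_index_finite[OF direct_system_directed, of "\<iota> ` X"] X(1) \<iota> by auto
  \<comment> \<open>A lift of the finitely many elements involved, as a map of sets only; nothing
    says that the lifts of \<open>A\<close> and \<open>B\<close> are inverse over
    \<open>G i\<close>.\<close>
  define s where "s z = \<phi> (\<iota> z) i (g z)" for z
  have s: "s z \<in> carrier (G i)" "f i (s z) = z" if "z \<in> X" for z
    using \<iota>[OF that] i that by (auto simp: s_def direct_system_closed f_\<phi>)
  have lift: "mat_push s M \<in> gr_matrices (G i) d" "\<And>a b. a < d \<Longrightarrow> b < d \<Longrightarrow> mat_push (f i) (mat_push s M) a b = M a b"
    if "\<And>a b. a < d \<Longrightarrow> b < d \<Longrightarrow> Poly_Mapping.keys (M a b) \<subseteq> X" for M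
  proof -
    show "mat_push s M \<in> gr_matrices (G i) d"
      unfolding gr_matrices_def group_ring_def mat_push_def using keys_gr_push[of s] that s(1) by blast
    fix a b assume ab: "a < d" "b < d"
    have "gr_push (\<lambda>z. f i (s z)) (M a b) = gr_push (\<lambda>z. z) (M a b)"
      using that[OF ab] s(2) by (intro gr_push_cong) auto
    then show "mat_push (f i) (mat_push s M) a b = M a b"
      by (simp add: mat_push_def gr_push_push gr_push_id)
  qed
  have keys: "Poly_Mapping.keys (A a b) \<subseteq> X" "Poly_Mapping.keys (B a b) \<subseteq> X" if "a < d" "b < d" for a b
    using that by (auto simp: X_def)
  note lA = lift[OF keys(1)] and lB = lift[OF keys(2)]
  let ?A = "mat_push (f i) (mat_push s A)" and ?B = "mat_push (f i) (mat_push s B)"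
  have cong: "mat_mult \<pi> d M N a b = mat_mult \<pi> d M' N' a b"
    if "\<And>a b. a < d \<Longrightarrow> b < d \<Longrightarrow> M a b = M' a b" "\<And>a b. a < d \<Longrightarrow> b < d \<Longrightarrow> N a b = N' a b" "a < d" "b < d"
    for M N M' N' a b
    using that by (auto simp: mat_mult_def)
  have "ln_det \<pi> d (mat_op \<pi> d (mat_mult \<pi> d (mat_star \<pi> ?A) ?A)) = 0"
  proof (rule ln_det_push_eq_0[OF direct_system_group[OF i(1)] \<pi> f_hom[OF i(1)] lA(1) lB(1)])
    show "mat_is_one \<pi> d (mat_mult \<pi> d ?A ?B)" "mat_is_one \<pi> d (mat_mult \<pi> d ?B ?A)"
      using AB BA cong[of ?A A ?B B] cong[of ?B B ?A A] lA(2) lB(2) by (simp_all add: mat_is_one_def)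
    fix F assume F: "finite F" "F \<subseteq> carrier (G i)"
    have one: "\<one>\<^bsub>G i\<^esub> \<in> carrier (G i)"
      using direct_system_group[OF i(1)] by (simp add: group.is_monoid monoid.one_closed)
    have f_one: "f i \<one>\<^bsub>G i\<^esub> = \<one>\<^bsub>\<pi>\<^esub>" by (rule hom_one[OF f_hom[OF i(1)] direct_system_group[OF i(1)] \<pi>])
    \<comment> \<open>An element that is trivial in the limit becomes trivial at some index and
      stays so above it.\<close>
    have "\<exists>k\<in>I. R i k \<and> (\<forall>m\<in>I. R k m \<longrightarrow> \<phi> i m x = \<phi> i m \<one>\<^bsub>G i\<^esub>)"
      if "x \<in> carrier (G i)" "f i x = \<one>\<^bsub>\<pi>\<^esub>" for x
    proof -
      have "((i, x), (i, \<one>\<^bsub>G i\<^esub>)) \<in> direct_limit_rel I R G \<phi>"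
        using f_eq[OF i(1) that(1) i(1) one] that(2) f_one by simp
      then show ?thesis by (rule direct_limit_rel_mono) blast
    qed
    then obtain \<kappa> where \<kappa>: "\<And>x. x \<in> carrier (G i) \<Longrightarrow> f i x = \<one>\<^bsub>\<pi>\<^esub> \<Longrightarrow>
      \<kappa> x \<in> I \<and> (\<forall>m\<in>I. R (\<kappa> x) m \<longrightarrow> \<phi> i m x = \<phi> i m \<one>\<^bsub>G i\<^esub>)" by metis
    \<comment> \<open>Including \<open>i\<close> puts the bound \<open>k\<close> above
      \<open>i\<close>, so that \<open>\<phi> i k\<close> is available even if nothing in
      \<open>F\<close> is trivial in \<open>\<pi>\<close>.\<close>
    have "insert i (\<kappa> ` {x \<in> F. f i x = \<one>\<^bsub>\<pi>\<^esub>}) \<subseteq> I" using F \<kappa> i(1) by blast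
    then obtain k where k: "k \<in> I" "R i k" "\<And>x. x \<in> F \<Longrightarrow> f i x = \<one>\<^bsub>\<pi>\<^esub> \<Longrightarrow> R (\<kappa> x) k"
      using directed_index_finite[OF direct_system_directed, of "insert i (\<kappa> ` {x \<in> F. f i x = \<one>\<^bsub>\<pi>\<^esub>})"] F(1)
      by auto
    have \<phi>_one: "\<phi> i k \<one>\<^bsub>G i\<^esub> = \<one>\<^bsub>G k\<^esub>"
      by (rule hom_one[OF direct_system_hom[OF i(1) k(1,2)] direct_system_group[OF i(1)] direct_system_group[OF k(1)]])
    have "\<phi> i k x = \<one>\<^bsub>G k\<^esub> \<longleftrightarrow> f i x = \<one>\<^bsub>\<pi>\<^esub>" if "x \<in> F" for x
    proof
      assume "f i x = \<one>\<^bsub>\<pi>\<^esub>"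
      then show "\<phi> i k x = \<one>\<^bsub>G k\<^esub>" using \<kappa>[of x] k(1) k(3)[OF that] that F \<phi>_one by auto
    next
      \<comment> \<open>This direction holds at every stage because \<open>f i\<close> factors
        through \<open>G k\<close>.\<close>
      assume "\<phi> i k x = \<one>\<^bsub>G k\<^esub>"
      moreover have "f k (\<phi> i k x) = f i x" using f_\<phi>[OF i(1) k(1,2)] that F by auto
      moreover have "f k \<one>\<^bsub>G k\<^esub> = \<one>\<^bsub>\<pi>\<^esub>" by (rule hom_one[OF f_hom[OF k(1)] direct_system_group[OF k(1)] \<pi>])
      ultimately show "f i x = \<one>\<^bsub>\<pi>\<^esub>" by simp
    qed
    then show "\<exists>(H :: 'a monoid) h. group H \<and> whitehead_trivial_det H \<and> h \<in> hom (G i) H \<and>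
        (\<forall>x\<in>F. h x = \<one>\<^bsub>H\<^esub> \<longleftrightarrow> f i x = \<one>\<^bsub>\<pi>\<^esub>)"
      using direct_system_group[OF k(1)] triv[OF k(1)] direct_system_hom[OF i(1) k(1,2)]
      by (intro exI[of _ "G k"] exI[of _ "\<phi> i k"]) auto
  qed
  \<comment> \<open>Lifting and pushing back returns \<open>A\<close> at indices below
    \<open>d\<close> only, which are the ones that \<open>mat_op\<close> reads.\<close>
  moreover have "mat_op \<pi> d (mat_mult \<pi> d (mat_star \<pi> ?A) ?A) = mat_op \<pi> d (mat_mult \<pi> d (mat_star \<pi> A) A)"
    using lA(2) by (intro mat_op_cong cong) (auto simp: mat_star_def)
  ultimately show "ln_det \<pi> d (mat_op \<pi> d (mat_mult \<pi> d (mat_star \<pi> A) A)) = 0" by simp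
qed

end

theorem theorem1p19:
  shows
   "(\<forall>(I :: 'i set) R (G :: 'i \<Rightarrow> 'a monoid) \<phi> (\<pi> :: 'p monoid).
       direct_system I R G \<phi> \<longrightarrow> (\<forall>i\<in>I. whitehead_trivial_det (G i)) \<longrightarrow>
       group \<pi> \<longrightarrow> \<pi> \<cong> direct_limit I R G \<phi> \<longrightarrow> whitehead_trivial_det \<pi>) \<and>
    (\<forall>(I :: 'j set) R (G :: 'j \<Rightarrow> 'b monoid) p (\<pi> :: 'q monoid).
       inverse_system I R G p \<longrightarrow> (\<forall>i\<in>I. whitehead_trivial_det (G i)) \<longrightarrow>
       group \<pi> \<longrightarrow> \<pi> \<cong> inverse_limit I R G p \<longrightarrow> whitehead_trivial_det \<pi>) \<and>
    (\<forall>(\<pi> :: 'c monoid) U.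
       group \<pi> \<longrightarrow> whitehead_trivial_det \<pi> \<longrightarrow> subgroup U \<pi> \<longrightarrow>
       whitehead_trivial_det (\<pi>\<lparr>carrier := U\<rparr>))"
  using whitehead_trivial_det_direct_limit whitehead_trivial_det_inverse_limit
    whitehead_trivial_det_subgroup by blast

end
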